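(* Hamilton's equation on the phase space $L^2(\mathbb{R}\to\mathbb{C})$ corresponding to the Hamiltonian $$\mathcal{H}_6(f)=\frac{2}{\pi}\int_{-\pi/4}^{\pi/4}\int_{\mathbb{R}}|e^{itH}f(x)|^6\,dx\,dt$$ is $$ i u_t(t) = \frac{12}{\pi}\int_{-\pi/4}^{\pi/4} e^{-isH}\left( |e^{isH}u(t)|^4\, e^{isH}u(t)\right) ds, $$ which is precisely, up to a rescaling of time, the resonant equation $$ iw_t(t)=\frac{2}{\pi}\int_{-\pi/4}^{\pi/4} e^{-isH}\left( |e^{isH}w(t)|^4\, e^{isH}w(t)\right) ds .$$
   Context: $H=-\Delta+x^2$ on $L^2(\mathbb{R})$, and $e^{itH}$ is the propagator of $iu_t+Hu=0$ (so $e^{itH}\phi_n=e^{it(2n+1)}\phi_n$ for the Hermite functions $\phi_n$, $H\phi_n=(2n+1)\phi_n$). $\langle f,g\rangle_{L^2}=\int_{\mathbb{R}}f\overline{g}\,dx$. The symplectic form on $L^2(\mathbb{R}\to\mathbb{C})$ is $\omega(f,g)=-\operatorname{Im}\langle f,g\rangle_{L^2}$. For a Hamiltonian $\mathcal{H}:L^2\to\mathbb{R}$, the symplectic gradient $\nabla_\omega\mathcal{H}$ is defined as the unique solution of $\omega(\nabla_\omega\mathcal{H}(f),g)=\frac{d}{d\epsilon}\big|_{\epsilon=0}\mathcal{H}(f+\epsilon g)$ for all $g$, and Hamilton's equation is $u_t=\nabla_\omega\mathcal{H}(u)$. *)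

theory Defs
  imports "HOL-Analysis.Analysis"
begin

section \<open>The Hilbert space \<open>L\<^sup>2(\<real> \<rightarrow> \<complex>)\<close>\<close>

definition square_integrable :: "(real \<Rightarrow> complex) \<Rightarrow> bool" where
  "square_integrable f \<longleftrightarrow>
     f \<in> borel_measurable lborel \<and> integrable lborel (\<lambda>x. (cmod (f x))\<^sup>2)"

lemma square_integrable_measurable [measurable_dest]:
  "square_integrable f \<Longrightarrow> f \<in> borel_measurable lborel"
  by (simp add: square_integrable_def)

lemma square_integrable_zero: "square_integrable (\<lambda>x. 0)"
  by (simp add: square_integrable_def)

lemma square_integrable_bound:
  assumes "square_integrable g" and [measurable]: "f \<in> borel_measurable lborel"
    and "AE x in lborel. cmod (f x) \<le> cmod (g x)"
  shows "square_integrable f"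
proof -
  have "integrable lborel (\<lambda>x. (cmod (f x))\<^sup>2)"
  proof (rule Bochner_Integration.integrable_bound)
    show "integrable lborel (\<lambda>x. (cmod (g x))\<^sup>2)"
      using assms(1) by (simp add: square_integrable_def)
    show "AE x in lborel. norm ((cmod (f x))\<^sup>2) \<le> norm ((cmod (g x))\<^sup>2)"
      using assms(3) by eventually_elim (simp add: power_mono)
  qed measurable
  then show ?thesis by (simp add: square_integrable_def)
qed

lemma square_integrable_add:
  assumes [measurable_dest]: "square_integrable f" "square_integrable g"
  shows "square_integrable (\<lambda>x. f x + g x)"
proof -
  have [measurable]: "f \<in> borel_measurable lborel" "g \<in> borel_measurable lborel"
    using assms by (auto simp: square_integrable_def)
  have bound: "(cmod (a + b))\<^sup>2 \<le> 2 * (cmod a)\<^sup>2 + 2 * (cmod b)\<^sup>2" for a b :: complex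
  proof -
    have "(cmod (a + b))\<^sup>2 \<le> (cmod a + cmod b)\<^sup>2"
      by (simp add: norm_triangle_ineq power_mono)
    also have "\<dots> \<le> 2 * (cmod a)\<^sup>2 + 2 * (cmod b)\<^sup>2"
      using sum_squares_bound[of "cmod a" "cmod b"] by (simp add: power2_sum)
    finally show ?thesis .
  qed
  have "integrable lborel (\<lambda>x. (cmod (f x + g x))\<^sup>2)"
  proof (rule Bochner_Integration.integrable_bound)
    show "integrable lborel (\<lambda>x. 2 * (cmod (f x))\<^sup>2 + 2 * (cmod (g x))\<^sup>2)"
      using assms by (auto simp: square_integrable_def)
    show "AE x in lborel. norm ((cmod (f x + g x))\<^sup>2)
            \<le> norm (2 * (cmod (f x))\<^sup>2 + 2 * (cmod (g x))\<^sup>2)"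
      using bound by (intro AE_I2) simp
  qed measurable
  then show ?thesis by (simp add: square_integrable_def)
qed

lemma square_integrable_scale:
  assumes "square_integrable f"
  shows "square_integrable (\<lambda>x. c * f x)"
  using assms by (auto simp: square_integrable_def norm_mult power_mult_distrib)

lemma borel_measurable_cnj [measurable (raw)]:
  "f \<in> borel_measurable M \<Longrightarrow> (\<lambda>x. cnj (f x)) \<in> borel_measurable M"
  by (rule borel_measurable_continuous_on[where f = cnj]) (auto intro: continuous_intros)

lemma integrable_mult_cnj:
  assumes "square_integrable f" "square_integrable g"
  shows "integrable lborel (\<lambda>x. f x * cnj (g x))"
proof (rule Bochner_Integration.integrable_bound)
  have [measurable]: "f \<in> borel_measurable lborel" "g \<in> borel_measurable lborel"
    using assms by (auto simp: square_integrable_def)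
  show "integrable lborel (\<lambda>x. (cmod (f x))\<^sup>2 + (cmod (g x))\<^sup>2)"
    using assms by (auto simp: square_integrable_def)
  show "AE x in lborel. norm (f x * cnj (g x)) \<le> norm ((cmod (f x))\<^sup>2 + (cmod (g x))\<^sup>2)"
  proof (intro AE_I2)
    fix x
    show "norm (f x * cnj (g x)) \<le> norm ((cmod (f x))\<^sup>2 + (cmod (g x))\<^sup>2)"
      using sum_squares_bound[of "cmod (f x)" "cmod (g x)"]
        mult_nonneg_nonneg[of "cmod (f x)" "cmod (g x)"]
      by (simp add: norm_mult del: mult_nonneg_nonneg)
  qed
  show "(\<lambda>x. f x * cnj (g x)) \<in> borel_measurable lborel"
    by measurable
qed

definition L2_rel :: "(real \<Rightarrow> complex) \<Rightarrow> (real \<Rightarrow> complex) \<Rightarrow> bool" where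
  "L2_rel f g \<longleftrightarrow> square_integrable f \<and> square_integrable g \<and> (AE x in lborel. f x = g x)"

lemma L2_rel_refl: "square_integrable f \<Longrightarrow> L2_rel f f"
  by (simp add: L2_rel_def)

text \<open>
  Every Lebesgue measurable function agrees almost everywhere with a Borel measurable one, so
  Borel measurable representatives suffice.
\<close>

quotient_type L2 = "real \<Rightarrow> complex" / partial: L2_rel
proof (rule part_equivpI)
  show "\<exists>f. L2_rel f f"
    using square_integrable_zero L2_rel_refl by blast
  show "symp L2_rel"
    by (auto simp: symp_def L2_rel_def)
  show "transp L2_rel"
    unfolding transp_def L2_rel_def by (auto elim: eventually_elim2)
qed

lemma L2_rel_rep: "L2_rel (rep_L2 f) (rep_L2 f)"
  using Quotient_rep_reflp[OF Quotient_L2] by simp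

lemma square_integrable_rep [simp]: "square_integrable (rep_L2 f)"
  using L2_rel_rep by (simp add: L2_rel_def)

lemma measurable_rep_L2 [measurable]: "rep_L2 f \<in> borel_measurable lborel"
  by (rule square_integrable_measurable) simp

lemma abs_rep_L2 [simp]: "abs_L2 (rep_L2 f) = f"
  using Quotient_abs_rep[OF Quotient_L2] by simp

lemma abs_L2_eq_iff:
  assumes "square_integrable f" "square_integrable g"
  shows "abs_L2 f = abs_L2 g \<longleftrightarrow> (AE x in lborel. f x = g x)"
  using Quotient_rel[OF Quotient_L2, of f g] assms by (auto simp: L2_rel_def)

lemma rep_abs_L2:
  assumes "square_integrable f"
  shows "AE x in lborel. rep_L2 (abs_L2 f) x = f x"
  using abs_L2_eq_iff[of "rep_L2 (abs_L2 f)" f] assms by simp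

instantiation L2 :: real_vector
begin

lift_definition zero_L2 :: L2 is "\<lambda>x. 0"
  by (simp add: L2_rel_def square_integrable_zero)

lift_definition plus_L2 :: "L2 \<Rightarrow> L2 \<Rightarrow> L2" is "\<lambda>f g x. f x + g x"
  by (auto simp: L2_rel_def square_integrable_add elim: eventually_elim2)

lift_definition uminus_L2 :: "L2 \<Rightarrow> L2" is "\<lambda>f x. - f x"
  using square_integrable_scale[where c = "-1"]
  by (auto simp: L2_rel_def)

definition minus_L2 :: "L2 \<Rightarrow> L2 \<Rightarrow> L2" where
  "minus_L2 f g = f + - g"

lift_definition scaleR_L2 :: "real \<Rightarrow> L2 \<Rightarrow> L2" is "\<lambda>c f x. of_real c * f x"
  by (auto simp: L2_rel_def square_integrable_scale)

instance
proof
  fix f g h :: L2 and a b :: real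
  note [simp] = L2_rel_def square_integrable_scale square_integrable_add square_integrable_zero
  have neg: "square_integrable (\<lambda>x. - f x)" if "square_integrable f" for f
    using square_integrable_scale[OF that, where c = "-1"] by simp
  show "f + g + h = f + (g + h)" by transfer (auto simp: add.assoc)
  show "f + g = g + f" by transfer (auto simp: add.commute)
  show "0 + f = f" by transfer auto
  show "- f + f = 0" by transfer (auto simp: neg)
  show "f - g = f + - g" by (simp add: minus_L2_def)
  show "a *\<^sub>R (f + g) = a *\<^sub>R f + a *\<^sub>R g" by transfer (auto simp: distrib_left)
  show "(a + b) *\<^sub>R f = a *\<^sub>R f + b *\<^sub>R f" by transfer (auto simp: distrib_right)
  show "a *\<^sub>R b *\<^sub>R f = (a * b) *\<^sub>R f" by transfer (auto simp: mult.assoc)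
  show "1 *\<^sub>R f = f" by transfer auto
qed

end

lift_definition scaleC :: "complex \<Rightarrow> L2 \<Rightarrow> L2" (infixr \<open>*\<^sub>C\<close> 75) is "\<lambda>c f x. c * f x"
  by (auto simp: L2_rel_def square_integrable_scale)

text \<open>Antilinear in the second argument.\<close>

lift_definition cinner :: "L2 \<Rightarrow> L2 \<Rightarrow> complex" is
  "\<lambda>f g. LINT x|lborel. f x * cnj (g x)"
proof -
  fix f f' g g' :: "real \<Rightarrow> complex"
  assume rel: "L2_rel f f'" "L2_rel g g'"
  then have "AE x in lborel. f x * cnj (g x) = f' x * cnj (g' x)"
    by (auto simp: L2_rel_def elim: eventually_elim2)
  moreover have "(\<lambda>x. f x * cnj (g x)) \<in> borel_measurable lborel"
    "(\<lambda>x. f' x * cnj (g' x)) \<in> borel_measurable lborel"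
    using rel by (auto simp: L2_rel_def dest!: square_integrable_measurable)
  ultimately show "(LINT x|lborel. f x * cnj (g x)) = (LINT x|lborel. f' x * cnj (g' x))"
    by (intro integral_cong_AE)
qed

instantiation L2 :: real_inner
begin

definition inner_L2 :: "L2 \<Rightarrow> L2 \<Rightarrow> real" where
  "inner_L2 f g = Re (cinner f g)"

definition norm_L2 :: "L2 \<Rightarrow> real" where
  "norm_L2 f = sqrt (inner f f)"

definition dist_L2 :: "L2 \<Rightarrow> L2 \<Rightarrow> real" where
  "dist_L2 f g = norm (f - g)"

definition sgn_L2 :: "L2 \<Rightarrow> L2" where
  "sgn_L2 f = f /\<^sub>R norm f"

definition uniformity_L2 :: "(L2 \<times> L2) filter" where
  "uniformity_L2 = (INF e\<in>{0<..}. principal {(f, g). dist f g < e})"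

definition open_L2 :: "L2 set \<Rightarrow> bool" where
  "open_L2 U \<longleftrightarrow> (\<forall>f\<in>U. \<forall>\<^sub>F (f', g) in uniformity. f' = f \<longrightarrow> g \<in> U)"

instance
proof
  fix f g h :: L2 and c :: real
  show "dist f g = norm (f - g)" by (simp add: dist_L2_def)
  show "sgn f = f /\<^sub>R norm f" by (simp add: sgn_L2_def)
  show "uniformity = (INF e\<in>{0<..}. principal {(f, g :: L2). dist f g < e})"
    by (simp add: uniformity_L2_def)
  show "open U \<longleftrightarrow> (\<forall>f\<in>U. \<forall>\<^sub>F (f', g) in uniformity. f' = f \<longrightarrow> g \<in> U)" for U :: "L2 set"
    by (simp add: open_L2_def)
  show "norm f = sqrt (inner f f)" by (simp add: norm_L2_def)
  have "cinner g f = cnj (cinner f g)"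
  proof transfer
    fix f g :: "real \<Rightarrow> complex"
    have "cnj (LINT x|lborel. f x * cnj (g x)) = (LINT x|lborel. cnj (f x * cnj (g x)))"
      by (rule Bochner_Integration.integral_cnj[symmetric])
    also have "\<dots> = (LINT x|lborel. g x * cnj (f x))"
      by (simp add: mult.commute)
    finally show "(LINT x|lborel. g x * cnj (f x)) = cnj (LINT x|lborel. f x * cnj (g x))" ..
  qed
  then show "inner f g = inner g f" by (simp add: inner_L2_def)
  show "inner (f + g) h = inner f h + inner g h"
    unfolding inner_L2_def
    by transfer (simp add: L2_rel_def distrib_right integrable_mult_cnj)
  show "inner (c *\<^sub>R f) g = c * inner f g"
    unfolding inner_L2_def by transfer (simp add: L2_rel_def mult.assoc)
  have self: "Re (LINT x|lborel. u x * cnj (u x)) = (LINT x|lborel. (cmod (u x))\<^sup>2)" for u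
    by (simp flip: complex_norm_square of_real_power)
  show "0 \<le> inner f f"
    unfolding inner_L2_def by transfer (simp add: self)
  show "inner f f = 0 \<longleftrightarrow> f = 0"
    unfolding inner_L2_def
    by transfer
      (auto simp: self L2_rel_def square_integrable_zero square_integrable_def
        integral_nonneg_eq_0_iff_AE)
qed

end

lemma norm_abs_L2:
  assumes "square_integrable f"
  shows "norm (abs_L2 f) = sqrt (LINT x|lborel. (cmod (f x))\<^sup>2)"
proof -
  have "cinner (abs_L2 f) (abs_L2 f) = (LINT x|lborel. f x * cnj (f x))"
    using assms by (simp add: cinner.abs_eq L2_rel_refl)
  moreover have "Re (LINT x|lborel. f x * cnj (f x)) = (LINT x|lborel. (cmod (f x))\<^sup>2)"
    by (simp flip: complex_norm_square of_real_power)
  ultimately show ?thesis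
    by (simp add: norm_L2_def inner_L2_def)
qed

lemma abs_L2_diff:
  assumes "square_integrable f" "square_integrable g"
  shows "abs_L2 f - abs_L2 g = abs_L2 (\<lambda>x. f x - g x)"
  using assms square_integrable_scale[of g "-1"]
  by (simp add: minus_L2_def uminus_L2.abs_eq plus_L2.abs_eq L2_rel_refl)


lemma tendsto_abs_L2:
  assumes [measurable]: "\<And>k. F k \<in> borel_measurable lborel" "f \<in> borel_measurable lborel"
    and g: "square_integrable g"
    and bound: "\<And>k. AE x in lborel. cmod (F k x) \<le> cmod (g x)"
    and lim: "AE x in lborel. (\<lambda>k. F k x) \<longlonglongrightarrow> f x"
  shows "(\<lambda>k. abs_L2 (F k)) \<longlonglongrightarrow> abs_L2 f"
proof -
  have [measurable]: "g \<in> borel_measurable lborel"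
    using g by (rule square_integrable_measurable)
  have sq_F: "square_integrable (F k)" for k
    by (rule square_integrable_bound[OF g _ bound]) measurable
  have "AE x in lborel. \<forall>k. cmod (F k x) \<le> cmod (g x)"
    using bound by (simp add: AE_all_countable)
  with lim have fg: "AE x in lborel. cmod (f x) \<le> cmod (g x)"
  proof eventually_elim
    case (elim x)
    show ?case
      by (rule LIMSEQ_le_const2[OF tendsto_norm[OF elim(1)]]) (use elim in auto)
  qed
  have sq_f: "square_integrable f"
    by (rule square_integrable_bound[OF g _ fg]) measurable
  have "(\<lambda>k. LINT x|lborel. (cmod (F k x - f x))\<^sup>2) \<longlonglongrightarrow> (LINT (x::real)|lborel. (0::real))"
  proof (rule integral_dominated_convergence)
    show "integrable lborel (\<lambda>x. 4 * (cmod (g x))\<^sup>2)"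
      using g by (simp add: square_integrable_def)
    show "AE x in lborel. (\<lambda>k. (cmod (F k x - f x))\<^sup>2) \<longlonglongrightarrow> 0"
      using lim
    proof eventually_elim
      case (elim x)
      then have "(\<lambda>k. (cmod (F k x - f x))\<^sup>2) \<longlonglongrightarrow> (cmod (f x - f x))\<^sup>2"
        by (intro tendsto_intros)
      then show ?case by simp
    qed
    show "AE x in lborel. norm ((cmod (F k x - f x))\<^sup>2) \<le> 4 * (cmod (g x))\<^sup>2" for k
      using bound[of k] fg
    proof eventually_elim
      case (elim x)
      have "cmod (F k x - f x) \<le> 2 * cmod (g x)"
        using norm_triangle_ineq4[of "F k x" "f x"] elim by simp
      then have "(cmod (F k x - f x))\<^sup>2 \<le> (2 * cmod (g x))\<^sup>2"
        by (intro power_mono) auto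
      then show ?case by (simp add: power_mult_distrib)
    qed
  qed measurable
  moreover have "norm (abs_L2 (F k) - abs_L2 f) = sqrt (LINT x|lborel. (cmod (F k x - f x))\<^sup>2)" for k
    using square_integrable_add[OF sq_F[of k] square_integrable_scale[OF sq_f, of "-1"]]
    by (simp add: abs_L2_diff sq_F sq_f norm_abs_L2)
  ultimately have "(\<lambda>k. norm (abs_L2 (F k) - abs_L2 f)) \<longlonglongrightarrow> 0"
    by (auto dest: tendsto_real_sqrt)
  then show ?thesis
    by (rule LIM_zero_cancel[OF tendsto_norm_zero_cancel])
qed

lemma nn_integral_rep_L2_diff:
  "(\<integral>\<^sup>+ x. ennreal ((cmod (rep_L2 f x - rep_L2 g x))\<^sup>2) \<partial>lborel) = ennreal ((dist f g)\<^sup>2)"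
proof -
  have sq: "square_integrable (\<lambda>x. rep_L2 f x - rep_L2 g x)"
    using square_integrable_add[of "rep_L2 f" "\<lambda>x. -1 * rep_L2 g x"]
      square_integrable_scale[of "rep_L2 g" "-1"] by simp
  have "dist f g = norm (abs_L2 (rep_L2 f) - abs_L2 (rep_L2 g))"
    by (simp add: dist_norm)
  also have "\<dots> = sqrt (LINT x|lborel. (cmod (rep_L2 f x - rep_L2 g x))\<^sup>2)"
    by (subst abs_L2_diff) (simp_all add: norm_abs_L2 sq)
  finally have "(dist f g)\<^sup>2 = (LINT x|lborel. (cmod (rep_L2 f x - rep_L2 g x))\<^sup>2)"
    by (simp add: integral_nonneg_AE)
  moreover have "integrable lborel (\<lambda>x. (cmod (rep_L2 f x - rep_L2 g x))\<^sup>2)"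
    using sq by (simp add: square_integrable_def)
  ultimately show ?thesis
    by (simp add: nn_integral_eq_integral)
qed

text \<open>The Riesz--Fischer theorem.\<close>

instance L2 :: complete_space
proof
  fix X :: "nat \<Rightarrow> L2"
  assume X: "Cauchy X"
  have "\<exists>r. strict_mono r \<and> (\<forall>n. \<forall>m\<ge>r n. dist (X m) (X (r n)) < (1/2) ^ n)"
  proof -
    have "\<exists>N. \<forall>m\<ge>N. \<forall>k\<ge>N. dist (X m) (X k) < (1/2) ^ n" for n
      using X unfolding Cauchy_def by (meson half_gt_zero_iff zero_less_one zero_less_power)
    then obtain N where N: "\<And>n m k. m \<ge> N n \<Longrightarrow> k \<ge> N n \<Longrightarrow> dist (X m) (X k) < (1/2) ^ n"
      by metis
    define r where "r n = n + (\<Sum>i\<le>n. N i)" for n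
    have "strict_mono r"
      by (simp add: strict_mono_Suc_iff r_def)
    moreover have "N n \<le> r n" for n
      by (simp add: r_def trans_le_add2 member_le_sum)
    ultimately show ?thesis
      using N by (meson order_refl order_trans)
  qed
  then obtain r where r: "strict_mono r"
    "\<And>n m. m \<ge> r n \<Longrightarrow> dist (X m) (X (r n)) < (1/2) ^ n"
    by blast
  define f where "f n = rep_L2 (X (r n))" for n
  have [measurable]: "f n \<in> borel_measurable lborel" for n
    by (simp add: f_def)
  define d where "d n x = (cmod (f (Suc n) x - f n x))\<^sup>2" for n x
  have [measurable]: "d n \<in> borel_measurable lborel" for n
    unfolding d_def by measurable
  have d_int: "(\<integral>\<^sup>+ x. ennreal (2 ^ n * d n x) \<partial>lborel) \<le> ennreal ((1/2) ^ n)" for n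
  proof -
    have "dist (X (r (Suc n))) (X (r n)) \<le> (1/2) ^ n"
      using r(2)[of n "r (Suc n)"] strict_mono_less_eq[OF r(1), of n "Suc n"] by simp
    then have "(dist (X (r (Suc n))) (X (r n)))\<^sup>2 \<le> ((1/2) ^ n)\<^sup>2"
      by (intro power_mono) auto
    then have "2 ^ n * (dist (X (r (Suc n))) (X (r n)))\<^sup>2 \<le> 2 ^ n * ((1/2::real) ^ n)\<^sup>2"
      by (intro mult_left_mono) auto
    also have "\<dots> = (1/2) ^ n"
      by (simp add: power_one_over power2_eq_square)
    finally have "2 ^ n * (dist (X (r (Suc n))) (X (r n)))\<^sup>2 \<le> (1/2::real) ^ n" .
    moreover have "(\<integral>\<^sup>+ x. ennreal (2 ^ n * d n x) \<partial>lborel)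
        = ennreal (2 ^ n) * (\<integral>\<^sup>+ x. ennreal (d n x) \<partial>lborel)"
      by (subst nn_integral_cmult[symmetric]) (auto simp: ennreal_mult d_def)
    moreover have "(\<integral>\<^sup>+ x. ennreal (d n x) \<partial>lborel) = ennreal ((dist (X (r (Suc n))) (X (r n)))\<^sup>2)"
      unfolding d_def f_def by (rule nn_integral_rep_L2_diff)
    ultimately show ?thesis
      by (simp add: ennreal_leI flip: ennreal_mult)
  qed
  have "(\<integral>\<^sup>+ x. (\<Sum>n. ennreal (2 ^ n * d n x)) \<partial>lborel) = (\<Sum>n. \<integral>\<^sup>+ x. ennreal (2 ^ n * d n x) \<partial>lborel)"
    by (rule nn_integral_suminf) measurable
  also have "\<dots> \<le> (\<Sum>n. ennreal ((1/2) ^ n))"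
    by (intro suminf_le d_int) auto
  also have "\<dots> = ennreal (\<Sum>n. (1/2) ^ n)"
    by (intro suminf_ennreal2) (auto intro: summable_geometric)
  also have "\<dots> < \<infinity>"
    by simp
  finally have "AE x in lborel. (\<Sum>n. ennreal (2 ^ n * d n x)) \<noteq> \<infinity>"
    by (intro nn_integral_PInf_AE) auto
  then have conv: "AE x in lborel. convergent (\<lambda>n. f n x)"
  proof eventually_elim
    case (elim x)
    have d_nonneg: "0 \<le> d n x" for n by (simp add: d_def)
    have "summable (\<lambda>n. 2 ^ n * d n x)"
      using elim d_nonneg by (intro summable_suminf_not_top) simp_all
    then have "Bseq (\<lambda>n. 2 ^ n * d n x)"
      by (intro convergent_imp_Bseq convergentI[OF summable_LIMSEQ_zero])
    then obtain C where "\<forall>n. norm (2 ^ n * d n x) \<le> C"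
      by (rule BseqE)
    then have C: "2 ^ n * d n x \<le> C" for n
      by (metis abs_le_D1 real_norm_def)
    have "summable (\<lambda>n. f (Suc n) x - f n x)"
    proof (rule summable_comparison_test')
      show "summable (\<lambda>n. sqrt C * sqrt (1/2) ^ n)"
        by (intro summable_mult summable_geometric) (simp add: real_sqrt_lt_1_iff)
      fix n
      have "d n x \<le> C * (1/2) ^ n"
        using C[of n] by (simp add: field_simps power_one_over)
      then have "sqrt (d n x) \<le> sqrt (C * (1/2) ^ n)"
        by simp
      then show "norm (f (Suc n) x - f n x) \<le> sqrt C * sqrt (1/2) ^ n"
        by (simp add: d_def real_sqrt_mult real_sqrt_power)
    qed
    then have "convergent (\<lambda>n. (\<Sum>i<n. f (Suc i) x - f i x))"
      by (simp only: summable_iff_convergent)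
    then have "convergent (\<lambda>n. f n x - f 0 x)"
      unfolding sum_lessThan_telescope[of "\<lambda>i. f i x"] .
    from convergent_add[OF this convergent_const[of "f 0 x"]]
    show ?case by simp
  qed
  define g where "g x = lim (\<lambda>n. f n x)" for x
  have [measurable]: "g \<in> borel_measurable lborel"
    unfolding g_def by measurable
  have g_close: "(\<integral>\<^sup>+ x. ennreal ((cmod (g x - f k x))\<^sup>2) \<partial>lborel) \<le> ennreal (((1/2) ^ k)\<^sup>2)" for k
  proof -
    have "(\<integral>\<^sup>+ x. ennreal ((cmod (g x - f k x))\<^sup>2) \<partial>lborel)
        = (\<integral>\<^sup>+ x. liminf (\<lambda>n. ennreal ((cmod (f n x - f k x))\<^sup>2)) \<partial>lborel)"
    proof (rule nn_integral_cong_AE)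
      show "AE x in lborel. ennreal ((cmod (g x - f k x))\<^sup>2)
          = liminf (\<lambda>n. ennreal ((cmod (f n x - f k x))\<^sup>2))"
        using conv
      proof eventually_elim
        case (elim x)
        then have "(\<lambda>n. f n x) \<longlonglongrightarrow> g x"
          by (simp add: g_def convergent_LIMSEQ_iff)
        then have "(\<lambda>n. ennreal ((cmod (f n x - f k x))\<^sup>2)) \<longlonglongrightarrow> ennreal ((cmod (g x - f k x))\<^sup>2)"
          by (intro tendsto_ennrealI tendsto_intros)
        then show ?case
          by (intro lim_imp_Liminf[symmetric]) auto
      qed
    qed
    also have "\<dots> \<le> liminf (\<lambda>n. \<integral>\<^sup>+ x. ennreal ((cmod (f n x - f k x))\<^sup>2) \<partial>lborel)"
      by (rule nn_integral_liminf) measurable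
    also have "\<dots> = liminf (\<lambda>n. ennreal ((dist (X (r n)) (X (r k)))\<^sup>2))"
      unfolding f_def nn_integral_rep_L2_diff ..
    also have "\<dots> \<le> limsup (\<lambda>n. ennreal ((dist (X (r n)) (X (r k)))\<^sup>2))"
      by (simp add: Liminf_le_Limsup)
    also have "\<dots> \<le> ennreal (((1/2) ^ k)\<^sup>2)"
    proof (rule Limsup_bounded)
      show "\<forall>\<^sub>F n in sequentially. ennreal ((dist (X (r n)) (X (r k)))\<^sup>2) \<le> ennreal (((1/2) ^ k)\<^sup>2)"
        using eventually_ge_at_top[of k]
      proof eventually_elim
        case (elim n)
        then have "dist (X (r n)) (X (r k)) < (1/2) ^ k"
          using r(2) strict_mono_less_eq[OF r(1)] by simp
        then show ?case
          by (intro ennreal_leI power_mono) auto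
      qed
    qed
    finally show ?thesis .
  qed
  have sq_diff: "square_integrable (\<lambda>x. g x - f k x)" for k
    unfolding square_integrable_def
  proof
    show "integrable lborel (\<lambda>x. (cmod (g x - f k x))\<^sup>2)"
      using le_less_trans[OF g_close[of k] ennreal_less_top]
      by (intro integrableI_bounded) simp_all
  qed measurable
  have sq_g: "square_integrable g"
    using square_integrable_add[OF sq_diff[of 0], of "f 0"] by (simp add: f_def)
  have "dist (X (r k)) (abs_L2 g) \<le> (1/2) ^ k" for k
  proof -
    have "AE x in lborel. rep_L2 (abs_L2 g) x = g x"
      by (rule rep_abs_L2[OF sq_g])
    then have "(\<integral>\<^sup>+ x. ennreal ((cmod (rep_L2 (abs_L2 g) x - rep_L2 (X (r k)) x))\<^sup>2) \<partial>lborel)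
        = (\<integral>\<^sup>+ x. ennreal ((cmod (g x - f k x))\<^sup>2) \<partial>lborel)"
      by (intro nn_integral_cong_AE) (auto simp: f_def)
    then have "ennreal ((dist (abs_L2 g) (X (r k)))\<^sup>2) \<le> ennreal (((1/2) ^ k)\<^sup>2)"
      using g_close[of k] by (simp add: nn_integral_rep_L2_diff)
    then have "(dist (abs_L2 g) (X (r k)))\<^sup>2 \<le> ((1/2) ^ k)\<^sup>2"
      by (subst (asm) ennreal_le_iff) auto
    then show ?thesis
      by (simp add: dist_commute power2_le_iff_abs_le)
  qed
  then have "(\<lambda>k. dist (X (r k)) (abs_L2 g)) \<longlonglongrightarrow> 0"
    by (intro tendsto_sandwich[OF _ _ tendsto_const LIMSEQ_realpow_zero[of "1/2"]])
      (auto intro!: always_eventually)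
  then have "(X \<circ> r) \<longlonglongrightarrow> abs_L2 g"
    by (subst tendsto_dist_iff) (simp add: o_def)
  then show "convergent X"
    by (intro convergentI Cauchy_converges_subseq[OF X r(1)])
qed

instance L2 :: banach ..

text \<open>
  Separability. It is needed because the Bochner integral of the library is restricted to
  second countable spaces.
\<close>

lemma countable_dense_imp_countable_subbasis:
  fixes D :: "'a :: metric_space set"
  assumes "countable D" and dense: "\<And>x e. e > 0 \<Longrightarrow> \<exists>d\<in>D. dist d x < e"
  shows "\<exists>B :: 'a set set. countable B \<and> open = generate_topology B"
proof (intro exI conjI)
  let ?B = "(\<lambda>(d, n). ball d (1 / real (Suc n))) ` (D \<times> (UNIV :: nat set))"
  show "countable ?B"
    using assms(1) by auto
  have "topological_basis ?B"
  proof (rule topological_basisI)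
    show "open b" if "b \<in> ?B" for b
      using that by auto
    fix U and x :: 'a
    assume "open U" "x \<in> U"
    then obtain e where e: "e > 0" "ball x e \<subseteq> U"
      by (auto simp: open_contains_ball)
    obtain n where n: "1 / real (Suc n) < e / 2"
      using nat_approx_posE[of "e / 2"] e(1) by auto
    obtain d where d: "d \<in> D" "dist d x < 1 / real (Suc n)"
      using dense[of "1 / real (Suc n)" x] by auto
    have "ball d (1 / real (Suc n)) \<subseteq> ball x e"
    proof
      fix y
      assume "y \<in> ball d (1 / real (Suc n))"
      then have "dist x y < 1 / real (Suc n) + 1 / real (Suc n)"
        using dist_triangle[of x y d] d(2) by (simp add: dist_commute)
      then show "y \<in> ball x e"
        using n by simp
    qed
    then show "\<exists>b\<in>?B. x \<in> b \<and> b \<subseteq> U"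
      using d e(2) by (intro bexI[of _ "ball d (1 / real (Suc n))"]) auto
  qed
  then show "open = generate_topology ?B"
    by (rule topological_basis_imp_subbasis)
qed

lemma borel_eq_rat_lessThan:
  "sets (borel :: real measure) = sigma_sets UNIV (range (\<lambda>q::rat. {..<of_rat q}))"
proof -
  have "(borel :: real measure) = sigma UNIV (range (\<lambda>q::rat. {..<of_rat q}))"
  proof (rule borel_eq_sigmaI1)
    show "borel = sigma UNIV (range (\<lambda>a::real. {x. eucl_less x a}))"
      by (rule borel_eq_lessThan)
    fix X :: "real set"
    assume "X \<in> range (\<lambda>a. {x. eucl_less x a})"
    then obtain a where X: "X = {..<a}"
      by (auto simp: eucl_less_def)
    have "{..<a} = (\<Union>q\<in>{q::rat. of_rat q < a}. {..<of_rat q})"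
    proof (intro set_eqI iffI)
      fix x
      assume "x \<in> {..<a}"
      then obtain q where "x < of_rat q" "of_rat q < a"
        using of_rat_dense[of x a] by auto
      then show "x \<in> (\<Union>q\<in>{q::rat. of_rat q < a}. {..<of_rat q})"
        by auto
    qed auto
    moreover have "(\<Union>q\<in>{q::rat. of_rat q < a}. {..<of_rat q})
        \<in> sigma_sets UNIV (range (\<lambda>q::rat. {..<of_rat q :: real}))"
      by (intro sigma_sets_UNION) auto
    ultimately show "X \<in> sets (sigma UNIV (range (\<lambda>q::rat. {..<of_rat q})))"
      by (simp add: X)
  qed auto
  then show ?thesis
    by (metis sets_measure_of subset_UNIV Pow_UNIV)
qed

lemma square_integrable_indicator:
  assumes [measurable]: "A \<in> sets borel"
  shows "square_integrable (\<lambda>x. c * (indicator A x * indicator {- real n..real n} x))"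
proof (rule square_integrable_scale, rule square_integrable_bound)
  have "integrable lborel (indicator {- real n..real n} :: real \<Rightarrow> real)"
    by simp
  moreover have "(\<lambda>x. (cmod (indicator {- real n..real n} x))\<^sup>2) = indicator {- real n..real n}"
    by (auto split: split_indicator)
  ultimately show "square_integrable (indicator {- real n..real n})"
    by (simp add: square_integrable_def)
  show "(\<lambda>x. indicator A x * indicator {- real n..real n} x :: complex) \<in> borel_measurable lborel"
    by measurable
qed (auto split: split_indicator)

lemma L2_countable_dense:
  obtains D :: "L2 set" where "countable D" "\<And>f. f \<in> closure D"
proof
  define ind :: "complex \<Rightarrow> nat \<Rightarrow> real set \<Rightarrow> L2"
    where "ind c n A = abs_L2 (\<lambda>x. c * (indicator A x * indicator {- real n..real n} x))" for c n A
  define G where "G = (\<lambda>(c, n, q::rat). ind c n {..<of_rat q}) ` ({1, \<i>} \<times> UNIV \<times> UNIV)"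
  define D where "D = (\<lambda>l. \<Sum>(n, q)\<leftarrow>l. of_rat q *\<^sub>R from_nat_into G n) ` (UNIV :: (nat \<times> rat) list set)"
  show "countable D"
    unfolding D_def by (intro countable_image countableI_type)

  have "countable G" "G \<noteq> {}"
    by (auto simp: G_def)
  have G_D: "g \<in> D" if "g \<in> G" for g
  proof -
    obtain n where "from_nat_into G n = g"
      using from_nat_into_surj[OF \<open>countable G\<close> \<open>g \<in> G\<close>] by auto
    then have "g = (\<Sum>(n, q)\<leftarrow>[(n, 1)]. of_rat q *\<^sub>R from_nat_into G n)"
      by simp
    then show ?thesis
      unfolding D_def by blast
  qed
  have D_add: "f + g \<in> D" if "f \<in> D" "g \<in> D" for f g
  proof -
    obtain l k where "f = (\<Sum>(n, q)\<leftarrow>l. of_rat q *\<^sub>R from_nat_into G n)"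
      "g = (\<Sum>(n, q)\<leftarrow>k. of_rat q *\<^sub>R from_nat_into G n)"
      using \<open>f \<in> D\<close> \<open>g \<in> D\<close> by (auto simp: D_def)
    then have "f + g = (\<Sum>(n, q)\<leftarrow>l @ k. of_rat q *\<^sub>R from_nat_into G n)"
      by simp
    then show ?thesis
      unfolding D_def by blast
  qed
  have D_scale: "of_rat p *\<^sub>R f \<in> D" if "f \<in> D" for f p
  proof -
    obtain l where l: "f = (\<Sum>(n, q)\<leftarrow>l. of_rat q *\<^sub>R from_nat_into G n)"
      using \<open>f \<in> D\<close> by (auto simp: D_def)
    have "of_rat p *\<^sub>R f = (\<Sum>(n, q)\<leftarrow>map (map_prod id ((*) p)) l. of_rat q *\<^sub>R from_nat_into G n)"
      unfolding l by (induction l) (auto simp: scaleR_add_right of_rat_mult)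
    then show ?thesis
      unfolding D_def by blast
  qed

  have C_add: "f + g \<in> closure D" if fg: "f \<in> closure D" "g \<in> closure D" for f g
  proof -
    obtain X Y where "\<And>n. X n \<in> D" "X \<longlonglongrightarrow> f" "\<And>n. Y n \<in> D" "Y \<longlonglongrightarrow> g"
      using fg unfolding closure_sequential by blast
    then have "\<And>n. X n + Y n \<in> D" "(\<lambda>n. X n + Y n) \<longlonglongrightarrow> f + g"
      by (auto intro: D_add tendsto_add)
    then show ?thesis
      unfolding closure_sequential by (intro exI[of _ "\<lambda>n. X n + Y n"]) simp
  qed
  have C_scale: "a *\<^sub>R f \<in> closure D" if f: "f \<in> closure D" for f a
  proof -
    obtain X where X: "\<And>n. X n \<in> D" "X \<longlonglongrightarrow> f"
      using f unfolding closure_sequential by blast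
    have "\<exists>q::rat. a < of_rat q \<and> of_rat q < a + 1 / real (Suc n)" for n
      by (rule of_rat_dense) simp
    then obtain q :: "nat \<Rightarrow> rat" where q: "\<And>n. a < of_rat (q n)" "\<And>n. of_rat (q n) < a + 1 / real (Suc n)"
      by metis
    have "(\<lambda>n. a + 1 / real (Suc n)) \<longlonglongrightarrow> a + 0"
      by (intro tendsto_intros LIMSEQ_Suc lim_1_over_n)
    then have lim: "(\<lambda>n. a + 1 / real (Suc n)) \<longlonglongrightarrow> a"
      by simp
    have "(\<lambda>n. of_rat (q n)) \<longlonglongrightarrow> a"
    proof (rule tendsto_sandwich[OF _ _ tendsto_const lim])
      show "\<forall>\<^sub>F n in sequentially. a \<le> of_rat (q n)"
        by (intro always_eventually allI less_imp_le q)
      show "\<forall>\<^sub>F n in sequentially. of_rat (q n) \<le> a + 1 / real (Suc n)"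
        by (intro always_eventually allI less_imp_le q)
    qed
    then have "(\<lambda>n. of_rat (q n) *\<^sub>R X n) \<longlonglongrightarrow> a *\<^sub>R f"
      by (intro tendsto_scaleR X)
    moreover have "of_rat (q n) *\<^sub>R X n \<in> D" for n
      by (intro D_scale X)
    ultimately show ?thesis
      unfolding closure_sequential by (intro exI[of _ "\<lambda>n. of_rat (q n) *\<^sub>R X n"]) simp
  qed
  have C_diff: "f - g \<in> closure D" if "f \<in> closure D" "g \<in> closure D" for f g
    using C_add[OF that(1) C_scale[OF that(2), of "-1"]] by simp
  have C_lim: "f \<in> closure D" if "\<And>k::nat. X k \<in> closure D" "X \<longlonglongrightarrow> f" for X f
    using that closed_sequentially[OF closed_closure] by blast
  have "0 \<in> closure D"
    using C_scale[of _ 0] G_D closure_subset \<open>G \<noteq> {}\<close> by fastforce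

  have ind_C: "ind c n A \<in> closure D" if c: "c \<in> {1, \<i>}" and A: "A \<in> sets borel" for c n A
  proof -
    let ?G = "range (\<lambda>q::rat. {..<of_rat q :: real})"
    have sq: "square_integrable (\<lambda>x. c * (indicator A x * indicator {- real n..real n} x))"
      if "A \<in> sets borel" for A
      using that by (rule square_integrable_indicator)
    have basic: "ind c n {..<of_rat q} \<in> closure D" for q
    proof -
      have "ind c n {..<of_rat q} \<in> G"
        unfolding G_def using c by (intro image_eqI[of _ _ "(c, n, q)"]) auto
      then show ?thesis
        using G_D closure_subset by blast
    qed
    have "Int_stable ?G"
    proof (rule Int_stableI)
      fix A B
      assume "A \<in> ?G" "B \<in> ?G"
      then obtain p q where "A = {..<of_rat p}" "B = {..<of_rat q}"
        by auto
      then have "A \<inter> B = {..<of_rat (min p q)}"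
        by (auto simp: min_def of_rat_less_eq intro: less_le_trans)
      then show "A \<inter> B \<in> ?G" by blast
    qed
    moreover have "?G \<subseteq> Pow UNIV" by simp
    moreover have "A \<in> sigma_sets UNIV ?G"
      using A by (simp add: borel_eq_rat_lessThan)
    ultimately show ?thesis
    proof (induction rule: sigma_sets_induct_disjoint)
      case (basic A)
      then show ?case
        using \<open>\<And>q. ind c n {..<of_rat q} \<in> closure D\<close> by auto
    next
      case empty
      have "ind c n {} = 0"
        by (simp add: ind_def zero_L2_def)
      with \<open>0 \<in> closure D\<close> show ?case by simp
    next
      case (compl A)
      have "ind c n UNIV = ind c n {..<of_rat (of_nat (Suc n))}"
        unfolding ind_def by (rule arg_cong[of _ _ abs_L2]) (auto simp: fun_eq_iff of_rat_add split: split_indicator)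
      then have "ind c n UNIV - ind c n A \<in> closure D"
        using \<open>\<And>q. ind c n {..<of_rat q} \<in> closure D\<close> compl.IH by (intro C_diff) auto
      moreover have "ind c n UNIV - ind c n A = ind c n (UNIV - A)"
      proof -
        have "A \<in> sets borel"
          using compl.hyps by (simp add: borel_eq_rat_lessThan)
        then show ?thesis
          unfolding ind_def
          by (subst abs_L2_diff[OF sq sq])
            (auto intro!: arg_cong[of _ _ abs_L2] simp: fun_eq_iff split: split_indicator)
      qed
      ultimately show ?case by simp
    next
      case (union A)
      have [measurable]: "A i \<in> sets borel" for i
        using union.hyps by (auto simp: borel_eq_rat_lessThan)
      have "ind c n (\<Union>i<k. A i) \<in> closure D" for k
      proof (induction k)
        case 0
        have "ind c n {} = 0"
          by (simp add: ind_def zero_L2_def)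
        with \<open>0 \<in> closure D\<close> show ?case by simp
      next
        case (Suc k)
        have "x \<notin> A i" if "i < k" "x \<in> A k" for i x
          using disjoint_family_onD[OF union.hyps(1), of k i] that by auto
        then have "ind c n (\<Union>i<Suc k. A i) = ind c n (\<Union>i<k. A i) + ind c n (A k)"
          unfolding ind_def
          by (subst plus_L2.abs_eq[OF L2_rel_refl[OF sq] L2_rel_refl[OF sq]])
            (auto intro!: arg_cong[of _ _ abs_L2] simp: fun_eq_iff lessThan_Suc split: split_indicator)
        then show ?case
          using Suc union.IH by (simp add: C_add)
      qed
      moreover have "(\<lambda>k. ind c n (\<Union>i<k. A i)) \<longlonglongrightarrow> ind c n (\<Union>i. A i)"
        unfolding ind_def
      proof (rule tendsto_abs_L2[OF _ _ sq[of UNIV]])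
        show "AE x in lborel. (\<lambda>k. c * (indicator (\<Union>i<k. A i) x * indicator {- real n..real n} x))
            \<longlonglongrightarrow> c * (indicator (\<Union>i. A i) x * indicator {- real n..real n} x)"
          by (intro AE_I2 tendsto_intros LIMSEQ_indicator_UN)
      qed (auto split: split_indicator)
      ultimately show ?case
        by (rule C_lim)
    qed
  qed

  fix f :: L2
  obtain F where F: "\<And>k. simple_function lborel (F k)"
      "\<And>x. (\<lambda>k. F k x) \<longlonglongrightarrow> rep_L2 f x"
      "\<And>k x. cmod (F k x) \<le> 2 * cmod (rep_L2 f x)"
    using borel_measurable_implies_sequence_metric[OF measurable_rep_L2, of f 0] by auto
  have F_meas [measurable]: "F k \<in> borel_measurable lborel" for k
    using F(1) by (rule borel_measurable_simple_function)
  define h where "h k x = F k x * indicator {- real k..real k} x" for k x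
  have "(\<lambda>k. abs_L2 (h k)) \<longlonglongrightarrow> abs_L2 (rep_L2 f)"
  proof (rule tendsto_abs_L2)
    show "square_integrable (\<lambda>x. 2 * rep_L2 f x)"
      by (intro square_integrable_scale) simp
    show "AE x in lborel. cmod (h k x) \<le> cmod (2 * rep_L2 f x)" for k
      using F(3) by (intro AE_I2) (auto simp: h_def norm_mult split: split_indicator)
    show "AE x in lborel. (\<lambda>k. h k x) \<longlonglongrightarrow> rep_L2 f x"
    proof (intro AE_I2)
      fix x :: real
      obtain N :: nat where N: "\<bar>x\<bar> \<le> real N"
        using real_arch_simple by blast
      have "\<forall>\<^sub>F k in sequentially. F k x = h k x"
        using eventually_ge_at_top[of N]
        by eventually_elim (use N in \<open>auto simp: h_def indicator_def\<close>)
      with F(2)[of x] show "(\<lambda>k. h k x) \<longlonglongrightarrow> rep_L2 f x"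
        by (rule Lim_transform_eventually)
    qed
    show "h k \<in> borel_measurable lborel" for k
      unfolding h_def by measurable
  qed simp
  moreover have "abs_L2 (h k) \<in> closure D" for k
  proof -
    let ?S = "{- real k..real k}"
    define A where "A y = F k -` {y}" for y
    have A: "A y \<in> sets borel" for y
      using measurable_sets[OF F_meas[of k], of "{y}"] by (simp add: A_def)
    have sum_C: "square_integrable (\<lambda>x. \<Sum>y\<in>Y. y * (indicator (A y) x * indicator ?S x)) \<and>
        abs_L2 (\<lambda>x. \<Sum>y\<in>Y. y * (indicator (A y) x * indicator ?S x)) \<in> closure D"
      if "finite Y" for Y
      using that
    proof induction
      case empty
      show ?case
        using \<open>0 \<in> closure D\<close> by (simp add: square_integrable_zero zero_L2_def)
    next
      case (insert y Y)
      have sq: "square_integrable (\<lambda>x. c * (indicator (A y) x * indicator ?S x))" for c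
        by (rule square_integrable_indicator[OF A])
      have "abs_L2 (\<lambda>x. y * (indicator (A y) x * indicator ?S x))
          = Re y *\<^sub>R ind 1 k (A y) + Im y *\<^sub>R ind \<i> k (A y)"
        unfolding ind_def
        unfolding scaleR_L2.abs_eq[OF L2_rel_refl[OF sq]]
          plus_L2.abs_eq[OF L2_rel_refl[OF square_integrable_scale[OF sq]]
            L2_rel_refl[OF square_integrable_scale[OF sq]]]
        by (rule arg_cong[of _ _ abs_L2]) (auto simp: fun_eq_iff complex_eq_iff split: split_indicator)
      also have "\<dots> \<in> closure D"
        by (intro C_add C_scale ind_C A) auto
      finally have "abs_L2 (\<lambda>x. y * (indicator (A y) x * indicator ?S x))
          + abs_L2 (\<lambda>x. \<Sum>y\<in>Y. y * (indicator (A y) x * indicator ?S x)) \<in> closure D"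
        using insert.IH by (intro C_add) auto
      then show ?case
        using insert square_integrable_add[OF sq[of y], of "\<lambda>x. \<Sum>y\<in>Y. y * (indicator (A y) x * indicator ?S x)"]
        by (simp add: plus_L2.abs_eq L2_rel_refl sq)
    qed
    have fin: "finite (range (F k))"
      using F(1)[of k] by (simp add: simple_function_def)
    have "h k = (\<lambda>x. \<Sum>y\<in>range (F k). y * (indicator (A y) x * indicator ?S x))"
    proof
      fix x
      have "(\<Sum>y\<in>range (F k). y * (indicator (A y) x * indicator ?S x))
          = (\<Sum>y\<in>range (F k). if y = F k x then y * indicator ?S x else 0)"
        by (intro sum.cong) (auto simp: A_def)
      also have "\<dots> = h k x"
        using fin by (simp add: h_def)
      finally show "h k x = (\<Sum>y\<in>range (F k). y * (indicator (A y) x * indicator ?S x))" ..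
    qed
    then show ?thesis
      using sum_C[OF fin] by simp
  qed
  ultimately show "f \<in> closure D"
    using C_lim by force
qed

instance L2 :: second_countable_topology
proof
  obtain D :: "L2 set" where D: "countable D" "\<And>f. f \<in> closure D"
    using L2_countable_dense by metis
  have "\<exists>d\<in>D. dist d f < e" if "e > 0" for f e
    using D(2)[of f] that by (simp add: closure_approachable)
  with D(1) show "\<exists>B :: L2 set set. countable B \<and> open = generate_topology B"
    by (rule countable_dense_imp_countable_subbasis)
qed


text \<open>
  The class of a function. The value \<open>0\<close> for functions that are not square integrable is a
  convention without mathematical content.
\<close>

definition L2_of :: "(real \<Rightarrow> complex) \<Rightarrow> L2" where
  "L2_of f = (if square_integrable f then abs_L2 f else 0)"


section \<open>The harmonic oscillator and its propagator\<close>

definition iterated_deriv :: "nat \<Rightarrow> (real \<Rightarrow> complex) \<Rightarrow> real \<Rightarrow> complex" where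
  "iterated_deriv k = (\<lambda>f x. vector_derivative f (at x)) ^^ k"

definition schwartz :: "(real \<Rightarrow> complex) \<Rightarrow> bool" where
  "schwartz \<psi> \<longleftrightarrow>
     (\<forall>k x. iterated_deriv k \<psi> differentiable (at x)) \<and>
     (\<forall>j k. bounded (range (\<lambda>x. x ^ j *\<^sub>R iterated_deriv k \<psi> x)))"

definition harmonic_oscillator :: "(real \<Rightarrow> complex) \<Rightarrow> real \<Rightarrow> complex" where
  "harmonic_oscillator \<psi> x = - iterated_deriv 2 \<psi> x + x\<^sup>2 *\<^sub>R \<psi> x"

text \<open>
  \<open>u\<close> solves \<open>i u\<^sub>t + H u = 0\<close>, \<open>u(0) = f\<close>. For data in \<open>L\<^sup>2\<close> the equation is understood in the
  sense of (tempered) distributions in \<open>x\<close>: \<open>\<langle>u\<^sub>t, \<psi>\<rangle> = i \<langle>u, H \<psi>\<rangle>\<close> for every Schwartz function \<open>\<psi>\<close>.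
  For a Hermite function, \<open>H f = (2n + 1) f\<close>, the solution is \<open>u(t) = e\<^sup>i\<^sup>t\<^sup>(\<^sup>2\<^sup>n\<^sup>+\<^sup>1\<^sup>) f\<close>.
\<close>

definition oscillator_solution :: "L2 \<Rightarrow> (real \<Rightarrow> L2) \<Rightarrow> bool" where
  "oscillator_solution f u \<longleftrightarrow>
     continuous_on UNIV u \<and> u 0 = f \<and>
     (\<forall>\<psi> t. schwartz \<psi> \<longrightarrow>
        ((\<lambda>t. cinner (u t) (L2_of \<psi>)) has_vector_derivative
           \<i> * cinner (u t) (L2_of (harmonic_oscillator \<psi>))) (at t))"

text \<open>\<open>propagator t f\<close> is \<open>e\<^sup>i\<^sup>t\<^sup>H f\<close>.\<close>

definition propagator :: "real \<Rightarrow> L2 \<Rightarrow> L2" where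
  "propagator t f = (THE u. oscillator_solution f u) t"


section \<open>Hamiltonian mechanics on \<open>L\<^sup>2(\<real> \<rightarrow> \<complex>)\<close>\<close>

definition symplectic_form :: "L2 \<Rightarrow> L2 \<Rightarrow> real" where
  "symplectic_form f g = - Im (cinner f g)"

definition is_symplectic_gradient :: "(L2 \<Rightarrow> real) \<Rightarrow> L2 \<Rightarrow> L2 \<Rightarrow> bool" where
  "is_symplectic_gradient \<H> f v \<longleftrightarrow>
     (\<forall>g. ((\<lambda>\<epsilon>. \<H> (f + \<epsilon> *\<^sub>R g)) has_real_derivative symplectic_form v g) (at 0))"

definition symplectic_gradient :: "(L2 \<Rightarrow> real) \<Rightarrow> L2 \<Rightarrow> L2" where
  "symplectic_gradient \<H> f = (THE v. is_symplectic_gradient \<H> f v)"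

text \<open>
  \<open>solution_on I E u\<close>: on the time interval \<open>I\<close> the curve \<open>u\<close> has an \<open>L\<^sup>2\<close> derivative \<open>u\<^sub>t\<close>
  (one-sided at end points of \<open>I\<close>), and \<open>E (u(t)) (u\<^sub>t(t))\<close> holds.
\<close>

definition solution_on :: "real set \<Rightarrow> (L2 \<Rightarrow> L2 \<Rightarrow> bool) \<Rightarrow> (real \<Rightarrow> L2) \<Rightarrow> bool" where
  "solution_on I E u \<longleftrightarrow>
     (\<forall>t\<in>I. \<exists>u'. (u has_vector_derivative u') (at t within I) \<and> E (u t) u')"

definition hamilton_equation :: "(L2 \<Rightarrow> real) \<Rightarrow> L2 \<Rightarrow> L2 \<Rightarrow> bool" where
  "hamilton_equation \<H> f f' \<longleftrightarrow> f' = symplectic_gradient \<H> f"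


section \<open>The Hamiltonian and the resonant equation\<close>

definition H6 :: "L2 \<Rightarrow> real" where
  "H6 f = 2 / pi *
     (LINT t:{-pi/4..pi/4}|lborel. LINT x|lborel. cmod (rep_L2 (propagator t f) x) ^ 6)"

definition quintic :: "(real \<Rightarrow> complex) \<Rightarrow> real \<Rightarrow> complex" where
  "quintic f x = of_real (cmod (f x) ^ 4) * f x"

text \<open>
  \<open>e\<^sup>-\<^sup>i\<^sup>s\<^sup>H (\<bar>e\<^sup>i\<^sup>s\<^sup>H f\<bar>\<^sup>4 e\<^sup>i\<^sup>s\<^sup>H f)\<close>. For \<open>f\<close> in \<open>L\<^sup>2\<close> the nonlinearity lies in \<open>L\<^sup>2\<close> for almost every
  \<open>s\<close> only, so that its integral over \<open>s\<close> does not depend on the convention in \<open>L2_of\<close>.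
\<close>

definition resonant_integrand :: "L2 \<Rightarrow> real \<Rightarrow> L2" where
  "resonant_integrand f s = propagator (- s) (L2_of (quintic (rep_L2 (propagator s f))))"

text \<open>The equation \<open>i f\<^sub>t = c \<integral> e\<^sup>-\<^sup>i\<^sup>s\<^sup>H (\<bar>e\<^sup>i\<^sup>s\<^sup>H f\<bar>\<^sup>4 e\<^sup>i\<^sup>s\<^sup>H f) ds\<close>, with a Bochner integral in \<open>L\<^sup>2\<close>.\<close>

definition resonant_equation :: "real \<Rightarrow> L2 \<Rightarrow> L2 \<Rightarrow> bool" where
  "resonant_equation c f f' \<longleftrightarrow>
     \<i> *\<^sub>C f' = c *\<^sub>R (LINT s:{-pi/4..pi/4}|lborel. resonant_integrand f s)"

end

theory Submission
  imports Defs "HOL-Probability.Probability" "HOL-Complex_Analysis.Complex_Analysis"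
begin

text \<open>
  The propagator multiplies the coefficient of the \<open>n\<close>-th Hermite function by \<open>e\<^sup>i\<^sup>t\<^sup>(\<^sup>2\<^sup>n\<^sup>+\<^sup>1\<^sup>)\<close>.
  Mehler's formula bounds its kernel by \<open>C \<bar>t\<bar>\<^sup>-\<^sup>1\<^sup>/\<^sup>2\<close> for \<open>\<bar>t\<bar> \<le> \<pi>/4\<close>, whence by duality and the
  Hardy--Littlewood--Sobolev inequality the Strichartz estimate in \<open>L\<^sup>4\<^sub>t L\<^sup>\<infinity>\<^sub>x\<close>. With
  \<open>\<parallel>u\<parallel>\<^sub>1\<^sub>0\<^sup>5 \<le> \<parallel>u\<parallel>\<^sub>\<infinity>\<^sup>4 \<parallel>u\<parallel>\<^sub>2\<close> this makes the nonlinearity \<open>\<bar>e\<^sup>i\<^sup>s\<^sup>H f\<bar>\<^sup>4 e\<^sup>i\<^sup>s\<^sup>H f\<close> integrable in \<open>s\<close> with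
  values in \<open>L\<^sup>2\<close>. A second order Taylor bound for \<open>\<bar>u + \<epsilon> w\<bar>\<^sup>6\<close> then gives the derivative of the
  Hamiltonian, and unitarity of the propagator moves it from the direction \<open>g\<close> onto the nonlinearity.
\<close>

section \<open>\<open>L\<^sup>2\<close> as a complex Hilbert space\<close>

text \<open>An element of \<open>L2\<close> is a class without point values, so the supremum in x
  cannot be taken directly, and at a given time the quintic nonlinearity may fail to be square
  integrable. Two regularizations deal with this. The multiplier \<open>r ^ n\<close> on Hermite
  coefficients, with r < 1, turns evaluation at y into pairing with the vector
  \<open>mehler_L2 r y\<close>; the dispersive and Strichartz bounds for it have constants
  independent of r. The truncation \<open>cut k\<close> makes the nonlinearity Lipschitz on
  \<open>L2\<close>, so that r can tend to 1 by continuity and Fatou, and k to infinity by monotone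
  convergence. Truncation also supplies the measurability of the nonlinearity.

  The kernel of the propagator at time t has size |sin 2t|^(-1/2), which is singular again at |t| =
  pi/2. Time differences within the full interval reach pi/2, hence the restriction to |t| <= pi/4
  and the splitting of the interval into two halves.

  The factor 12/pi is 6 times 2/pi: differentiating the sixth power brings down a 6, and the same 6
  is the rescaling of time.\<close>

lemma cinner_abs_L2:
  assumes "square_integrable f" "square_integrable g"
  shows "cinner (abs_L2 f) (abs_L2 g) = (LINT x|lborel. f x * cnj (g x))"
  using assms by (simp add: cinner.abs_eq L2_rel_refl)

lemma cinner_rep_L2: "cinner f g = (LINT x|lborel. rep_L2 f x * cnj (rep_L2 g x))"
  using cinner_abs_L2[of "rep_L2 f" "rep_L2 g"] by simp

lemma cinner_commute: "cinner g f = cnj (cinner f g)"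
proof -
  have "cnj (cinner f g) = (LINT x|lborel. cnj (rep_L2 f x * cnj (rep_L2 g x)))"
    unfolding cinner_rep_L2 by (rule Bochner_Integration.integral_cnj[symmetric])
  then show ?thesis
    by (simp add: cinner_rep_L2 mult.commute)
qed

lemma cinner_add_left: "cinner (f + g) h = cinner f h + cinner g h"
  by transfer (simp add: L2_rel_def distrib_right integrable_mult_cnj)

lemma cinner_add_right: "cinner h (f + g) = cinner h f + cinner h g"
  by (metis cinner_add_left cinner_commute complex_cnj_add)

lemma cinner_scaleC_left: "cinner (c *\<^sub>C f) g = c * cinner f g"
  by transfer (simp add: L2_rel_def mult.assoc)

lemma cinner_scaleC_right: "cinner f (c *\<^sub>C g) = cnj c * cinner f g"
  by (metis cinner_scaleC_left cinner_commute complex_cnj_mult)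

lemma scaleR_eq_scaleC: "r *\<^sub>R f = of_real r *\<^sub>C f"
  by transfer (auto simp: L2_rel_def square_integrable_scale)

lemma cinner_self: "cinner f f = of_real ((norm f)\<^sup>2)"
proof -
  have "Im (cinner f f) = 0"
    using cinner_commute[of f f] by (simp add: complex_eq_iff)
  moreover have "Re (cinner f f) = (norm f)\<^sup>2"
    by (simp add: norm_eq_sqrt_inner inner_L2_def[symmetric])
  ultimately show ?thesis
    by (simp add: complex_eq_iff)
qed

lemma norm_scaleC: "norm (c *\<^sub>C f) = cmod c * norm f"
proof -
  have "of_real ((norm (c *\<^sub>C f))\<^sup>2) = (c * cnj c) * of_real ((norm f)\<^sup>2)"
    unfolding cinner_self[symmetric] by (simp add: cinner_scaleC_left cinner_scaleC_right ac_simps)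
  also have "\<dots> = of_real ((cmod c * norm f)\<^sup>2)"
    unfolding complex_norm_square[symmetric] by (simp add: power_mult_distrib)
  finally have "of_real ((norm (c *\<^sub>C f))\<^sup>2) = (of_real ((cmod c * norm f)\<^sup>2) :: complex)" .
  then show ?thesis
    by (simp only: of_real_eq_iff) (simp add: power2_eq_iff_nonneg)
qed

text \<open>Multiplying \<open>f\<close> by the conjugate of the inner product makes the product
  real and nonnegative, which reduces the complex Cauchy-Schwarz inequality to the real one.\<close>

lemma norm_cinner_le: "cmod (cinner f g) \<le> norm f * norm g"
proof -
  define z where "z = cinner f g"
  have "cmod z * cmod z = Re (cinner (cnj z *\<^sub>C f) g)"
    unfolding cinner_scaleC_left z_def[symmetric] mult.commute[of "cnj z"] complex_norm_square[symmetric]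
    by (simp add: power2_eq_square)
  also have "\<dots> = inner (cnj z *\<^sub>C f) g"
    by (simp add: inner_L2_def)
  also have "\<dots> \<le> norm (cnj z *\<^sub>C f) * norm g"
    by (rule norm_cauchy_schwarz)
  also have "\<dots> = cmod z * (norm f * norm g)"
    by (simp add: norm_scaleC)
  finally have "cmod z = 0 \<or> cmod z \<le> norm f * norm g"
    by (auto simp: mult_le_cancel_left)
  then show ?thesis
    by (auto simp: z_def)
qed

lemma bounded_bilinear_cinner: "bounded_bilinear cinner"
proof
  fix f g h :: L2 and r :: real
  show "cinner (f + g) h = cinner f h + cinner g h" by (rule cinner_add_left)
  show "cinner h (f + g) = cinner h f + cinner h g" by (rule cinner_add_right)
  show "cinner (r *\<^sub>R f) g = r *\<^sub>R cinner f g"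
    by (simp add: scaleR_eq_scaleC cinner_scaleC_left scaleR_conv_of_real)
  show "cinner f (r *\<^sub>R g) = r *\<^sub>R cinner f g"
    by (simp add: scaleR_eq_scaleC cinner_scaleC_right scaleR_conv_of_real)
  show "\<exists>K. \<forall>a b. norm (cinner a b) \<le> norm a * norm b * K"
    using norm_cinner_le by (intro exI[of _ 1]) simp
qed

lemma scaleC_add_right: "c *\<^sub>C (f + g) = c *\<^sub>C f + c *\<^sub>C g"
  by transfer (auto simp: L2_rel_def square_integrable_scale square_integrable_add distrib_left)

lemma scaleC_add_left: "(c + d) *\<^sub>C f = c *\<^sub>C f + d *\<^sub>C f"
  by transfer (auto simp: L2_rel_def square_integrable_scale square_integrable_add distrib_right)

lemma scaleC_scaleC: "c *\<^sub>C d *\<^sub>C f = (c * d) *\<^sub>C f"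
  by transfer (auto simp: L2_rel_def square_integrable_scale mult.assoc)

lemma scaleC_one [simp]: "1 *\<^sub>C f = f"
  by transfer (auto simp: L2_rel_def)

lemma bounded_bilinear_scaleC: "bounded_bilinear (\<lambda>c f. c *\<^sub>C f)"
proof
  fix f g :: L2 and c d :: complex and r :: real
  show "(c + d) *\<^sub>C f = c *\<^sub>C f + d *\<^sub>C f" by (rule scaleC_add_left)
  show "c *\<^sub>C (f + g) = c *\<^sub>C f + c *\<^sub>C g" by (rule scaleC_add_right)
  show "(r *\<^sub>R c) *\<^sub>C f = r *\<^sub>R c *\<^sub>C f"
    by (simp add: scaleR_eq_scaleC scaleC_scaleC scaleR_conv_of_real)
  show "c *\<^sub>C r *\<^sub>R f = r *\<^sub>R c *\<^sub>C f"
    by (simp add: scaleR_eq_scaleC scaleC_scaleC mult.commute)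
  show "\<exists>K. \<forall>a b. norm (a *\<^sub>C b) \<le> norm a * norm b * K"
    by (intro exI[of _ 1]) (simp add: norm_scaleC)
qed

interpretation cinner: bounded_bilinear cinner
  by (rule bounded_bilinear_cinner)

interpretation scaleC: bounded_bilinear scaleC
  by (rule bounded_bilinear_scaleC)

lemmas scaleC_zero_left [simp] = scaleC.zero_left
lemmas cinner_zero_left [simp] = cinner.zero_left
lemmas cinner_zero_right [simp] = cinner.zero_right

section \<open>Expansions in a countable orthonormal basis\<close>

locale orthonormal_basis_L2 =
  fixes e :: "nat \<Rightarrow> L2"
  assumes orthonormal: "cinner (e m) (e n) = (if m = n then 1 else 0)"
    and total: "(\<And>n. cinner f (e n) = 0) \<Longrightarrow> f = 0"
begin

definition coeff :: "L2 \<Rightarrow> nat \<Rightarrow> complex" where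
  "coeff f n = cinner f (e n)"

lemma coeff_add: "coeff (f + g) n = coeff f n + coeff g n"
  by (simp add: coeff_def cinner.add_left)

lemma coeff_diff: "coeff (f - g) n = coeff f n - coeff g n"
  by (simp add: coeff_def cinner.diff_left)

lemma coeff_scaleC: "coeff (c *\<^sub>C f) n = c * coeff f n"
  by (simp add: coeff_def cinner_scaleC_left)

lemma coeff_zero [simp]: "coeff 0 n = 0"
  by (simp add: coeff_def)

lemma coeff_sum: "coeff (\<Sum>k\<in>A. a k *\<^sub>C e k) n = (if finite A \<and> n \<in> A then a n else 0)"
proof (cases "finite A")
  case True
  have "coeff (\<Sum>k\<in>A. a k *\<^sub>C e k) n = (\<Sum>k\<in>A. if k = n then a k else 0)"
    by (auto simp: coeff_def cinner.sum_left cinner_scaleC_left orthonormal intro!: sum.cong)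
  with True show ?thesis by simp
qed simp

lemma eqI: "(\<And>n. coeff f n = coeff g n) \<Longrightarrow> f = g"
  using total[of "f - g"] by (simp add: coeff_def cinner.diff_left)

lemma norm_sum_sq:
  assumes "finite A"
  shows "(norm (\<Sum>k\<in>A. a k *\<^sub>C e k))\<^sup>2 = (\<Sum>k\<in>A. (cmod (a k))\<^sup>2)"
proof -
  define v where "v = (\<Sum>k\<in>A. a k *\<^sub>C e k)"
  have "cinner v v = (\<Sum>k\<in>A. cnj (a k) * coeff v k)"
    unfolding coeff_def by (subst (2) v_def) (simp add: cinner.sum_right cinner_scaleC_right)
  also have "\<dots> = (\<Sum>k\<in>A. of_real ((cmod (a k))\<^sup>2))"
    unfolding v_def coeff_sum
    by (intro sum.cong) (use assms in \<open>auto simp: complex_norm_square mult.commute simp del: of_real_power\<close>)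
  finally have "of_real ((norm v)\<^sup>2) = (of_real (\<Sum>k\<in>A. (cmod (a k))\<^sup>2) :: complex)"
    by (simp add: cinner_self)
  then show ?thesis
    by (simp only: of_real_eq_iff v_def)
qed

text \<open>By Pythagoras a block of the series has squared norm equal to a block of the scalar
  series, so the Cauchy criterion transfers; completeness of \<open>L2\<close> turns it into
  convergence.\<close>

lemma summable_basis:
  assumes "summable (\<lambda>n. (cmod (a n))\<^sup>2)"
  shows "summable (\<lambda>n. a n *\<^sub>C e n)"
  unfolding summable_Cauchy
proof (intro allI impI)
  fix \<epsilon> :: real
  assume "\<epsilon> > 0"
  then obtain N where N: "\<And>m n. m \<ge> N \<Longrightarrow> norm (\<Sum>k = m..<n. (cmod (a k))\<^sup>2) < \<epsilon>\<^sup>2"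
    using assms unfolding summable_Cauchy by (meson zero_less_power)
  show "\<exists>N. \<forall>m\<ge>N. \<forall>n. norm (\<Sum>k = m..<n. a k *\<^sub>C e k) < \<epsilon>"
  proof (intro exI[of _ N] allI impI)
    fix m n
    assume "m \<ge> N"
    then have "(norm (\<Sum>k = m..<n. a k *\<^sub>C e k))\<^sup>2 < \<epsilon>\<^sup>2"
      using N[of m n] by (simp add: norm_sum_sq)
    then show "norm (\<Sum>k = m..<n. a k *\<^sub>C e k) < \<epsilon>"
      using \<open>\<epsilon> > 0\<close> by (simp add: power2_less_imp_less)
  qed
qed

lemma coeff_suminf:
  assumes "summable (\<lambda>n. (cmod (a n))\<^sup>2)"
  shows "coeff (\<Sum>n. a n *\<^sub>C e n) k = a k"
proof -
  have "(\<lambda>n. cinner (a n *\<^sub>C e n) (e k)) sums cinner (\<Sum>n. a n *\<^sub>C e n) (e k)"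
    by (intro cinner.bounded_linear_left[THEN bounded_linear.sums] summable_sums summable_basis assms)
  moreover have "cinner (a n *\<^sub>C e n) (e k) = (if n = k then a n else 0)" for n
    by (simp add: cinner_scaleC_left orthonormal)
  ultimately have "(\<lambda>n. if n = k then a n else 0) sums coeff (\<Sum>n. a n *\<^sub>C e n) k"
    by (simp add: coeff_def)
  moreover have "(\<lambda>n. if n = k then a n else 0) sums a k"
    using sums_single[of k a] by simp
  ultimately show ?thesis
    by (rule sums_unique2)
qed

text \<open>With \<open>v\<close> the partial sum of the expansion, \<open>cinner f v\<close> equals
  the squared norm of \<open>v\<close>, so Cauchy-Schwarz gives
  \<open>norm v \<le> norm f\<close>.\<close>

lemma bessel: "(\<Sum>n<N. (cmod (coeff f n))\<^sup>2) \<le> (norm f)\<^sup>2"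
proof -
  define v where "v = (\<Sum>n<N. coeff f n *\<^sub>C e n)"
  have "cinner f v = of_real (\<Sum>n<N. (cmod (coeff f n))\<^sup>2)"
    unfolding v_def cinner.sum_right cinner_scaleC_right coeff_def[symmetric] of_real_sum
    by (intro sum.cong) (auto simp: complex_norm_square mult.commute simp del: of_real_power)
  also have "\<dots> = of_real ((norm v)\<^sup>2)"
    by (simp add: v_def norm_sum_sq)
  finally have "cmod (of_real ((norm v)\<^sup>2)) \<le> norm f * norm v"
    using norm_cinner_le[of f v] by simp
  then have "norm v * norm v \<le> norm f * norm v"
    by (simp only: norm_of_real) (simp add: power2_eq_square)
  then have "norm v \<le> norm f"
    by (cases "norm v = 0") (auto simp: mult_le_cancel_right)
  then have "(norm v)\<^sup>2 \<le> (norm f)\<^sup>2"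
    by (intro power_mono) auto
  then show ?thesis
    by (simp add: v_def norm_sum_sq)
qed

lemma summable_coeff: "summable (\<lambda>n. (cmod (coeff f n))\<^sup>2)"
  by (rule summableI_nonneg_bounded[OF _ bessel]) auto

text \<open>The series converges by Bessel, and its sum has the coefficients of \<open>f\<close>;
  totality identifies the two.\<close>

lemma expansion: "(\<lambda>n. coeff f n *\<^sub>C e n) sums f"
proof -
  have "(\<Sum>n. coeff f n *\<^sub>C e n) = f"
    by (rule eqI) (simp add: coeff_suminf summable_coeff)
  then show ?thesis
    using summable_sums[OF summable_basis[OF summable_coeff[of f]]] by simp
qed

lemma parseval: "(\<lambda>n. coeff f n * cnj (coeff g n)) sums cinner f g"
proof -
  have "(\<lambda>n. cinner (coeff f n *\<^sub>C e n) g) sums cinner f g"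
    by (intro cinner.bounded_linear_left[THEN bounded_linear.sums] expansion)
  moreover have "cinner (coeff f n *\<^sub>C e n) g = coeff f n * cnj (coeff g n)" for n
    using cinner_commute[of "e n" g] by (simp add: cinner_scaleC_left coeff_def)
  ultimately show ?thesis
    by simp
qed

lemma parseval_norm: "(\<lambda>n. (cmod (coeff f n))\<^sup>2) sums (norm f)\<^sup>2"
proof -
  have "(\<lambda>n. of_real ((cmod (coeff f n))\<^sup>2) :: complex) sums of_real ((norm f)\<^sup>2)"
    using parseval[of f f] by (simp add: cinner_self complex_norm_square del: of_real_power)
  then show ?thesis
    by (simp only: sums_of_real_iff)
qed

lemma summable_coeff_mult: "summable (\<lambda>n. cmod (coeff f n) * cmod (coeff g n))"
proof (rule summable_comparison_test')
  show "summable (\<lambda>n. (cmod (coeff f n))\<^sup>2 + (cmod (coeff g n))\<^sup>2)"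
    by (intro summable_add summable_coeff)
  fix n
  show "norm (cmod (coeff f n) * cmod (coeff g n)) \<le> (cmod (coeff f n))\<^sup>2 + (cmod (coeff g n))\<^sup>2"
    using sum_squares_bound[of "cmod (coeff f n)" "cmod (coeff g n)"]
      mult_nonneg_nonneg[of "cmod (coeff f n)" "cmod (coeff g n)"]
    by (simp del: mult_nonneg_nonneg)
qed

text \<open>Multiplier operators in the basis: both the propagator and the smoothing by
  \<open>r ^ n\<close> are of this form.\<close>

definition diag :: "(nat \<Rightarrow> complex) \<Rightarrow> L2 \<Rightarrow> L2" where
  "diag m f = (\<Sum>n. (m n * coeff f n) *\<^sub>C e n)"

lemma coeff_diag:
  assumes "\<And>n. cmod (m n) \<le> C"
  shows "coeff (diag m f) n = m n * coeff f n"
  unfolding diag_def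
proof (rule coeff_suminf, rule summable_comparison_test')
  show "summable (\<lambda>n. C\<^sup>2 * (cmod (coeff f n))\<^sup>2)"
    by (intro summable_mult summable_coeff)
  fix n
  show "norm ((cmod (m n * coeff f n))\<^sup>2) \<le> C\<^sup>2 * (cmod (coeff f n))\<^sup>2"
    using assms[of n] by (auto simp: norm_mult power_mult_distrib intro!: mult_right_mono power_mono)
qed

lemma norm_diag_le:
  assumes "\<And>n. cmod (m n) \<le> C"
  shows "norm (diag m f) \<le> C * norm f"
proof -
  have "C \<ge> 0"
    using assms[of 0] norm_ge_zero order_trans by blast
  have "(norm (diag m f))\<^sup>2 \<le> C\<^sup>2 * (norm f)\<^sup>2"
  proof (rule sums_le[OF _ parseval_norm sums_mult[OF parseval_norm]])
    fix n
    show "(cmod (coeff (diag m f) n))\<^sup>2 \<le> C\<^sup>2 * (cmod (coeff f n))\<^sup>2"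
      unfolding coeff_diag[OF assms] norm_mult power_mult_distrib
      using assms[of n] by (intro mult_right_mono power_mono) auto
  qed
  then have "(norm (diag m f))\<^sup>2 \<le> (C * norm f)\<^sup>2"
    by (simp only: power_mult_distrib)
  then show ?thesis
    by (rule power2_le_imp_le) (simp add: \<open>C \<ge> 0\<close>)
qed

lemma norm_diag_unimodular:
  assumes "\<And>n. cmod (m n) = 1"
  shows "norm (diag m f) = norm f"
proof -
  have "\<And>n. cmod (m n) \<le> 1"
    using assms by simp
  note c = coeff_diag[OF this]
  have "(\<lambda>n. (cmod (coeff (diag m f) n))\<^sup>2) = (\<lambda>n. (cmod (coeff f n))\<^sup>2)"
    by (simp add: c norm_mult assms)
  then have "(norm (diag m f))\<^sup>2 = (norm f)\<^sup>2"
    using parseval_norm[of "diag m f"] parseval_norm[of f] sums_unique2 by metis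
  then show ?thesis
    by simp
qed

lemma diag_add:
  assumes "\<And>n. cmod (m n) \<le> C"
  shows "diag m (f + g) = diag m f + diag m g"
  by (rule eqI) (simp add: coeff_add coeff_diag[OF assms] distrib_left)

lemma diag_diff:
  assumes "\<And>n. cmod (m n) \<le> C"
  shows "diag m (f - g) = diag m f - diag m g"
  by (rule eqI) (simp add: coeff_diff coeff_diag[OF assms] right_diff_distrib)

lemma diag_scaleC:
  assumes "\<And>n. cmod (m n) \<le> C"
  shows "diag m (c *\<^sub>C f) = c *\<^sub>C diag m f"
  by (rule eqI) (simp add: coeff_scaleC coeff_diag[OF assms])

text \<open>On a partial sum of the expansion only finitely many multipliers enter; the common bound
  1 controls the tail uniformly in \<open>j\<close>. This yields the strong continuity of the
  propagator and, later, the removal of the smoothing.\<close>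

lemma tendsto_diag:
  assumes m: "\<And>j n. cmod (m j n) \<le> 1" and l: "\<And>n. cmod (l n) \<le> 1"
    and lim: "\<And>n. ((\<lambda>j. m j n) \<longlongrightarrow> l n) F"
  shows "((\<lambda>j. diag (m j) f) \<longlongrightarrow> diag l f) F"
proof (rule tendstoI)
  fix \<epsilon> :: real
  assume "\<epsilon> > 0"
  define S where "S N = (\<Sum>n<N. coeff f n *\<^sub>C e n)" for N
  have "S \<longlonglongrightarrow> f"
    using expansion[of f] by (simp add: sums_def S_def[abs_def])
  then obtain N where N: "norm (S N - f) < \<epsilon> / 4"
    using LIMSEQ_D[of S f "\<epsilon> / 4"] \<open>\<epsilon> > 0\<close> by auto
  have fin: "diag k (S N) = (\<Sum>n<N. (k n * coeff f n) *\<^sub>C e n)" if "\<And>n. cmod (k n) \<le> 1" for k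
    by (rule eqI) (simp add: coeff_diag[OF that] S_def coeff_sum)
  have "((\<lambda>j. diag (m j) (S N)) \<longlongrightarrow> diag l (S N)) F"
    unfolding fin[OF m] fin[OF l]
    by (intro tendsto_sum scaleC.tendsto tendsto_mult lim tendsto_const)
  then have "\<forall>\<^sub>F j in F. dist (diag (m j) (S N)) (diag l (S N)) < \<epsilon> / 2"
    using \<open>\<epsilon> > 0\<close> by (intro tendstoD) auto
  then show "\<forall>\<^sub>F j in F. dist (diag (m j) f) (diag l f) < \<epsilon>"
  proof eventually_elim
    case (elim j)
    have "norm (diag k f - diag k (S N)) < \<epsilon> / 4" if "\<And>n. cmod (k n) \<le> 1" for k
      using norm_diag_le[where m = k and C = 1 and f = "f - S N", OF that] N
      by (simp add: diag_diff[OF that] norm_minus_commute)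
    from this[of "m j", OF m] this[of l, OF l] elim show ?case
      using dist_triangle[of "diag (m j) f" "diag l f" "diag (m j) (S N)"]
        dist_triangle[of "diag (m j) (S N)" "diag l f" "diag l (S N)"]
      by (simp add: dist_norm norm_minus_commute)
  qed
qed

end

section \<open>Hermite functions\<close>

text \<open>The form of integration by parts on the whole line that serves both the symmetry of the
  oscillator and Stein's identity.\<close>

lemma integral_derivative_eq_zero:
  fixes F f :: "real \<Rightarrow> 'a::euclidean_space"
  assumes F: "\<And>x. (F has_vector_derivative f x) (at x)" and f: "continuous_on UNIV f"
    and int: "integrable lborel f"
    and lim: "(F \<longlongrightarrow> 0) at_top" "(F \<longlongrightarrow> 0) at_bot"
  shows "(LINT x|lborel. f x) = 0"
proof -
  have "(LBINT x=-\<infinity>..\<infinity>. f x) = 0 - 0"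
  proof (rule interval_integral_FTC_integrable)
    show "isCont f x" for x
      using f by (simp add: continuous_on_eq_continuous_at)
    show "set_integrable lborel (einterval (- \<infinity>) \<infinity>) f"
      using int by (simp add: einterval_eq_UNIV set_integrable_def)
    show "((F \<circ> real_of_ereal) \<longlongrightarrow> 0) (at_right (- \<infinity>))" "((F \<circ> real_of_ereal) \<longlongrightarrow> 0) (at_left \<infinity>)"
      using lim by (simp_all add: at_left_PInf at_right_MInf filterlim_filtermap)
  qed (use F in auto)
  then show ?thesis
    by (simp add: interval_lebesgue_integral_def einterval_eq_UNIV set_lebesgue_integral_def)
qed

lemma integrable_gaussian:
  assumes "c > 0"
  shows "integrable lborel (\<lambda>x::real. exp (- c * x\<^sup>2))"
proof -
  define \<sigma> where "\<sigma> = sqrt (1 / (2 * c))"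
  have \<sigma>: "\<sigma>\<^sup>2 = 1 / (2 * c)" "\<sigma> > 0"
    using assms by (simp_all add: \<sigma>_def)
  have "integrable lborel (\<lambda>x. sqrt (2 * pi * \<sigma>\<^sup>2) * normal_density 0 \<sigma> x)"
    by (intro integrable_mult_right integrable_normal_density \<sigma>)
  moreover have "sqrt (2 * pi * \<sigma>\<^sup>2) * normal_density 0 \<sigma> x = exp (- c * x\<^sup>2)" for x
    using \<sigma> assms by (simp add: normal_density_def)
  ultimately show ?thesis by simp
qed

lemma tendsto_gaussian:
  assumes "c > 0"
  shows "((\<lambda>x::real. exp (- c * x\<^sup>2)) \<longlongrightarrow> 0) at_top" "((\<lambda>x::real. exp (- c * x\<^sup>2)) \<longlongrightarrow> 0) at_bot"
proof -
  have "filterlim (\<lambda>x::real. c * x\<^sup>2) at_top at_top"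
    by (intro filterlim_tendsto_pos_mult_at_top[OF tendsto_const assms] filterlim_pow_at_top filterlim_ident) simp
  then have "filterlim (\<lambda>x::real. - (c * x\<^sup>2)) at_bot at_top"
    by (simp add: filterlim_uminus_at_bot)
  then show *: "((\<lambda>x::real. exp (- c * x\<^sup>2)) \<longlongrightarrow> 0) at_top"
    using filterlim_compose[OF exp_at_bot] by fastforce
  then show "((\<lambda>x::real. exp (- c * x\<^sup>2)) \<longlongrightarrow> 0) at_bot"
    by (simp add: filterlim_at_bot_mirror)
qed

text \<open>Each step of the induction spends half of the exponent on the new factor x and leaves
  the other half to the remaining polynomial, hence the arbitrary \<open>c\<close>.\<close>

lemma poly_le_exp_square:
  fixes p :: "real poly"
  assumes "c > 0"
  shows "\<exists>C\<ge>0. \<forall>x. \<bar>poly p x\<bar> \<le> C * exp (c * x\<^sup>2)"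
  using assms
proof (induction p arbitrary: c)
  case 0
  then show ?case by (intro exI[of _ 0]) auto
next
  case (pCons a p)
  from pCons.IH[of "c / 2"] pCons.prems obtain C where
    C: "C \<ge> 0" "\<And>x. \<bar>poly p x\<bar> \<le> C * exp (c / 2 * x\<^sup>2)"
    by auto
  have lin: "\<bar>x\<bar> \<le> (1 + 2 / c) * exp (c / 2 * x\<^sup>2)" for x :: real
  proof -
    have "\<bar>x\<bar> \<le> 1 + x\<^sup>2"
      using sum_squares_bound[of 1 "\<bar>x\<bar>"] by simp
    moreover have "1 \<le> exp (c / 2 * x\<^sup>2)"
      using pCons.prems by simp
    moreover have "x\<^sup>2 \<le> 2 / c * exp (c / 2 * x\<^sup>2)"
      using exp_ge_add_one_self[of "c / 2 * x\<^sup>2"] pCons.prems by (simp add: field_simps)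
    ultimately have "\<bar>x\<bar> \<le> exp (c / 2 * x\<^sup>2) + 2 / c * exp (c / 2 * x\<^sup>2)"
      by linarith
    then show ?thesis
      by (simp only: distrib_right mult_1)
  qed
  show ?case
  proof (intro exI[of _ "\<bar>a\<bar> + (1 + 2 / c) * C"] conjI allI)
    show "\<bar>a\<bar> + (1 + 2 / c) * C \<ge> 0"
      using C(1) pCons.prems by simp
    fix x
    have "\<bar>poly (pCons a p) x\<bar> \<le> \<bar>a\<bar> + \<bar>x\<bar> * \<bar>poly p x\<bar>"
      by (simp add: abs_mult[symmetric])
    also have "\<dots> \<le> \<bar>a\<bar> * exp (c * x\<^sup>2) + ((1 + 2 / c) * exp (c / 2 * x\<^sup>2)) * (C * exp (c / 2 * x\<^sup>2))"
      using pCons.prems C(1) by (intro add_mono mult_mono lin C) (auto simp: mult_le_cancel_left1)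
    also have "\<dots> = (\<bar>a\<bar> + (1 + 2 / c) * C) * exp (c * x\<^sup>2)"
      by (simp add: algebra_simps mult_exp_exp)
    finally show "\<bar>poly (pCons a p) x\<bar> \<le> (\<bar>a\<bar> + (1 + 2 / c) * C) * exp (c * x\<^sup>2)" .
  qed
qed

section \<open>Polynomials times the Gaussian\<close>

definition pgauss :: "real poly \<Rightarrow> real \<Rightarrow> real" where
  "pgauss p x = poly p x * exp (- x\<^sup>2 / 2)"

lemma pgauss_bound: "\<exists>C\<ge>0. \<forall>x. \<bar>pgauss p x\<bar> \<le> C * exp (- (1/4) * x\<^sup>2)"
proof -
  obtain C where C: "C \<ge> 0" "\<And>x. \<bar>poly p x\<bar> \<le> C * exp (1/4 * x\<^sup>2)"
    using poly_le_exp_square[of "1/4" p] by auto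
  have "\<bar>pgauss p x\<bar> \<le> C * exp (- (1/4) * x\<^sup>2)" for x
  proof -
    have "\<bar>pgauss p x\<bar> \<le> (C * exp (1/4 * x\<^sup>2)) * exp (- x\<^sup>2 / 2)"
      using C(2)[of x] by (simp add: pgauss_def abs_mult)
    also have "\<dots> = C * exp (- (1/4) * x\<^sup>2)"
      by (simp add: mult.assoc mult_exp_exp)
    finally show ?thesis .
  qed
  with C(1) show ?thesis by blast
qed

lemma pgauss_add: "pgauss (p + q) x = pgauss p x + pgauss q x"
  by (simp add: pgauss_def distrib_right)

lemma pgauss_smult: "pgauss (smult a p) x = a * pgauss p x"
  by (simp add: pgauss_def)

lemma pgauss_diff: "pgauss (p - q) x = pgauss p x - pgauss q x"
  by (simp add: pgauss_def left_diff_distrib)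

lemma continuous_pgauss [continuous_intros]: "continuous_on A (pgauss p)"
  unfolding pgauss_def by (intro continuous_intros) auto

lemma measurable_pgauss [measurable]: "pgauss p \<in> borel_measurable borel"
  by (intro borel_measurable_continuous_onI continuous_pgauss)

text \<open>Differentiation of \<open>pgauss p\<close>, read off on the polynomial factor, so that
  calculus with these functions becomes algebra.\<close>

definition pgderiv :: "real poly \<Rightarrow> real poly" where
  "pgderiv p = pderiv p - [:0, 1:] * p"

lemma DERIV_pgauss: "(pgauss p has_real_derivative pgauss (pgderiv p) x) (at x)"
  unfolding pgauss_def[abs_def] pgderiv_def
  by (auto intro!: derivative_eq_intros poly_DERIV simp: algebra_simps)

lemma vector_derivative_pgauss:
  "((\<lambda>x. complex_of_real (pgauss p x)) has_vector_derivative of_real (pgauss (pgderiv p) x)) (at x)"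
  using DERIV_pgauss by (rule has_vector_derivative_of_real)

lemma iterated_deriv_pgauss:
  "iterated_deriv k (\<lambda>x. complex_of_real (pgauss p x)) = (\<lambda>x. of_real (pgauss ((pgderiv ^^ k) p) x))"
proof (induction k)
  case (Suc k)
  show ?case
    using Suc vector_derivative_at[OF vector_derivative_pgauss] by (simp add: iterated_deriv_def)
qed (simp add: iterated_deriv_def)

lemma square_integrable_bounded_mult_gauss:
  assumes [measurable]: "f \<in> borel_measurable lborel" and "c > 0"
    and "\<And>x. cmod (f x) \<le> C * exp (- c * x\<^sup>2)"
  shows "square_integrable f"
  unfolding square_integrable_def
proof
  show "integrable lborel (\<lambda>x. (cmod (f x))\<^sup>2)"
  proof (rule Bochner_Integration.integrable_bound)
    show "integrable lborel (\<lambda>x::real. C\<^sup>2 * exp (- (2 * c) * x\<^sup>2))"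
      using assms(2) by (intro integrable_mult_right integrable_gaussian) auto
    show "AE x in lborel. norm ((cmod (f x))\<^sup>2) \<le> norm (C\<^sup>2 * exp (- (2 * c) * x\<^sup>2))"
    proof (rule AE_I2)
      fix x
      have "(cmod (f x))\<^sup>2 \<le> (C * exp (- c * x\<^sup>2))\<^sup>2"
        using assms(3) by (intro power_mono) auto
      also have "\<dots> = C\<^sup>2 * exp (- (2 * c) * x\<^sup>2)"
        by (simp add: power_mult_distrib flip: exp_double)
      finally show "norm ((cmod (f x))\<^sup>2) \<le> norm (C\<^sup>2 * exp (- (2 * c) * x\<^sup>2))"
        by simp
    qed
  qed measurable
qed measurable

lemma square_integrable_pgauss: "square_integrable (\<lambda>x. complex_of_real (pgauss p x))"
proof -
  obtain C where "\<And>x. \<bar>pgauss p x\<bar> \<le> C * exp (- (1/4) * x\<^sup>2)"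
    using pgauss_bound by blast
  then show ?thesis
    by (intro square_integrable_bounded_mult_gauss[of _ "1/4" C]) auto
qed

lemma schwartz_pgauss: "schwartz (\<lambda>x. complex_of_real (pgauss p x))"
  unfolding schwartz_def iterated_deriv_pgauss
proof (intro conjI allI)
  show "(\<lambda>x. complex_of_real (pgauss ((pgderiv ^^ k) p) x)) differentiable at x" for k x
    using vector_derivative_pgauss differentiableI_vector by blast
  fix j k
  obtain C where C: "C \<ge> 0" "\<And>x. \<bar>pgauss ([:0, 1:] ^ j * (pgderiv ^^ k) p) x\<bar> \<le> C * exp (- (1/4) * x\<^sup>2)"
    using pgauss_bound by blast
  show "bounded (range (\<lambda>x. x ^ j *\<^sub>R complex_of_real (pgauss ((pgderiv ^^ k) p) x)))"
  proof (rule boundedI)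
    fix z
    assume "z \<in> range (\<lambda>x. x ^ j *\<^sub>R complex_of_real (pgauss ((pgderiv ^^ k) p) x))"
    then obtain x where z: "z = x ^ j *\<^sub>R complex_of_real (pgauss ((pgderiv ^^ k) p) x)"
      by auto
    have "norm z = \<bar>pgauss ([:0, 1:] ^ j * (pgderiv ^^ k) p) x\<bar>"
      unfolding z by (simp add: pgauss_def abs_mult power_abs del: of_real_mult)
    also have "\<dots> \<le> C * exp (- (1/4) * x\<^sup>2)"
      by (rule C)
    also have "\<dots> \<le> C"
      using C(1) by (intro mult_right_le_one_le) auto
    finally show "norm z \<le> C" .
  qed
qed

section \<open>Schwartz functions and the symmetry of the oscillator\<close>

lemma schwartz_deriv:
  assumes "schwartz \<psi>"
  shows "(iterated_deriv k \<psi> has_vector_derivative iterated_deriv (Suc k) \<psi> x) (at x)"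
  using assms unfolding schwartz_def by (simp add: iterated_deriv_def vector_derivative_works)

lemma schwartz_continuous:
  assumes "schwartz \<psi>"
  shows "continuous_on A (iterated_deriv k \<psi>)"
  by (meson schwartz_deriv[OF assms] continuous_at_imp_continuous_on has_vector_derivative_continuous)

lemma schwartz_square_integrable:
  assumes "schwartz \<psi>"
  shows "square_integrable (\<lambda>x. x ^ j *\<^sub>R iterated_deriv k \<psi> x)"
  unfolding square_integrable_def
proof
  show [measurable]: "(\<lambda>x. x ^ j *\<^sub>R iterated_deriv k \<psi> x) \<in> borel_measurable lborel"
    unfolding measurable_lborel2
    by (intro borel_measurable_continuous_onI continuous_intros schwartz_continuous assms)
  have "bounded (range (\<lambda>x. x ^ i *\<^sub>R iterated_deriv k \<psi> x))" for i
    using assms by (simp add: schwartz_def)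
  then have "\<exists>B. \<forall>x. norm (x ^ i *\<^sub>R iterated_deriv k \<psi> x) \<le> B" for i
    unfolding bounded_iff by blast
  then obtain B where B: "\<And>i x. norm (x ^ i *\<^sub>R iterated_deriv k \<psi> x) \<le> B i"
    by metis
  \<comment> \<open>The weights \<open>j\<close> and \<open>j + 2\<close> together bound
    \<open>1 + x^2\<close> times the function, which gives integrable decay of the square.\<close>
  let ?C = "B j + B (j + 2)"
  have dec: "(norm (x ^ j *\<^sub>R iterated_deriv k \<psi> x))\<^sup>2 \<le> ?C\<^sup>2 * inverse (1 + x\<^sup>2)" for x
  proof -
    have "(1 + x\<^sup>2) * norm (x ^ j *\<^sub>R iterated_deriv k \<psi> x)
        = norm (x ^ j *\<^sub>R iterated_deriv k \<psi> x) + norm (x ^ (j + 2) *\<^sub>R iterated_deriv k \<psi> x)"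
      by (simp add: abs_mult distrib_right power2_eq_square)
    also have "\<dots> \<le> ?C"
      by (intro add_mono B)
    finally have *: "(1 + x\<^sup>2) * norm (x ^ j *\<^sub>R iterated_deriv k \<psi> x) \<le> ?C" .
    have pos: "1 + x\<^sup>2 \<ge> 1"
      by simp
    have "(1 + x\<^sup>2) * (norm (x ^ j *\<^sub>R iterated_deriv k \<psi> x))\<^sup>2
        \<le> (1 + x\<^sup>2)\<^sup>2 * (norm (x ^ j *\<^sub>R iterated_deriv k \<psi> x))\<^sup>2"
      using pos by (intro mult_right_mono) (auto intro: self_le_power)
    also have "\<dots> = ((1 + x\<^sup>2) * norm (x ^ j *\<^sub>R iterated_deriv k \<psi> x))\<^sup>2"
      by (simp only: power_mult_distrib)
    also have "\<dots> \<le> ?C\<^sup>2"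
      by (intro power_mono *) auto
    finally show ?thesis
      using pos less_le_trans[OF zero_less_one pos]
      by (simp only: divide_inverse[symmetric] pos_le_divide_eq mult.commute[of _ "1 + x\<^sup>2"])
  qed
  show "integrable lborel (\<lambda>x. (cmod (x ^ j *\<^sub>R iterated_deriv k \<psi> x))\<^sup>2)"
  proof (rule Bochner_Integration.integrable_bound)
    show "integrable lborel (\<lambda>x::real. ?C\<^sup>2 * inverse (1 + x\<^sup>2))"
      using integrable_inverse_1_plus_square by (simp add: set_integrable_def einterval_eq_UNIV)
    show "AE x in lborel. norm ((cmod (x ^ j *\<^sub>R iterated_deriv k \<psi> x))\<^sup>2) \<le> norm (?C\<^sup>2 * inverse (1 + x\<^sup>2))"
      using dec by (intro AE_I2) (simp add: abs_of_nonneg)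
  qed measurable
qed

text \<open>The boundary terms vanish because \<open>\<psi>\<close> is bounded and
  \<open>pgauss p\<close> has Gaussian decay.\<close>

lemma integral_by_parts_pgauss:
  assumes \<psi>: "\<And>x. (\<psi> has_vector_derivative \<psi>' x) (at x)" and cont: "continuous_on UNIV \<psi>'"
    and bounded: "bounded (range \<psi>)"
    and sq: "square_integrable \<psi>" "square_integrable \<psi>'"
  shows "(LINT x|lborel. of_real (pgauss p x) * cnj (\<psi>' x))
      = - (LINT x|lborel. of_real (pgauss (pgderiv p) x) * cnj (\<psi> x))"
proof -
  let ?F = "\<lambda>x. of_real (pgauss p x) * cnj (\<psi> x)"
  let ?f = "\<lambda>x. of_real (pgauss (pgderiv p) x) * cnj (\<psi> x) + of_real (pgauss p x) * cnj (\<psi>' x)"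
  obtain B where B: "\<And>x. cmod (\<psi> x) \<le> B"
    using bounded unfolding bounded_iff by auto
  have "B \<ge> 0"
    using B[of 0] norm_ge_zero order_trans by blast
  obtain C where C: "\<And>x. \<bar>pgauss p x\<bar> \<le> C * exp (- (1/4) * x\<^sup>2)"
    using pgauss_bound by blast
  have le: "cmod (?F x) \<le> C * exp (- (1/4) * x\<^sup>2) * B" for x
    using B[of x] C[of x] by (simp add: norm_mult) (meson abs_ge_zero mult_mono norm_ge_zero order_trans)
  have "(LINT x|lborel. ?f x) = 0"
  proof (rule integral_derivative_eq_zero)
    fix x
    show "(?F has_vector_derivative ?f x) (at x)"
      using has_vector_derivative_mult[OF vector_derivative_pgauss has_vector_derivative_cnj[OF \<psi>]]
      by (simp add: add.commute)
  next
    have "continuous_on UNIV \<psi>"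
      using \<psi> by (meson continuous_at_imp_continuous_on has_vector_derivative_continuous)
    then show "continuous_on UNIV ?f"
      by (intro continuous_intros cont continuous_on_of_real)
  next
    show "integrable lborel ?f"
      by (intro Bochner_Integration.integrable_add integrable_mult_cnj square_integrable_pgauss sq)
  next
    have lim: "((\<lambda>x. C * exp (- (1/4) * x\<^sup>2) * B) \<longlongrightarrow> C * 0 * B) at_top"
      "((\<lambda>x. C * exp (- (1/4) * x\<^sup>2) * B) \<longlongrightarrow> C * 0 * B) at_bot"
      by (intro tendsto_mult tendsto_const tendsto_gaussian; simp)+
    show "(?F \<longlongrightarrow> 0) at_top" "(?F \<longlongrightarrow> 0) at_bot"
      by (rule Lim_null_comparison[OF always_eventually]; use le lim in auto)+
  qed
  moreover have "(LINT x|lborel. ?f x) = (LINT x|lborel. of_real (pgauss (pgderiv p) x) * cnj (\<psi> x))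
      + (LINT x|lborel. of_real (pgauss p x) * cnj (\<psi>' x))"
    by (intro Bochner_Integration.integral_add integrable_mult_cnj square_integrable_pgauss sq)
  ultimately show ?thesis
    by (simp add: eq_neg_iff_add_eq_0 add.commute)
qed

lemma harmonic_oscillator_alt:
  "harmonic_oscillator \<psi> = (\<lambda>x. (-1) * (x ^ 0 *\<^sub>R iterated_deriv 2 \<psi> x) + x ^ 2 *\<^sub>R iterated_deriv 0 \<psi> x)"
  by (simp add: harmonic_oscillator_def fun_eq_iff iterated_deriv_def)

lemma square_integrable_harmonic_oscillator:
  assumes "schwartz \<psi>"
  shows "square_integrable (harmonic_oscillator \<psi>)"
  unfolding harmonic_oscillator_alt
  by (intro square_integrable_add square_integrable_scale schwartz_square_integrable assms)

lemma square_integrable_schwartz: "schwartz \<psi> \<Longrightarrow> square_integrable \<psi>"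
  using schwartz_square_integrable[of \<psi> 0 0] by (simp add: iterated_deriv_def)

definition pgauss_L2 :: "real poly \<Rightarrow> L2" where
  "pgauss_L2 p = abs_L2 (\<lambda>x. complex_of_real (pgauss p x))"

lemma L2_of_eq: "square_integrable f \<Longrightarrow> L2_of f = abs_L2 f"
  by (simp add: L2_of_def)

text \<open>Symmetry of the oscillator in weak form: two integrations by parts move the second
  derivative from \<open>\<psi>\<close> to the Gaussian factor, where the oscillator becomes a map
  of polynomials.\<close>

lemma cinner_pgauss_L2_oscillator:
  assumes \<psi>: "schwartz \<psi>"
  shows "cinner (pgauss_L2 p) (L2_of (harmonic_oscillator \<psi>))
    = cinner (pgauss_L2 ([:0, 0, 1:] * p - pgderiv (pgderiv p))) (L2_of \<psi>)"
proof -
  let ?\<psi> = "\<lambda>k. iterated_deriv k \<psi>"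
  have sq: "square_integrable (?\<psi> k)" for k
    using schwartz_square_integrable[OF \<psi>, of 0 k] by simp
  have bd: "bounded (range (?\<psi> k))" for k
    using \<psi> unfolding schwartz_def by (metis (no_types, lifting) power_0 scaleR_one image_cong)
  note parts = integral_by_parts_pgauss[OF schwartz_deriv[OF \<psi>] schwartz_continuous[OF \<psi>] bd sq sq]
  have "(LINT x|lborel. of_real (pgauss p x) * cnj (?\<psi> 2 x))
      = (LINT x|lborel. of_real (pgauss (pgderiv (pgderiv p)) x) * cnj (?\<psi> 0 x))"
    using parts[of p 1] parts[of "pgderiv p" 0] by (simp add: numeral_2_eq_2)
  moreover have "of_real (pgauss p x) * cnj (x ^ 2 *\<^sub>R ?\<psi> 0 x)
      = of_real (pgauss ([:0, 0, 1:] * p) x) * cnj (?\<psi> 0 x)" for x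
    by (simp add: pgauss_def scaleR_conv_of_real power2_eq_square)
  moreover have "cinner (pgauss_L2 p) (L2_of (harmonic_oscillator \<psi>))
      = (LINT x|lborel. of_real (pgauss p x) * cnj (x ^ 2 *\<^sub>R ?\<psi> 0 x) - of_real (pgauss p x) * cnj (?\<psi> 2 x))"
    unfolding pgauss_L2_def L2_of_eq[OF square_integrable_harmonic_oscillator[OF \<psi>]]
    by (subst cinner_abs_L2[OF square_integrable_pgauss square_integrable_harmonic_oscillator[OF \<psi>]])
       (simp add: harmonic_oscillator_alt algebra_simps)
  ultimately have "cinner (pgauss_L2 p) (L2_of (harmonic_oscillator \<psi>))
      = (LINT x|lborel. of_real (pgauss ([:0, 0, 1:] * p) x) * cnj (?\<psi> 0 x))
        - (LINT x|lborel. of_real (pgauss (pgderiv (pgderiv p)) x) * cnj (?\<psi> 0 x))"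
    by (simp add: Bochner_Integration.integral_diff integrable_mult_cnj square_integrable_pgauss sq
        schwartz_square_integrable[OF \<psi>] del: iterated_deriv_pgauss)
  also have "\<dots> = (LINT x|lborel. of_real (pgauss ([:0, 0, 1:] * p - pgderiv (pgderiv p)) x) * cnj (?\<psi> 0 x))"
    by (subst Bochner_Integration.integral_diff[symmetric])
       (auto intro!: integrable_mult_cnj square_integrable_pgauss sq Bochner_Integration.integral_cong
          simp: pgauss_diff left_diff_distrib)
  also have "\<dots> = cinner (pgauss_L2 ([:0, 0, 1:] * p - pgderiv (pgderiv p))) (L2_of \<psi>)"
    unfolding pgauss_L2_def L2_of_eq[OF square_integrable_schwartz[OF \<psi>]]
    by (subst cinner_abs_L2[OF square_integrable_pgauss square_integrable_schwartz[OF \<psi>]])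
       (simp add: iterated_deriv_def)
  finally show ?thesis .
qed

section \<open>Hermite polynomials in the physicists' normalization\<close>

fun hermite :: "nat \<Rightarrow> real poly" where
  "hermite 0 = 1"
| "hermite (Suc n) = smult 2 ([:0, 1:] * hermite n) - pderiv (hermite n)"

lemma pderiv_hermite_Suc: "pderiv (hermite (Suc n)) = smult (2 * real (Suc n)) (hermite n)"
proof (induction n)
  case 0
  show ?case by (simp add: pderiv_pCons)
next
  case (Suc n)
  have "pderiv (hermite (Suc (Suc n)))
      = smult 2 (hermite (Suc n) + [:0, 1:] * pderiv (hermite (Suc n))) - pderiv (pderiv (hermite (Suc n)))"
    by (subst hermite.simps(2)) (simp add: pderiv_diff pderiv_smult pderiv_mult pderiv_pCons smult_add_right add.commute del: hermite.simps)
  also have "\<dots> = smult 2 (hermite (Suc n))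
      + smult (2 * real (Suc n)) (smult 2 ([:0, 1:] * hermite n) - pderiv (hermite n))"
    unfolding Suc by (simp add: pderiv_smult smult_add_right smult_diff_right mult.commute del: hermite.simps)
  also have "\<dots> = smult (2 * real (Suc (Suc n))) (hermite (Suc n))"
    by (simp only: hermite.simps(2)[symmetric] smult_add_left[symmetric]) (simp add: algebra_simps)
  finally show ?case .
qed

text \<open>For \<open>n = 0\<close> the truncated index \<open>n - 1\<close> is harmless, since its
  coefficient vanishes. In the completeness proof the recursion trades multiplication by x for
  shifts of the index.\<close>

lemma hermite_rec: "[:0, 1:] * hermite n = smult (1/2) (hermite (Suc n)) + smult (real n) (hermite (n - 1))"
proof (cases n)
  case (Suc m)
  then have "smult (1/2) (pderiv (hermite n)) = smult (real n) (hermite (n - 1))"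
    using pderiv_hermite_Suc[of m] by (simp add: add_divide_distrib del: hermite.simps)
  then show ?thesis
    by (simp add: smult_diff_right)
qed simp

lemma hermite_ode:
  "pderiv (pderiv (hermite n)) - smult 2 ([:0, 1:] * pderiv (hermite n)) = smult (- 2 * real n) (hermite n)"
proof (cases n)
  case (Suc m)
  show ?thesis
    unfolding Suc pderiv_hermite_Suc
    by (rule poly_eq_poly_eq_iff[THEN iffD1]) (simp add: fun_eq_iff pderiv_smult algebra_simps)
qed simp

text \<open>Conjugating the oscillator by the Gaussian gives \<open>p - (p'' - 2 x p')\<close>;
  Hermite's differential equation then produces the eigenvalue.\<close>

lemma pgderiv_hermite: "[:0, 0, 1:] * hermite n - pgderiv (pgderiv (hermite n)) = smult (2 * real n + 1) (hermite n)"
proof -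
  have "[:0, 0, 1:] * hermite n - pgderiv (pgderiv (hermite n))
      = hermite n - (pderiv (pderiv (hermite n)) - smult 2 ([:0, 1:] * pderiv (hermite n)))"
    unfolding pgderiv_def
    by (rule poly_eq_poly_eq_iff[THEN iffD1]) (simp add: fun_eq_iff pderiv_diff pderiv_mult pderiv_pCons algebra_simps)
  also have "\<dots> = smult (2 * real n + 1) (hermite n)"
    unfolding hermite_ode by (simp add: smult_add_left)
  finally show ?thesis .
qed

lemma pgauss_L2_smult: "pgauss_L2 (smult a p) = a *\<^sub>R pgauss_L2 p"
  unfolding pgauss_L2_def scaleR_L2.abs_eq[OF L2_rel_refl[OF square_integrable_pgauss]]
  by (simp add: pgauss_smult)

lemma pgauss_L2_add: "pgauss_L2 (p + q) = pgauss_L2 p + pgauss_L2 q"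
  unfolding pgauss_L2_def plus_L2.abs_eq[OF L2_rel_refl[OF square_integrable_pgauss] L2_rel_refl[OF square_integrable_pgauss]]
  by (simp add: pgauss_add)

lemma cinner_hermite_oscillator:
  assumes "schwartz \<psi>"
  shows "cinner (pgauss_L2 (hermite n)) (L2_of (harmonic_oscillator \<psi>)) = (2 * real n + 1) *\<^sub>R cinner (pgauss_L2 (hermite n)) (L2_of \<psi>)"
  using cinner_pgauss_L2_oscillator[OF assms, of "hermite n"]
  by (simp only: pgderiv_hermite pgauss_L2_smult cinner.scaleR_left)

lemma oscillator_hermite:
  "harmonic_oscillator (\<lambda>x. complex_of_real (pgauss (hermite n) x))
    = (\<lambda>x. of_real (pgauss (smult (2 * real n + 1) (hermite n)) x))"
  unfolding pgderiv_hermite[symmetric] harmonic_oscillator_def iterated_deriv_pgauss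
  by (auto simp: fun_eq_iff pgauss_diff numeral_2_eq_2 scaleR_conv_of_real) (simp add: pgauss_def power2_eq_square)

text \<open>Eigenvectors of a symmetric operator for distinct eigenvalues; the weak form is tested
  with a Hermite function, which is Schwartz.\<close>

lemma hermite_orthogonal:
  assumes "m \<noteq> n"
  shows "cinner (pgauss_L2 (hermite m)) (pgauss_L2 (hermite n)) = 0"
proof -
  let ?\<psi> = "\<lambda>x. complex_of_real (pgauss (hermite n) x)"
  have 1: "L2_of ?\<psi> = pgauss_L2 (hermite n)"
    by (simp add: L2_of_eq square_integrable_pgauss pgauss_L2_def)
  have 2: "L2_of (harmonic_oscillator ?\<psi>) = (2 * real n + 1) *\<^sub>R pgauss_L2 (hermite n)"
    unfolding oscillator_hermite pgauss_L2_smult[symmetric] by (simp add: L2_of_eq square_integrable_pgauss pgauss_L2_def)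
  have "(2 * real n + 1) *\<^sub>R cinner (pgauss_L2 (hermite m)) (pgauss_L2 (hermite n))
      = (2 * real m + 1) *\<^sub>R cinner (pgauss_L2 (hermite m)) (pgauss_L2 (hermite n))"
    using cinner_hermite_oscillator[OF schwartz_pgauss, of m "hermite n"] unfolding 1 2
    by (simp add: cinner.scaleR_right)
  with assms show ?thesis
    by simp
qed

section \<open>Completeness of the Hermite functions\<close>

lemma AE_zero_of_fourier_zero_real:
  fixes k :: "real \<Rightarrow> real"
  assumes k: "integrable lborel k"
    and fourier: "\<And>\<xi>. (LINT x|lborel. of_real (k x) * iexp (\<xi> * x)) = 0"
  shows "AE x in lborel. k x = 0"
proof -
  \<comment> \<open>The positive and negative parts have the same mass \<open>c\<close>, by the
    transform at 0. If \<open>c\<close> is nonzero, both are normalized to probability densities,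
    which Levy's uniqueness theorem identifies through their characteristic functions.\<close>
  define kp where "kp x = max 0 (k x)" for x
  define km where "km x = max 0 (- k x)" for x
  have int: "integrable lborel kp" "integrable lborel km"
    unfolding kp_def km_def using k by (auto intro!: Bochner_Integration.integrable_max)
  note [measurable] = borel_measurable_integrable[OF int(1)] borel_measurable_integrable[OF int(2)]
  have nonneg: "kp x \<ge> 0" "km x \<ge> 0" for x
    by (simp_all add: kp_def km_def)
  have k_eq: "k x = kp x - km x" for x
    by (simp add: kp_def km_def)
  define c where "c = (LINT x|lborel. kp x)"
  have "(LINT x|lborel. k x) = 0"
    using fourier[of 0] by simp
  then have c': "(LINT x|lborel. km x) = c"
    unfolding k_eq c_def using int by (simp add: Bochner_Integration.integral_diff)
  show ?thesis
  proof (cases "c = 0")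
    case True
    then have "AE x in lborel. kp x = 0" "AE x in lborel. km x = 0"
      using integral_nonneg_eq_0_iff_AE[OF int(1)] integral_nonneg_eq_0_iff_AE[OF int(2)] nonneg c'
      by (simp_all add: c_def)
    then show ?thesis
      by eventually_elim (simp add: k_eq)
  next
    case False
    moreover have "c \<ge> 0"
      unfolding c_def using nonneg by simp
    ultimately have "c > 0"
      by simp
    define M where "M f = density lborel (\<lambda>x. ennreal (f x / c))" for f :: "real \<Rightarrow> real"
    have dist: "real_distribution (M f)"
      if f: "integrable lborel f" "\<And>x. f x \<ge> 0" "(LINT x|lborel. f x) = c" for f
    proof -
      have [measurable]: "f \<in> borel_measurable borel"
        using borel_measurable_integrable[OF f(1)] by simp
      have "emeasure (M f) (space (M f)) = (\<integral>\<^sup>+ x. ennreal (f x / c) \<partial>lborel)"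
        by (simp add: M_def emeasure_density)
      also have "\<dots> = 1"
        using f \<open>c > 0\<close> by (simp add: nn_integral_eq_integral)
      finally have "prob_space (M f)"
        by (rule prob_spaceI)
      then show ?thesis
        by (simp add: real_distribution_def real_distribution_axioms_def M_def)
    qed
    have char: "char (M f) \<xi> = (LINT x|lborel. (of_real (f x) * iexp (\<xi> * x)) / of_real c)"
      if f: "integrable lborel f" "\<And>x. f x \<ge> 0" for f \<xi>
    proof -
      have [measurable]: "f \<in> borel_measurable borel"
        using borel_measurable_integrable[OF f(1)] by simp
      show ?thesis
        unfolding char_def M_def using f(2) \<open>c > 0\<close>
        by (subst integral_density) (auto simp: scaleR_conv_of_real)
    qed
    have int_exp: "integrable lborel (\<lambda>x. of_real (f x) * iexp (\<xi> * x) / of_real c)"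
      if "integrable lborel f" for f :: "real \<Rightarrow> real" and \<xi>
    proof (rule Bochner_Integration.integrable_bound)
      show "integrable lborel (\<lambda>x. f x / c)"
        using that by simp
      show "(\<lambda>x. of_real (f x) * iexp (\<xi> * x) / of_real c) \<in> borel_measurable lborel"
        using borel_measurable_integrable[OF that] by measurable
    qed (auto simp: norm_mult norm_divide)
    have "char (M kp) = char (M km)"
    proof
      fix \<xi>
      have "char (M kp) \<xi> - char (M km) \<xi> = (LINT x|lborel.
          of_real (kp x) * iexp (\<xi> * x) / of_real c - of_real (km x) * iexp (\<xi> * x) / of_real c)"
        unfolding char[OF int(1) nonneg(1)] char[OF int(2) nonneg(2)]
        by (rule Bochner_Integration.integral_diff[symmetric]; intro int_exp int)
      also have "\<dots> = (LINT x|lborel. of_real (k x) * iexp (\<xi> * x) / of_real c)"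
        by (simp add: k_eq left_diff_distrib diff_divide_distrib)
      also have "\<dots> = 0"
        using fourier[of \<xi>] by simp
      finally show "char (M kp) \<xi> = char (M km) \<xi>"
        by simp
    qed
    then have "M kp = M km"
      by (intro Levy_uniqueness dist int nonneg c' c_def[symmetric])
    moreover have "(\<integral>\<^sup>+ x. ennreal (kp x / c) \<partial>lborel) \<noteq> \<infinity>"
      using int(1) nonneg(1) \<open>c > 0\<close> by (simp add: nn_integral_eq_integral)
    ultimately have "AE x in lborel. ennreal (kp x / c) = ennreal (km x / c)"
      unfolding M_def by (subst (asm) finite_density_unique) auto
    then show ?thesis
      by eventually_elim (use \<open>c > 0\<close> nonneg in \<open>simp add: k_eq\<close>)
  qed
qed

text \<open>The transform of the conjugate at \<open>\<xi>\<close> is the conjugate of the transform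
  at \<open>- \<xi>\<close>, so the real and imaginary parts have vanishing transforms as
  well.\<close>

lemma AE_zero_of_fourier_zero:
  fixes k :: "real \<Rightarrow> complex"
  assumes k: "integrable lborel k"
    and fourier: "\<And>\<xi>. (LINT x|lborel. k x * iexp (\<xi> * x)) = 0"
  shows "AE x in lborel. k x = 0"
proof -
  have [measurable]: "k \<in> borel_measurable borel"
    using borel_measurable_integrable[OF k] by simp
  have int: "integrable lborel (\<lambda>x. k x * iexp (\<xi> * x))" for \<xi>
    by (rule Bochner_Integration.integrable_bound[OF k]) (auto simp: norm_mult)
  have int': "integrable lborel (\<lambda>x. cnj (k x) * iexp (\<xi> * x))" for \<xi>
    by (rule Bochner_Integration.integrable_bound[OF k]) (auto simp: norm_mult)
  have fourier': "(LINT x|lborel. cnj (k x) * iexp (\<xi> * x)) = 0" for \<xi>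
  proof -
    have "(LINT x|lborel. cnj (k x) * iexp (\<xi> * x)) = (LINT x|lborel. cnj (k x * iexp (- \<xi> * x)))"
      by (simp add: exp_cnj)
    also have "\<dots> = cnj (LINT x|lborel. k x * iexp (- \<xi> * x))"
      by (rule Bochner_Integration.integral_cnj)
    finally show ?thesis
      by (simp only: fourier complex_cnj_zero)
  qed
  have re: "of_real (Re (k x)) * z = (k x * z + cnj (k x) * z) / 2"
    and im: "of_real (Im (k x)) * z = (k x * z - cnj (k x) * z) / (2 * \<i>)" for x z
    unfolding distrib_right[symmetric] left_diff_distrib[symmetric] complex_add_cnj complex_diff_cnj
    by (simp, simp add: complex_eq_iff)
  have "AE x in lborel. Re (k x) = 0"
    using int int' fourier fourier' k
    by (intro AE_zero_of_fourier_zero_real) (simp_all only: re, auto)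
  moreover have "AE x in lborel. Im (k x) = 0"
    using int int' fourier fourier' k
    by (intro AE_zero_of_fourier_zero_real) (simp_all only: im, auto)
  ultimately show ?thesis
    by eventually_elim (simp add: complex_eq_iff)
qed

lemma cinner_pgauss_L2: "cinner f (pgauss_L2 p) = (LINT x|lborel. rep_L2 f x * of_real (pgauss p x))"
  using cinner_abs_L2[OF square_integrable_rep square_integrable_pgauss, of f p] by (simp add: pgauss_L2_def)

text \<open>Expanding the exponential turns the Fourier transform of \<open>f\<close> times the
  Gaussian into a series of moments of \<open>f\<close>, all zero; injectivity of the transform does
  the rest.\<close>

lemma moments_imp_zero:
  assumes "\<And>k. cinner f (pgauss_L2 ([:0, 1:] ^ k)) = 0"
  shows "f = 0"
proof -
  define g where "g x = rep_L2 f x * of_real (exp (- x\<^sup>2 / 2))" for x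
  have [measurable]: "g \<in> borel_measurable borel"
    unfolding g_def by simp
  have sq: "square_integrable (\<lambda>x. complex_of_real (exp (- (1/4) * x\<^sup>2)))"
    by (rule square_integrable_bounded_mult_gauss[where c = "1/4" and C = 1]) auto
  have "integrable lborel (\<lambda>x. norm (rep_L2 f x * cnj (complex_of_real (exp (- (1/4) * x\<^sup>2)))))"
    by (intro integrable_norm integrable_mult_cnj sq square_integrable_rep)
  then have dom: "integrable lborel (\<lambda>x. exp (\<xi>\<^sup>2) * (cmod (rep_L2 f x) * exp (- (1/4) * x\<^sup>2)))" for \<xi> :: real
    by (intro integrable_mult_right) (simp add: norm_mult)
  have bound: "cmod (g x) * exp \<bar>\<xi> * x\<bar> \<le> exp (\<xi>\<^sup>2) * (cmod (rep_L2 f x) * exp (- (1/4) * x\<^sup>2))" for \<xi> x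
  proof -
    \<comment> \<open>Completing the square: half of the Gaussian absorbs
      \<open>exp \<bar>\<xi> * x\<bar>\<close>, the other half keeps the product with
      \<open>f\<close> integrable.\<close>
    have "0 \<le> (\<bar>\<xi>\<bar> - \<bar>x\<bar> / 2)\<^sup>2"
      by simp
    then have "- x\<^sup>2 / 2 + \<bar>\<xi> * x\<bar> \<le> \<xi>\<^sup>2 + - (1/4) * x\<^sup>2"
      by (simp add: power2_diff abs_mult power_divide)
    then have "exp (- x\<^sup>2 / 2) * exp \<bar>\<xi> * x\<bar> \<le> exp (\<xi>\<^sup>2) * exp (- (1/4) * x\<^sup>2)"
      unfolding mult_exp_exp by simp
    then have "cmod (rep_L2 f x) * (exp (- x\<^sup>2 / 2) * exp \<bar>\<xi> * x\<bar>)
        \<le> cmod (rep_L2 f x) * (exp (\<xi>\<^sup>2) * exp (- (1/4) * x\<^sup>2))"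
      by (intro mult_left_mono) auto
    then show ?thesis
      by (simp add: g_def norm_mult mult_ac)
  qed
  have g: "integrable lborel g"
    by (rule Bochner_Integration.integrable_bound[OF dom[of 0]]) (use bound[where \<xi> = 0] in auto)
  have "(LINT x|lborel. g x * iexp (\<xi> * x)) = 0" for \<xi>
  proof -
    define s where "s N x = (\<Sum>k<N. (\<i> * of_real (\<xi> * x)) ^ k / fact k)" for N and x
    have s_le: "cmod (s N x) \<le> exp \<bar>\<xi> * x\<bar>" for N x
    proof -
      have "cmod (s N x) \<le> (\<Sum>k<N. \<bar>\<xi> * x\<bar> ^ k / fact k)"
        unfolding s_def
        by (rule order_trans[OF norm_sum])
           (simp add: norm_divide norm_power norm_mult abs_mult)
      also have "\<dots> \<le> (\<Sum>k. \<bar>\<xi> * x\<bar> ^ k / fact k)"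
        using summable_exp_generic[of "\<bar>\<xi> * x\<bar>"]
        by (intro sum_le_suminf) (auto simp: divide_inverse mult.commute)
      also have "\<dots> = exp \<bar>\<xi> * x\<bar>"
        by (simp add: exp_def divide_inverse mult.commute)
      finally show ?thesis .
    qed
    have "(\<lambda>N. LINT x|lborel. g x * s N x) \<longlonglongrightarrow> (LINT x|lborel. g x * iexp (\<xi> * x))"
    proof (rule integral_dominated_convergence[OF _ _ dom[of \<xi>]])
      show "AE x in lborel. (\<lambda>N. g x * s N x) \<longlonglongrightarrow> g x * iexp (\<xi> * x)"
      proof (intro AE_I2 tendsto_mult tendsto_const)
        fix x
        show "(\<lambda>N. s N x) \<longlonglongrightarrow> iexp (\<xi> * x)"
          unfolding s_def using exp_converges[of "\<i> * of_real (\<xi> * x)"]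
          by (simp add: sums_def scaleR_conv_of_real divide_inverse mult.commute)
      qed
      show "AE x in lborel. norm (g x * s N x) \<le> exp (\<xi>\<^sup>2) * (cmod (rep_L2 f x) * exp (- (1/4) * x\<^sup>2))" for N
        using bound s_le by (intro AE_I2) (auto simp: norm_mult intro!: order_trans[OF mult_left_mono[OF s_le]])
    qed (auto simp: s_def)
    moreover have "(LINT x|lborel. g x * s N x) = 0" for N
    proof -
      have int: "integrable lborel (\<lambda>x. rep_L2 f x * of_real (pgauss ([:0, 1:] ^ k) x))" for k
        using integrable_mult_cnj[OF square_integrable_rep square_integrable_pgauss, of f "[:0, 1:] ^ k"] by simp
      have "g x * s N x = (\<Sum>k<N. (\<i> * of_real \<xi>) ^ k / fact k * (rep_L2 f x * of_real (pgauss ([:0, 1:] ^ k) x)))" for x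
        unfolding s_def sum_distrib_left g_def
        by (intro sum.cong) (auto simp: pgauss_def power_mult_distrib)
      then have "(LINT x|lborel. g x * s N x)
          = (\<Sum>k<N. (\<i> * of_real \<xi>) ^ k / fact k * cinner f (pgauss_L2 ([:0, 1:] ^ k)))"
        using int by (simp add: Bochner_Integration.integral_sum cinner_pgauss_L2)
      then show ?thesis
        by (simp add: assms)
    qed
    ultimately show ?thesis
      by (simp add: LIMSEQ_const_iff)
  qed
  with g have "AE x in lborel. g x = 0"
    by (rule AE_zero_of_fourier_zero)
  then have "AE x in lborel. rep_L2 f x = 0"
    by eventually_elim (simp add: g_def)
  then have "abs_L2 (rep_L2 f) = abs_L2 (\<lambda>x. 0)"
    by (subst abs_L2_eq_iff) (auto simp: square_integrable_zero)
  then show ?thesis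
    by (simp add: zero_L2_def)
qed

text \<open>Orthogonality to all Hermite polynomials passes by the three-term recursion to
  \<open>x ^ k\<close> times each of them; index 0 yields the monomials.\<close>

lemma hermite_total:
  assumes "\<And>n. cinner f (pgauss_L2 (hermite n)) = 0"
  shows "f = 0"
proof (rule moments_imp_zero)
  fix k
  have "cinner f (pgauss_L2 ([:0, 1:] ^ k * hermite n)) = 0" for n
  proof (induction k arbitrary: n)
    case (Suc k)
    have "[:0, 1:] ^ Suc k * hermite n = [:0, 1:] ^ k * ([:0, 1:] * hermite n)"
      by (simp add: mult_ac)
    also have "\<dots> = smult (1/2) ([:0, 1:] ^ k * hermite (Suc n)) + smult (real n) ([:0, 1:] ^ k * hermite (n - 1))"
      unfolding hermite_rec by (simp add: distrib_left)
    finally show ?case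
      using Suc[of "Suc n"] Suc[of "n - 1"]
      by (simp only: pgauss_L2_add pgauss_L2_smult cinner.add_right cinner.scaleR_right scaleR_zero_right add_0_right)
  qed (simp add: assms)
  from this[of 0] show "cinner f (pgauss_L2 ([:0, 1:] ^ k)) = 0"
    by simp
qed

lemma pgauss_L2_eq_zero_iff: "pgauss_L2 p = 0 \<longleftrightarrow> p = 0"
proof
  assume "pgauss_L2 p = 0"
  then have "AE x in lborel. complex_of_real (pgauss p x) = 0"
    unfolding pgauss_L2_def zero_L2_def
    by (subst (asm) abs_L2_eq_iff) (auto simp: square_integrable_zero square_integrable_pgauss)
  then have AE: "AE x in lborel. poly p x = 0"
    by eventually_elim (simp add: pgauss_def)
  show "p = 0"
  proof (rule ccontr)
    assume "p \<noteq> 0"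
    then have "finite {x. poly p x = 0}"
      by (rule poly_roots_finite)
    then have "{x. poly p x = 0} \<in> null_sets lborel"
      by (rule finite_imp_null_set_lborel)
    then have "AE x in lborel. poly p x \<noteq> 0"
      by (rule AE_I') auto
    with AE have "AE x in (lborel :: real measure). False"
      by eventually_elim simp
    then show False
      by (simp add: AE_iff_null null_sets_def)
  qed
qed (simp add: pgauss_L2_def pgauss_def zero_L2_def)

lemma hermite_nonzero: "hermite n \<noteq> 0"
proof (induction n)
  case (Suc n)
  show ?case
  proof
    assume "hermite (Suc n) = 0"
    then have "smult (2 * real (Suc n)) (hermite n) = 0"
      using pderiv_hermite_Suc[of n] by (simp del: hermite.simps)
    with Suc show False by simp
  qed
qed simp

section \<open>The normalized Hermite basis\<close>

definition hnorm :: "nat \<Rightarrow> real" where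
  "hnorm n = norm (pgauss_L2 (hermite n))"

lemma hnorm_pos: "hnorm n > 0"
  by (simp add: hnorm_def pgauss_L2_eq_zero_iff hermite_nonzero)

definition herm :: "nat \<Rightarrow> L2" where
  "herm n = (1 / hnorm n) *\<^sub>R pgauss_L2 (hermite n)"

interpretation herm: orthonormal_basis_L2 herm
proof
  fix m n
  show "cinner (herm m) (herm n) = (if m = n then 1 else 0)"
    using hermite_orthogonal[of m n] hnorm_pos[of n]
    by (simp add: herm_def cinner.scaleR_left cinner.scaleR_right cinner_self hnorm_def[symmetric] scaleR_conv_of_real power2_eq_square)
next
  fix f
  assume "\<And>n. cinner f (herm n) = 0"
  then show "f = 0"
    using less_imp_neq[OF hnorm_pos] by (intro hermite_total) (simp add: herm_def cinner.scaleR_right)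
qed

lemma coeff_herm: "herm.coeff f n = cinner f (pgauss_L2 (hermite n)) / hnorm n"
  by (simp add: herm.coeff_def herm_def cinner.scaleR_right scaleR_conv_of_real)

section \<open>The propagator\<close>

definition phase :: "real \<Rightarrow> nat \<Rightarrow> complex" where
  "phase t n = cis (t * (2 * real n + 1))"

definition flow :: "real \<Rightarrow> L2 \<Rightarrow> L2" where
  "flow t = herm.diag (phase t)"

lemma norm_phase [simp]: "cmod (phase t n) = 1"
  by (simp add: phase_def)

lemma phase_le: "cmod (phase t n) \<le> 1"
  by simp

lemma coeff_flow: "herm.coeff (flow t f) n = phase t n * herm.coeff f n"
  unfolding flow_def by (rule herm.coeff_diag[OF phase_le])

lemma flow_0 [simp]: "flow 0 f = f"
  by (rule herm.eqI) (simp add: coeff_flow phase_def)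

lemma norm_flow [simp]: "norm (flow t f) = norm f"
  unfolding flow_def by (rule herm.norm_diag_unimodular) simp

lemma flow_add: "flow t (f + g) = flow t f + flow t g"
  unfolding flow_def by (rule herm.diag_add[OF phase_le])

lemma flow_scaleC: "flow t (c *\<^sub>C f) = c *\<^sub>C flow t f"
  unfolding flow_def by (rule herm.diag_scaleC[OF phase_le])

lemma flow_scaleR: "flow t (r *\<^sub>R f) = r *\<^sub>R flow t f"
  by (simp add: scaleR_eq_scaleC flow_scaleC)

lemma cinner_flow: "cinner (flow t f) g = cinner f (flow (- t) g)"
proof -
  have "herm.coeff (flow t f) n * cnj (herm.coeff g n) = herm.coeff f n * cnj (herm.coeff (flow (- t) g) n)" for n
    by (simp add: coeff_flow phase_def cis_cnj)
  then show ?thesis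
    using herm.parseval[of "flow t f" g] herm.parseval[of f "flow (- t) g"] by (simp add: sums_unique2)
qed

lemma tendsto_phase: "((\<lambda>s. phase s n) \<longlongrightarrow> phase t n) (at t within A)"
  unfolding phase_def by (intro tendsto_intros tendsto_cis) 

lemma continuous_flow: "continuous_on A (\<lambda>t. flow t f)"
  unfolding flow_def continuous_on_def by (intro ballI herm.tendsto_diag tendsto_phase) auto

text \<open>Since the flow is isometric, perturbing the argument costs no more than the norm of the
  perturbation, and strong continuity handles the time. Measurability of the flow in both arguments
  rests on this joint continuity.\<close>

lemma tendsto_flow:
  assumes s: "(s \<longlongrightarrow> t) F" and g: "(g \<longlongrightarrow> f) F"
  shows "((\<lambda>x. flow (s x) (g x)) \<longlongrightarrow> flow t f) F"
proof -
  have "((\<lambda>x. norm (g x - f)) \<longlongrightarrow> 0) F"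
    using g by (simp add: LIM_zero_iff tendsto_norm_zero_iff)
  then have "((\<lambda>x. flow (s x) (g x - f)) \<longlongrightarrow> 0) F"
    by (subst tendsto_norm_zero_iff[symmetric]) simp
  moreover have "isCont (\<lambda>t. flow t f) t"
    using continuous_flow[of UNIV f] by (simp add: continuous_on_eq_continuous_at)
  from isCont_tendsto_compose[OF this s] have "((\<lambda>x. flow (s x) f) \<longlongrightarrow> flow t f) F" .
  ultimately have "((\<lambda>x. flow (s x) (g x - f) + flow (s x) f) \<longlongrightarrow> 0 + flow t f) F"
    by (rule tendsto_add)
  then show ?thesis
    by (simp flip: flow_add)
qed

lemma L2_of_pgauss_L2: "L2_of (\<lambda>x. complex_of_real (pgauss p x)) = pgauss_L2 p"
  by (simp add: L2_of_eq square_integrable_pgauss pgauss_L2_def)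

lemma coeff_oscillator:
  assumes "schwartz \<psi>"
  shows "herm.coeff (L2_of (harmonic_oscillator \<psi>)) n = of_real (2 * real n + 1) * herm.coeff (L2_of \<psi>) n"
proof -
  have "cinner (L2_of (harmonic_oscillator \<psi>)) (pgauss_L2 (hermite n)) = cnj (cinner (pgauss_L2 (hermite n)) (L2_of (harmonic_oscillator \<psi>)))"
    by (rule cinner_commute)
  also have "\<dots> = of_real (2 * real n + 1) * cnj (cinner (pgauss_L2 (hermite n)) (L2_of \<psi>))"
    unfolding cinner_hermite_oscillator[OF assms] by (simp add: scaleR_conv_of_real)
  also have "\<dots> = of_real (2 * real n + 1) * cinner (L2_of \<psi>) (pgauss_L2 (hermite n))"
    by (simp add: cinner_commute[of "L2_of \<psi>" "pgauss_L2 (hermite n)"])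
  finally show ?thesis
    by (simp add: coeff_herm)
qed

text \<open>The Parseval series of the pairing is differentiated termwise. The factor
  \<open>2 n + 1\<close> is absorbed into the coefficients of the oscillator applied to
  \<open>\<psi>\<close>, so the derived series has a summable majorant independent of
  \<open>t\<close>.\<close>

lemma flow_solution: "oscillator_solution f (\<lambda>t. flow t f)"
  unfolding oscillator_solution_def
proof (intro conjI allI impI)
  show "continuous_on UNIV (\<lambda>t. flow t f)" by (rule continuous_flow)
  show "flow 0 f = f" by simp
  fix \<psi> t
  assume \<psi>: "schwartz \<psi>"
  let ?\<psi> = "L2_of \<psi>" and ?H\<psi> = "L2_of (harmonic_oscillator \<psi>)"
  define a where "a n t = phase t n * herm.coeff f n * cnj (herm.coeff ?\<psi> n)" for n t
  define b where "b n t = \<i> * (phase t n * herm.coeff f n * cnj (herm.coeff ?H\<psi> n))" for n t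
  have a_sums: "(\<lambda>n. a n t) sums cinner (flow t f) ?\<psi>" for t
    using herm.parseval[of "flow t f" ?\<psi>] by (simp add: coeff_flow a_def)
  have b_sums: "(\<lambda>n. b n t) sums (\<i> * cinner (flow t f) ?H\<psi>)" for t
    using sums_mult[OF herm.parseval[of "flow t f" ?H\<psi>], of \<i>] by (simp add: coeff_flow b_def)
  have phase_deriv: "((\<lambda>t. phase t n) has_vector_derivative \<i> * of_real (2 * real n + 1) * phase t n) (at t)" for n t
  proof -
    have "((\<lambda>t. exp (\<i> * of_real (t * (2 * real n + 1)))) has_vector_derivative
        (of_real (2 * real n + 1) * \<i>) * exp (\<i> * of_real (t * (2 * real n + 1)))) (at t)"
      by (rule has_vector_derivative_real_field[of "\<lambda>z. exp (\<i> * (z * of_real (2 * real n + 1)))", simplified of_real_mult[symmetric]])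
         (auto intro!: derivative_eq_intros)
    then show ?thesis
      by (simp add: phase_def[abs_def] cis_conv_exp mult_ac)
  qed
  have a_deriv: "((\<lambda>t. a n t) has_vector_derivative b n t) (at t)" for n t
    using has_vector_derivative_mult_left[OF phase_deriv[of n t], of "herm.coeff f n * cnj (herm.coeff ?\<psi> n)"]
    by (simp add: a_def b_def coeff_oscillator[OF \<psi>] mult_ac)
  have unif: "uniform_limit UNIV (\<lambda>N t. \<Sum>n<N. b n t) (\<lambda>t. \<Sum>n. b n t) sequentially"
    by (rule Weierstrass_m_test[OF _ herm.summable_coeff_mult[of f ?H\<psi>]])
       (simp add: b_def norm_mult)
  have "\<exists>g. \<forall>t\<in>UNIV. (\<lambda>n. a n t) sums g t \<and> (g has_derivative (\<lambda>h. h *\<^sub>R (\<i> * cinner (flow t f) ?H\<psi>))) (at t within UNIV)"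
  proof (rule has_derivative_series)
    show "(a n has_derivative (\<lambda>h. h *\<^sub>R b n t)) (at t within UNIV)" for n t
      using a_deriv[of n t] by (simp add: has_vector_derivative_def)
    show "(\<lambda>n. a n 0) sums cinner (flow 0 f) ?\<psi>"
      by (rule a_sums)
    fix e :: real
    assume "e > 0"
    then have "\<forall>\<^sub>F N in sequentially. \<forall>t\<in>UNIV. dist (\<Sum>n<N. b n t) (\<Sum>n. b n t) < e"
      using unif by (simp add: uniform_limit_iff)
    then show "\<forall>\<^sub>F N in sequentially. \<forall>t\<in>UNIV. \<forall>h.
        norm ((\<Sum>n<N. h *\<^sub>R b n t) - h *\<^sub>R (\<i> * cinner (flow t f) ?H\<psi>)) \<le> e * norm h"
    proof eventually_elim
      case (elim N)
      show ?case
      proof (intro ballI allI)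
        fix t h :: real
        have "(\<Sum>n<N. h *\<^sub>R b n t) - h *\<^sub>R (\<i> * cinner (flow t f) ?H\<psi>) = h *\<^sub>R ((\<Sum>n<N. b n t) - (\<Sum>n. b n t))"
          using sums_unique[OF b_sums[of t]] by (simp add: scaleR_sum_right scaleR_diff_right)
        also have "norm \<dots> \<le> \<bar>h\<bar> * e"
          using elim[rule_format, of t] by (auto simp: dist_norm intro!: mult_left_mono)
        finally show "norm ((\<Sum>n<N. h *\<^sub>R b n t) - h *\<^sub>R (\<i> * cinner (flow t f) ?H\<psi>)) \<le> e * norm h"
          by (simp add: mult.commute)
      qed
    qed
  qed auto
  then obtain g where g: "\<And>t. (\<lambda>n. a n t) sums g t"
    "\<And>t. (g has_vector_derivative \<i> * cinner (flow t f) ?H\<psi>) (at t)"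
    by (auto simp: has_vector_derivative_def)
  have "g = (\<lambda>t. cinner (flow t f) ?\<psi>)"
    using sums_unique2[OF g(1) a_sums] by auto
  with g(2)[of t] show "((\<lambda>t. cinner (flow t f) ?\<psi>) has_vector_derivative \<i> * cinner (flow t f) ?H\<psi>) (at t)"
    by simp
qed

text \<open>Hermite functions are admissible test functions, so each coefficient of a solution
  satisfies a scalar linear equation, solved by an integrating factor.\<close>

lemma oscillator_solution_unique:
  assumes "oscillator_solution f u"
  shows "u = (\<lambda>t. flow t f)"
proof
  fix t
  show "u t = flow t f"
  proof (rule herm.eqI)
    fix n
    let ?E = "\<lambda>t. exp (- (\<i> * of_real (2 * real n + 1)) * of_real t)"
    define c where "c t = cinner (u t) (pgauss_L2 (hermite n))" for t
    have c': "(c has_vector_derivative (\<i> * of_real (2 * real n + 1)) * c t) (at t)" for t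
    proof -
      have "L2_of (harmonic_oscillator (\<lambda>x. complex_of_real (pgauss (hermite n) x))) = (2 * real n + 1) *\<^sub>R pgauss_L2 (hermite n)"
        by (simp add: oscillator_hermite L2_of_pgauss_L2 pgauss_L2_smult)
      moreover have "((\<lambda>t. cinner (u t) (L2_of (\<lambda>x. complex_of_real (pgauss (hermite n) x)))) has_vector_derivative
           \<i> * cinner (u t) (L2_of (harmonic_oscillator (\<lambda>x. complex_of_real (pgauss (hermite n) x))))) (at t)"
        using assms schwartz_pgauss unfolding oscillator_solution_def by blast
      ultimately show ?thesis
        by (simp add: c_def[abs_def] L2_of_pgauss_L2 cinner.scaleR_right scaleR_conv_of_real mult.assoc)
    qed
    have "((\<lambda>t. ?E t * c t) has_vector_derivative 0) (at t within UNIV)" for t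
    proof -
      have "((\<lambda>t. ?E t) has_vector_derivative
          - (\<i> * of_real (2 * real n + 1)) * ?E t) (at t)"
        by (rule has_vector_derivative_real_field) (auto intro!: derivative_eq_intros)
      from has_vector_derivative_mult[OF this c'] show ?thesis
        by (simp add: algebra_simps)
    qed
    then obtain k where k: "\<And>t. ?E t * c t = k"
      using has_vector_derivative_zero_constant[of UNIV "\<lambda>t. ?E t * c t"]
      by auto
    have "k = c 0"
      using k[of 0] by simp
    have "c t = exp (\<i> * of_real (2 * real n + 1) * of_real t) * (?E t * c t)"
      unfolding mult.assoc[symmetric] mult_exp_exp by simp
    also have "\<dots> = phase t n * c 0"
      unfolding k \<open>k = c 0\<close> by (simp add: phase_def cis_conv_exp mult_ac)
    finally have "herm.coeff (u t) n = phase t n * herm.coeff f n"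
      using assms by (simp add: coeff_herm c_def oscillator_solution_def)
    then show "herm.coeff (u t) n = herm.coeff (flow t f) n"
      by (simp add: coeff_flow)
  qed
qed

lemma propagator_eq_flow: "propagator t f = flow t f"
proof -
  have "(THE u. oscillator_solution f u) = (\<lambda>t. flow t f)"
    by (rule the_equality) (auto intro: flow_solution oscillator_solution_unique)
  then show ?thesis
    by (simp add: propagator_def)
qed

section \<open>Mehler's formula\<close>

lemma normal_density_mult_poly_le:
  assumes "\<sigma> > 0"
  shows "\<exists>C. \<forall>y. \<bar>normal_density \<mu> \<sigma> y * poly q y\<bar> \<le> C * exp (- (1 / (8 * \<sigma>\<^sup>2)) * y\<^sup>2)"
proof -
  \<comment> \<open>The density has exponent \<open>4 * c\<close> around its mean. Passing from the
    mean to the origin costs half of it, the polynomial costs another \<open>c\<close>, and one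
    \<open>c\<close> is left for decay.\<close>
  define c where "c = 1 / (8 * \<sigma>\<^sup>2)"
  have "c > 0"
    using assms by (simp add: c_def)
  then obtain C where C: "C \<ge> 0" "\<And>y. \<bar>poly q y\<bar> \<le> C * exp (c * y\<^sup>2)"
    using poly_le_exp_square[of c q] by auto
  have "\<bar>normal_density \<mu> \<sigma> y * poly q y\<bar>
      \<le> (1 / sqrt (2 * pi * \<sigma>\<^sup>2) * exp (4 * c * \<mu>\<^sup>2) * C) * exp (- c * y\<^sup>2)" for y
  proof -
    have "0 \<le> (y - 2 * \<mu>)\<^sup>2"
      by simp
    then have "y\<^sup>2 / 2 - \<mu>\<^sup>2 \<le> (y - \<mu>)\<^sup>2"
      by (simp add: power2_eq_square algebra_simps)
    then have "4 * c * (y\<^sup>2 / 2 - \<mu>\<^sup>2) \<le> 4 * c * (y - \<mu>)\<^sup>2"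
      using \<open>c > 0\<close> by (intro mult_left_mono) auto
    then have le: "- (4 * c * (y - \<mu>)\<^sup>2) + c * y\<^sup>2 \<le> 4 * c * \<mu>\<^sup>2 - c * y\<^sup>2"
      by (simp add: right_diff_distrib)
    have eq: "normal_density \<mu> \<sigma> y = 1 / sqrt (2 * pi * \<sigma>\<^sup>2) * exp (- (4 * c * (y - \<mu>)\<^sup>2))"
      using assms by (simp add: normal_density_def c_def)
    have "\<bar>normal_density \<mu> \<sigma> y * poly q y\<bar>
        \<le> (1 / sqrt (2 * pi * \<sigma>\<^sup>2) * exp (- (4 * c * (y - \<mu>)\<^sup>2))) * (C * exp (c * y\<^sup>2))"
      unfolding abs_mult eq by (intro mult_mono C) auto
    also have "\<dots> = (1 / sqrt (2 * pi * \<sigma>\<^sup>2) * C) * exp (- (4 * c * (y - \<mu>)\<^sup>2) + c * y\<^sup>2)"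
      unfolding exp_add by (simp only: mult_ac)
    also have "\<dots> \<le> (1 / sqrt (2 * pi * \<sigma>\<^sup>2) * C) * exp (4 * c * \<mu>\<^sup>2 - c * y\<^sup>2)"
      using le C(1) by (intro mult_left_mono) auto
    also have "\<dots> = (1 / sqrt (2 * pi * \<sigma>\<^sup>2) * exp (4 * c * \<mu>\<^sup>2) * C) * exp (- c * y\<^sup>2)"
      by (simp add: exp_diff exp_minus field_simps)
    finally show ?thesis .
  qed
  then show ?thesis
    unfolding c_def by blast
qed

lemma integrable_normal_density_poly:
  assumes "\<sigma> > 0"
  shows "integrable lborel (\<lambda>y. normal_density \<mu> \<sigma> y * poly q y)"
proof -
  obtain C where C: "\<And>y. \<bar>normal_density \<mu> \<sigma> y * poly q y\<bar> \<le> C * exp (- (1 / (8 * \<sigma>\<^sup>2)) * y\<^sup>2)"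
    using normal_density_mult_poly_le[OF assms] by blast
  show ?thesis
  proof (rule Bochner_Integration.integrable_bound)
    show "integrable lborel (\<lambda>y::real. C * exp (- (1 / (8 * \<sigma>\<^sup>2)) * y\<^sup>2))"
      using assms by (intro integrable_mult_right integrable_gaussian) auto
    have "(\<lambda>y. poly q y) \<in> borel_measurable borel"
      by (intro borel_measurable_continuous_onI continuous_intros)
    then show "(\<lambda>y. normal_density \<mu> \<sigma> y * poly q y) \<in> borel_measurable lborel"
      by measurable
    show "AE y in lborel. norm (normal_density \<mu> \<sigma> y * poly q y) \<le> norm (C * exp (- (1 / (8 * \<sigma>\<^sup>2)) * y\<^sup>2))"
      using C by (intro AE_I2) (metis abs_ge_self order_trans real_norm_def)
  qed
qed

section \<open>Gaussian means of Hermite polynomials\<close>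

definition gauss_mean :: "real \<Rightarrow> real \<Rightarrow> real poly \<Rightarrow> real" where
  "gauss_mean \<mu> \<sigma> q = (LINT y|lborel. normal_density \<mu> \<sigma> y * poly q y)"

lemma gauss_mean_add:
  "\<sigma> > 0 \<Longrightarrow> gauss_mean \<mu> \<sigma> (p + q) = gauss_mean \<mu> \<sigma> p + gauss_mean \<mu> \<sigma> q"
  by (simp add: gauss_mean_def distrib_left integrable_normal_density_poly)

lemma gauss_mean_smult: "gauss_mean \<mu> \<sigma> (smult a q) = a * gauss_mean \<mu> \<sigma> q"
  by (simp add: gauss_mean_def mult.left_commute)

lemma gauss_mean_diff:
  "\<sigma> > 0 \<Longrightarrow> gauss_mean \<mu> \<sigma> (p - q) = gauss_mean \<mu> \<sigma> p - gauss_mean \<mu> \<sigma> q"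
  by (simp add: gauss_mean_def right_diff_distrib integrable_normal_density_poly)

text \<open>Stein's identity: the derivative of the density times \<open>q\<close> integrates to
  zero, and the density has logarithmic derivative
  \<open>- (y - \<mu>) / \<sigma>^2\<close>.\<close>

lemma gauss_mean_stein:
  assumes "\<sigma> > 0"
  shows "gauss_mean \<mu> \<sigma> ([:-\<mu>, 1:] * q) = \<sigma>\<^sup>2 * gauss_mean \<mu> \<sigma> (pderiv q)"
proof -
  let ?q = "pderiv q - smult (1 / \<sigma>\<^sup>2) ([:-\<mu>, 1:] * q)"
  obtain C where C: "\<And>y. \<bar>normal_density \<mu> \<sigma> y * poly q y\<bar> \<le> C * exp (- (1 / (8 * \<sigma>\<^sup>2)) * y\<^sup>2)"
    using normal_density_mult_poly_le[OF assms] by blast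
  have "(LINT y|lborel. normal_density \<mu> \<sigma> y * poly ?q y) = 0"
  proof (rule integral_derivative_eq_zero)
    fix y
    define K where "K = 1 / sqrt (2 * pi * \<sigma>\<^sup>2)"
    have nd: "normal_density \<mu> \<sigma> = (\<lambda>y. K * exp (- (y - \<mu>)\<^sup>2 / (2 * \<sigma>\<^sup>2)))"
      by (simp add: normal_density_def fun_eq_iff K_def)
    have "(normal_density \<mu> \<sigma> has_real_derivative - ((y - \<mu>) / \<sigma>\<^sup>2) * normal_density \<mu> \<sigma> y) (at y)"
      unfolding nd using assms
      by (auto intro!: derivative_eq_intros simp: field_simps)
    from DERIV_mult[OF this poly_DERIV]
    have "((\<lambda>y. normal_density \<mu> \<sigma> y * poly q y) has_real_derivative normal_density \<mu> \<sigma> y * poly ?q y) (at y)"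
      by (rule DERIV_cong) (use assms in \<open>simp add: field_simps\<close>)
    then show "((\<lambda>y. normal_density \<mu> \<sigma> y * poly q y) has_vector_derivative normal_density \<mu> \<sigma> y * poly ?q y) (at y)"
      by (simp only: has_real_derivative_iff_has_vector_derivative)
  next
    show "continuous_on UNIV (\<lambda>y. normal_density \<mu> \<sigma> y * poly ?q y)"
      unfolding normal_density_def using assms by (intro continuous_intros) auto
  next
    show "integrable lborel (\<lambda>y. normal_density \<mu> \<sigma> y * poly ?q y)"
      by (rule integrable_normal_density_poly[OF assms])
  next
    have "1 / (8 * \<sigma>\<^sup>2) > 0"
      using assms by simp
    then have lim: "((\<lambda>y. C * exp (- (1 / (8 * \<sigma>\<^sup>2)) * y\<^sup>2)) \<longlongrightarrow> C * 0) at_top"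
      "((\<lambda>y. C * exp (- (1 / (8 * \<sigma>\<^sup>2)) * y\<^sup>2)) \<longlongrightarrow> C * 0) at_bot"
      by (intro tendsto_mult tendsto_const tendsto_gaussian; assumption)+
    show "((\<lambda>y. normal_density \<mu> \<sigma> y * poly q y) \<longlongrightarrow> 0) at_top" "((\<lambda>y. normal_density \<mu> \<sigma> y * poly q y) \<longlongrightarrow> 0) at_bot"
      by (rule Lim_null_comparison[OF always_eventually]; use C lim in auto)+
  qed
  then have "gauss_mean \<mu> \<sigma> ?q = 0"
    by (simp add: gauss_mean_def)
  then show ?thesis
    using assms by (simp only: gauss_mean_diff gauss_mean_smult) (simp add: field_simps)
qed

text \<open>Hermite polynomials are eigenfunctions of the Ornstein-Uhlenbeck average. The recursion
  for \<open>hermite\<close>, Stein's identity and \<open>2 * \<sigma>^2 - 1 = - r^2\<close>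
  reproduce the same recursion for the right-hand side.\<close>

lemma gauss_mean_hermite:
  assumes r: "\<sigma> > 0" "2 * \<sigma>\<^sup>2 = 1 - r\<^sup>2"
  shows "gauss_mean (r * x) \<sigma> (hermite n) = r ^ n * poly (hermite n) x"
proof (induction n rule: less_induct)
  case (less n)
  show ?case
  proof (cases n)
    case 0
    then show ?thesis
      using r(1) by (simp add: gauss_mean_def)
  next
    case (Suc m)
    \<comment> \<open>The factor \<open>2 y\<close> of the recursion is split as
      \<open>2 (y - r x) + 2 r x\<close>, so that Stein's identity applies to the centred
      part.\<close>
    have "gauss_mean (r * x) \<sigma> (hermite (Suc m))
        = gauss_mean (r * x) \<sigma> (smult 2 ([:-(r * x), 1:] * hermite m) + smult (2 * (r * x)) (hermite m) - pderiv (hermite m))"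
      unfolding hermite.simps
      by (intro arg_cong[of _ _ "gauss_mean (r * x) \<sigma>"] poly_eq_poly_eq_iff[THEN iffD1])
         (simp add: fun_eq_iff algebra_simps)
    also have "\<dots> = 2 * r * x * gauss_mean (r * x) \<sigma> (hermite m) + (2 * \<sigma>\<^sup>2 - 1) * gauss_mean (r * x) \<sigma> (pderiv (hermite m))"
      using r(1) by (simp only: gauss_mean_diff gauss_mean_add gauss_mean_smult gauss_mean_stein)
        (simp add: algebra_simps)
    also have "(2 * \<sigma>\<^sup>2 - 1) * gauss_mean (r * x) \<sigma> (pderiv (hermite m)) = - (r ^ Suc m * poly (pderiv (hermite m)) x)"
    proof (cases m)
      case 0
      then show ?thesis
        by (simp add: gauss_mean_def)
    next
      case (Suc k)
      have "gauss_mean (r * x) \<sigma> (hermite k) = r ^ k * poly (hermite k) x"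
        using \<open>n = Suc m\<close> Suc by (intro less) auto
      then show ?thesis
        unfolding Suc pderiv_hermite_Suc gauss_mean_smult r(2) by (simp add: power2_eq_square)
    qed
    also have "gauss_mean (r * x) \<sigma> (hermite m) = r ^ m * poly (hermite m) x"
      using Suc by (intro less) auto
    finally show ?thesis
      unfolding Suc by (simp add: algebra_simps)
  qed
qed

section \<open>The Mehler kernel for real parameters\<close>

definition mehler :: "real \<Rightarrow> real \<Rightarrow> real \<Rightarrow> real" where
  "mehler r x y = exp (- ((1 + r\<^sup>2) * (x\<^sup>2 + y\<^sup>2) - 4 * r * x * y) / (2 * (1 - r\<^sup>2))) / sqrt (pi * (1 - r\<^sup>2))"

text \<open>Completing the square in \<open>y\<close> exhibits the kernel against the Gaussian as a
  normal density, which is how the Gaussian means enter.\<close>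

lemma mehler_mult_gauss:
  assumes "0 < r" "r < 1"
  shows "mehler r x y * exp (- y\<^sup>2 / 2) = exp (- x\<^sup>2 / 2) * normal_density (r * x) (sqrt ((1 - r\<^sup>2) / 2)) y"
proof -
  let ?E = "- ((1 + r\<^sup>2) * (x\<^sup>2 + y\<^sup>2) - 4 * r * x * y) / (2 * (1 - r\<^sup>2))"
  let ?s = "sqrt ((1 - r\<^sup>2) / 2)"
  have r: "1 - r\<^sup>2 > 0"
    using assms by (simp add: power_less_one_iff)
  have "?E + (- y\<^sup>2 / 2)
      = - x\<^sup>2 / 2 + (- (y - r * x)\<^sup>2 / (1 - r\<^sup>2))"
    using r by (simp add: divide_simps) (simp add: algebra_simps power2_eq_square)
  then have "exp (?E) * exp (- y\<^sup>2 / 2)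
      = exp (- x\<^sup>2 / 2) * exp (- (y - r * x)\<^sup>2 / (1 - r\<^sup>2))"
    by (simp only: mult_exp_exp)
  moreover have "2 * (?s)\<^sup>2 = 1 - r\<^sup>2" "2 * pi * (?s)\<^sup>2 = pi * (1 - r\<^sup>2)"
    using r by simp_all
  ultimately show ?thesis
    unfolding mehler_def normal_density_def by simp
qed

text \<open>The quadratic form equals \<open>(1 - r)^2 (x^2 + y^2) + 2 r (x - y)^2\<close>; keeping
  only the part in \<open>y^2\<close> gives Gaussian decay uniform in \<open>x\<close>.\<close>

lemma mehler_le:
  assumes "0 < r" "r < 1"
  shows "mehler r x y \<le> 1 / sqrt (pi * (1 - r\<^sup>2)) * exp (- ((1 - r)\<^sup>2 / (2 * (1 - r\<^sup>2))) * y\<^sup>2)"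
proof -
  let ?E = "- ((1 + r\<^sup>2) * (x\<^sup>2 + y\<^sup>2) - 4 * r * x * y) / (2 * (1 - r\<^sup>2))"
  let ?B = "- ((1 - r)\<^sup>2 / (2 * (1 - r\<^sup>2))) * y\<^sup>2"
  let ?s = "sqrt (pi * (1 - r\<^sup>2))"
  have r: "1 - r\<^sup>2 > 0"
    using assms by (simp add: power_less_one_iff)
  have "(1 - r)\<^sup>2 * y\<^sup>2 + ((1 - r)\<^sup>2 * x\<^sup>2 + 2 * r * (x - y)\<^sup>2) = (1 + r\<^sup>2) * (x\<^sup>2 + y\<^sup>2) - 4 * r * x * y"
    by (simp add: power2_eq_square algebra_simps)
  moreover have "0 \<le> (1 - r)\<^sup>2 * x\<^sup>2 + 2 * r * (x - y)\<^sup>2"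
    using assms by simp
  ultimately have "(1 - r)\<^sup>2 * y\<^sup>2 \<le> (1 + r\<^sup>2) * (x\<^sup>2 + y\<^sup>2) - 4 * r * x * y"
    by linarith
  then have "(1 - r)\<^sup>2 * y\<^sup>2 / (2 * (1 - r\<^sup>2)) \<le> ((1 + r\<^sup>2) * (x\<^sup>2 + y\<^sup>2) - 4 * r * x * y) / (2 * (1 - r\<^sup>2))"
    using r by (intro divide_right_mono) auto
  then have "?E \<le> ?B"
    by (simp only: minus_divide_left[symmetric] mult_minus_left times_divide_eq_left neg_le_iff_le)
  then have "exp (?E) / ?s
      \<le> exp (?B) / ?s"
    using r by (intro divide_right_mono) (simp_all only: exp_le_cancel_iff, simp)
  then show ?thesis
    by (simp only: mehler_def times_divide_eq_left mult_1)
qed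

lemma mehler_commute: "mehler r x y = mehler r y x"
  by (simp add: mehler_def add.commute mult.commute mult.left_commute)

lemma mehler_nonneg: "r\<^sup>2 < 1 \<Longrightarrow> mehler r x y \<ge> 0"
  by (simp add: mehler_def)

lemma mehler_le_const:
  assumes "0 < r" "r < 1"
  shows "mehler r x y \<le> 1 / sqrt (pi * (1 - r\<^sup>2))"
proof -
  have "1 - r\<^sup>2 > 0"
    using assms by (simp add: power_less_one_iff)
  then have "1 / sqrt (pi * (1 - r\<^sup>2)) * exp (- ((1 - r)\<^sup>2 / (2 * (1 - r\<^sup>2))) * y\<^sup>2) \<le> 1 / sqrt (pi * (1 - r\<^sup>2))"
    by (intro mult_right_le_one_le) auto
  with mehler_le[OF assms] show ?thesis
    by (rule order_trans)
qed

lemma continuous_mehler: "continuous_on A (mehler r x)"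
  unfolding mehler_def by (cases "r\<^sup>2 = 1") (auto intro!: continuous_intros)

lemma measurable_mehler [measurable]: "mehler r x \<in> borel_measurable borel"
  by (intro borel_measurable_continuous_onI continuous_mehler)

lemma square_integrable_mehler:
  assumes "0 < r" "r < 1"
  shows "square_integrable (\<lambda>y. complex_of_real (mehler r x y))"
proof (rule square_integrable_bounded_mult_gauss)
  have r: "1 - r\<^sup>2 > 0"
    using assms by (simp add: power_less_one_iff)
  then show "(1 - r)\<^sup>2 / (2 * (1 - r\<^sup>2)) > 0"
    using assms by simp
  show "cmod (complex_of_real (mehler r x y)) \<le> 1 / sqrt (pi * (1 - r\<^sup>2)) * exp (- ((1 - r)\<^sup>2 / (2 * (1 - r\<^sup>2))) * y\<^sup>2)" for y
    using mehler_le[OF assms, of x y] mehler_nonneg[of r x y] r by simp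
qed measurable

text \<open>A substitute for the Dirac mass at \<open>x\<close>, which lies outside
  \<open>L2\<close>.\<close>

definition mehler_L2 :: "real \<Rightarrow> real \<Rightarrow> L2" where
  "mehler_L2 r x = abs_L2 (\<lambda>y. complex_of_real (mehler r x y))"

text \<open>The continuous representative of \<open>herm n\<close>.\<close>

definition hermite_fun :: "nat \<Rightarrow> real \<Rightarrow> real" where
  "hermite_fun n x = pgauss (hermite n) x / hnorm n"

lemma coeff_mehler_L2:
  assumes "0 < r" "r < 1"
  shows "herm.coeff (mehler_L2 r x) n = of_real (r ^ n * hermite_fun n x)"
proof -
  let ?\<sigma> = "sqrt ((1 - r\<^sup>2) / 2)"
  have r: "1 - r\<^sup>2 > 0"
    using assms by (simp add: power_less_one_iff)
  have "cinner (mehler_L2 r x) (pgauss_L2 (hermite n)) = (LINT y|lborel. complex_of_real (mehler r x y * pgauss (hermite n) y))"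
    using cinner_abs_L2[OF square_integrable_mehler[OF assms] square_integrable_pgauss]
    by (simp add: mehler_L2_def pgauss_L2_def)
  also have "\<dots> = of_real (LINT y|lborel. exp (- x\<^sup>2 / 2) * (normal_density (r * x) (?\<sigma>) y * poly (hermite n) y))"
  proof -
    have "mehler r x y * pgauss (hermite n) y
        = exp (- x\<^sup>2 / 2) * (normal_density (r * x) (?\<sigma>) y * poly (hermite n) y)" for y
      using mehler_mult_gauss[OF assms, of x y] by (simp add: pgauss_def mult_ac)
    then show ?thesis
      by (simp only: integral_complex_of_real)
  qed
  also have "\<dots> = of_real (exp (- x\<^sup>2 / 2) * gauss_mean (r * x) (?\<sigma>) (hermite n))"
    by (simp add: gauss_mean_def)
  also have "\<dots> = of_real (r ^ n * pgauss (hermite n) x)"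
  proof -
    have "gauss_mean (r * x) (?\<sigma>) (hermite n) = r ^ n * poly (hermite n) x"
      by (rule gauss_mean_hermite) (use r in auto)
    then show ?thesis
      by (simp add: pgauss_def)
  qed
  finally show ?thesis
    by (simp add: coeff_herm hermite_fun_def)
qed

text \<open>Completing the square in \<open>z\<close> leaves a normal density in \<open>z\<close>;
  integrating it out gives the semigroup law, in which parameters multiply.\<close>

lemma mehler_mult_mehler:
  assumes "0 < r" "r < 1"
  shows "mehler r x z * mehler r y z
    = mehler (r\<^sup>2) x y * normal_density (r * (x + y) / (1 + r\<^sup>2)) (sqrt ((1 - r\<^sup>2) / (2 * (1 + r\<^sup>2)))) z"
proof -
  have "r\<^sup>2 < 1"
    using assms by (simp add: power_less_one_iff)
  then obtain a b where ab: "a = 1 - r\<^sup>2" "b = 1 + r\<^sup>2" "a > 0" "b > 0"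
    using assms by (metis add_pos_nonneg diff_gt_0_iff_gt zero_le_power2 zero_less_one)
  have r4: "1 - (r\<^sup>2)\<^sup>2 = a * b"
    unfolding ab by (simp add: algebra_simps power2_eq_square)
  let ?E1 = "- (b * (x\<^sup>2 + z\<^sup>2) - 4 * r * x * z) / (2 * a)"
  let ?E2 = "- (b * (y\<^sup>2 + z\<^sup>2) - 4 * r * y * z) / (2 * a)"
  let ?E3 = "- ((1 + (r\<^sup>2)\<^sup>2) * (x\<^sup>2 + y\<^sup>2) - 4 * r\<^sup>2 * x * y) / (2 * (a * b))"
  let ?E4 = "- (z - r * (x + y) / b)\<^sup>2 / (a / b)"
  have "?E1 + ?E2
      = ?E3 + ?E4"
  proof -
    have "(z - r * (x + y) / b)\<^sup>2 / (a / b) = (z * b - r * (x + y))\<^sup>2 / (a * b)"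
      using ab(3,4) by (simp add: field_simps power2_eq_square)
    moreover have "?E1 + ?E2
        = - (b * (b * (x\<^sup>2 + y\<^sup>2 + 2 * z\<^sup>2) - 4 * r * z * (x + y))) / (2 * (a * b))"
      using ab(3,4) by (simp add: field_simps)
    moreover have "b * (b * (x\<^sup>2 + y\<^sup>2 + 2 * z\<^sup>2) - 4 * r * z * (x + y))
        = ((1 + (r\<^sup>2)\<^sup>2) * (x\<^sup>2 + y\<^sup>2) - 4 * r\<^sup>2 * x * y) + 2 * (z * b - r * (x + y))\<^sup>2"
      unfolding ab by (simp add: algebra_simps power2_eq_square)
    ultimately show ?thesis
      by (simp add: add_divide_distrib diff_divide_distrib)
  qed
  then have e: "exp (?E1) * exp (?E2)
      = exp (?E3) * exp (?E4)"
    by (simp only: mult_exp_exp)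
  have "(pi * (a * b)) * (pi * (a / b)) = (pi * a)\<^sup>2"
    using ab(4) by (simp add: power2_eq_square)
  then have "sqrt (pi * a) * sqrt (pi * a) = sqrt ((pi * (a * b)) * (pi * (a / b)))"
    using ab(3) by (simp only: real_sqrt_abs) simp
  then have s: "sqrt (pi * a) * sqrt (pi * a) = sqrt (pi * (a * b)) * sqrt (pi * (a / b))"
    by (simp only: real_sqrt_mult)
  have "mehler r x z * mehler r y z
      = (exp (?E1) * exp (?E2))
        / (sqrt (pi * a) * sqrt (pi * a))"
    by (simp add: mehler_def ab(1,2))
  also have "\<dots> = mehler (r\<^sup>2) x y * (exp (?E4) / sqrt (pi * (a / b)))"
    unfolding e s mehler_def r4 by simp
  also have "exp (?E4) / sqrt (pi * (a / b))
      = normal_density (r * (x + y) / b) (sqrt (a / (2 * b))) z"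
    using ab(3,4) by (simp add: normal_density_def)
  finally show ?thesis
    by (simp only: ab(1,2))
qed

lemma cinner_mehler_L2:
  assumes "0 < r" "r < 1"
  shows "cinner (mehler_L2 r x) (mehler_L2 r y) = of_real (mehler (r\<^sup>2) x y)"
proof -
  have r: "1 - r\<^sup>2 > 0"
    using assms by (simp add: power_less_one_iff)
  have "cinner (mehler_L2 r x) (mehler_L2 r y) = (LINT z|lborel. complex_of_real (mehler r x z * mehler r y z))"
    using cinner_abs_L2[OF square_integrable_mehler[OF assms] square_integrable_mehler[OF assms]]
    by (simp add: mehler_L2_def)
  also have "\<dots> = of_real (mehler (r\<^sup>2) x y)"
    unfolding mehler_mult_mehler[OF assms] integral_complex_of_real
    using r by (simp add: add_pos_nonneg)
  finally show ?thesis .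
qed

text \<open>Parseval for two smoothed Dirac masses with parameter \<open>sqrt \<rho>\<close>: each
  contributes half of the power, and their inner product is the kernel with parameter
  \<open>\<rho>\<close>.\<close>

lemma mehler_sums:
  assumes "0 < \<rho>" "\<rho> < 1"
  shows "(\<lambda>n. of_real (hermite_fun n x * hermite_fun n y) * complex_of_real \<rho> ^ n) sums of_real (mehler \<rho> x y)"
proof -
  define r where "r = sqrt \<rho>"
  have r: "0 < r" "r < 1" "r\<^sup>2 = \<rho>"
    using assms by (simp_all add: r_def)
  have "(of_real (r ^ n * hermite_fun n x)) * cnj (of_real (r ^ n * hermite_fun n y)) = of_real (hermite_fun n x * hermite_fun n y) * complex_of_real \<rho> ^ n" for n
    unfolding r(3)[symmetric] by (simp add: power_even_eq power2_eq_square power_mult_distrib)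
  then show ?thesis
    using herm.parseval[of "mehler_L2 r x" "mehler_L2 r y"] by (simp only: coeff_mehler_L2[OF r(1,2)] cinner_mehler_L2[OF r(1,2)] r(3))
qed

section \<open>Continuation of Mehler's formula to the unit disc\<close>

definition cmehler :: "real \<Rightarrow> real \<Rightarrow> complex \<Rightarrow> complex" where
  "cmehler x y w = exp (- ((1 + w\<^sup>2) * of_real (x\<^sup>2 + y\<^sup>2) - 4 * w * of_real (x * y)) / (2 * (1 - w\<^sup>2)))
     / (of_real (sqrt pi) * csqrt (1 - w\<^sup>2))"

text \<open>This keeps \<open>1 - w^2\<close> off the branch cut, so the principal square root in
  \<open>cmehler\<close> is holomorphic on the disc.\<close>

lemma Re_one_minus_square: "cmod w < 1 \<Longrightarrow> Re (1 - w\<^sup>2) > 0"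
  using complex_Re_le_cmod[of "w\<^sup>2"] power_less_one_iff[of "cmod w" 2] by (simp add: norm_power)

lemma cmehler_holomorphic: "cmehler x y holomorphic_on ball 0 1"
proof -
  have "1 - w\<^sup>2 \<notin> \<real>\<^sub>\<le>\<^sub>0" "1 - w\<^sup>2 \<noteq> 0" if "w \<in> ball 0 1" for w :: complex
    using Re_one_minus_square[of w] that by (auto simp: complex_nonpos_Reals_iff)
  then show ?thesis
    unfolding cmehler_def by (intro holomorphic_intros) auto
qed

lemma cmehler_of_real:
  assumes "0 < \<rho>" "\<rho> < 1"
  shows "cmehler x y (of_real \<rho>) = of_real (mehler \<rho> x y)"
proof -
  have r: "1 - \<rho>\<^sup>2 > 0"
    using assms by (simp add: power_less_one_iff)
  have e1: "csqrt (1 - (of_real \<rho>)\<^sup>2) = of_real (sqrt (1 - \<rho>\<^sup>2))"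
    using r csqrt_of_real_nonneg[of "of_real (1 - \<rho>\<^sup>2)"] by simp
  have e2: "- ((1 + (of_real \<rho>)\<^sup>2) * of_real (x\<^sup>2 + y\<^sup>2) - 4 * of_real \<rho> * of_real (x * y)) / (2 * (1 - (of_real \<rho>)\<^sup>2))
      = (of_real (- ((1 + \<rho>\<^sup>2) * (x\<^sup>2 + y\<^sup>2) - 4 * \<rho> * x * y) / (2 * (1 - \<rho>\<^sup>2))) :: complex)"
    by simp
  show ?thesis
    unfolding cmehler_def mehler_def e1 e2 exp_of_real by (simp add: real_sqrt_mult)
qed

text \<open>Power series and closed form are holomorphic on the disc and agree on the real points
  between 0 and 1, which accumulate at 1/2; convergence of the series is inherited from the real
  case.\<close>

lemma cmehler_sums:
  assumes "cmod w < 1"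
  shows "(\<lambda>n. of_real (hermite_fun n x * hermite_fun n y) * w ^ n) sums cmehler x y w"
proof -
  define a where "a n = complex_of_real (hermite_fun n x * hermite_fun n y)" for n
  have summable: "summable (\<lambda>n. a n * z ^ n)" if z: "cmod z < 1" for z
  proof -
    obtain \<rho> where \<rho>: "cmod z < \<rho>" "\<rho> < 1"
      using dense[OF z] by auto
    then have "\<rho> > 0"
      using norm_ge_zero[of z] by linarith
    show ?thesis
      by (rule powser_inside[of _ "of_real \<rho>"])
         (use mehler_sums[OF \<open>\<rho> > 0\<close> \<rho>(2), of x y] \<rho> in \<open>auto simp: a_def sums_iff\<close>)
  qed
  define f where "f z = (\<Sum>n. a n * z ^ n)" for z
  have sums: "(\<lambda>n. a n * (z - 0) ^ n) sums f z" if "z \<in> ball 0 1" for z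
    using summable_sums[OF summable[of z]] that by (simp add: f_def)
  have "f holomorphic_on ball 0 1"
    by (rule power_series_holomorphic[OF sums])
  then have hol: "(\<lambda>z. f z - cmehler x y z) holomorphic_on ball 0 1"
    by (intro holomorphic_on_diff cmehler_holomorphic)
  have "f w - cmehler x y w = 0"
  proof (rule analytic_continuation[OF hol])
    show "complex_of_real ` {0<..<1} \<subseteq> ball 0 1"
      by auto
    show "(1/2 :: complex) islimpt complex_of_real ` {0<..<1}"
      unfolding islimpt_sequential
    \<comment> \<open>The shift by 3 keeps every point of the sequence strictly between 1/2 and
      1.\<close>
    proof (intro exI[of _ "\<lambda>n. complex_of_real (1/2 + 1 / real (n + 3))"] conjI allI)
      have "(\<lambda>n. 1/2 + 1 / real (n + 3)) \<longlonglongrightarrow> 1/2 + 0"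
        by (intro tendsto_add tendsto_const LIMSEQ_ignore_initial_segment lim_1_over_n)
      from tendsto_of_real[OF this, where 'a = complex]
      show "(\<lambda>n. complex_of_real (1/2 + 1 / real (n + 3))) \<longlonglongrightarrow> 1/2"
        by simp
      fix n
      have "1 / real (n + 3) \<in> {0<..1/3}"
        by (simp add: field_simps)
      moreover have "complex_of_real (1/2 + 1 / real (n + 3)) \<noteq> of_real (1/2)"
        unfolding of_real_eq_iff by simp
      moreover have "1/2 + 1 / real (n + 3) \<in> {0<..<1}"
        by (simp add: field_simps)
      ultimately show "complex_of_real (1/2 + 1 / real (n + 3)) \<in> complex_of_real ` {0<..<1} - {1/2}"
        by (intro DiffI imageI) simp_all
    qed
    fix z
    assume "z \<in> complex_of_real ` {0<..<1}"
    then obtain \<rho> where \<rho>: "0 < \<rho>" "\<rho> < 1" "z = of_real \<rho>"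
      by auto
    then show "f z - cmehler x y z = 0"
      using sums[of z] mehler_sums[OF \<rho>(1,2), of x y] cmehler_of_real[OF \<rho>(1,2), of x y]
      by (simp add: a_def sums_unique2)
  qed (use assms in auto)
  then show ?thesis
    using sums[of w] assms by (simp add: a_def)
qed

text \<open>Rewritten in \<open>x + y\<close> and \<open>x - y\<close>, the exponent has, up to
  sign, the coefficients \<open>(1 - w) / (1 + w)\<close> and its inverse, which have nonnegative
  real part on the disc. The exponential is therefore at most 1 in modulus and only the prefactor
  remains.\<close>

lemma norm_cmehler_le:
  assumes "cmod w < 1"
  shows "cmod (cmehler x y w) \<le> 1 / sqrt (pi * cmod (1 - w\<^sup>2))"
proof -
  let ?E = "- ((1 + w\<^sup>2) * of_real (x\<^sup>2 + y\<^sup>2) - 4 * w * of_real (x * y)) / (2 * (1 - w\<^sup>2))"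
  have nz: "1 - w \<noteq> 0" "1 + w \<noteq> 0"
    using assms by (auto simp: add_eq_0_iff)
  have Re: "Re ((1 - w) / (1 + w)) \<ge> 0" "Re ((1 + w) / (1 - w)) \<ge> 0"
  proof -
    have "(Re w)\<^sup>2 + (Im w)\<^sup>2 < 1"
      using assms by (simp add: cmod_def real_sqrt_lt_1_iff)
    moreover have "Re ((1 - w) / (1 + w)) = (1 - ((Re w)\<^sup>2 + (Im w)\<^sup>2)) / ((1 + Re w)\<^sup>2 + (Im w)\<^sup>2)"
      "Re ((1 + w) / (1 - w)) = (1 - ((Re w)\<^sup>2 + (Im w)\<^sup>2)) / ((1 - Re w)\<^sup>2 + (Im w)\<^sup>2)"
      by (simp_all add: Re_divide power2_eq_square algebra_simps)
    ultimately show "Re ((1 - w) / (1 + w)) \<ge> 0" "Re ((1 + w) / (1 - w)) \<ge> 0"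
      by simp_all
  qed
  have "?E
      = - (((1 - w) / (1 + w)) * of_real ((x + y)\<^sup>2 / 4) + ((1 + w) / (1 - w)) * of_real ((x - y)\<^sup>2 / 4))"
  proof -
    have "1 - w\<^sup>2 = (1 - w) * (1 + w)"
      by (simp add: power2_eq_square algebra_simps)
    moreover have "(a / b) * p + (b / a) * q = (a\<^sup>2 * p + b\<^sup>2 * q) / (a * b)" if "a \<noteq> 0" "b \<noteq> 0" for a b p q :: complex
      using that by (simp add: field_simps power2_eq_square)
    note this[OF nz]
    moreover have "(1 - w)\<^sup>2 * of_real ((x + y)\<^sup>2 / 4) + (1 + w)\<^sup>2 * of_real ((x - y)\<^sup>2 / 4)
        = ((1 + w\<^sup>2) * of_real (x\<^sup>2 + y\<^sup>2) - 4 * w * of_real (x * y)) / 2"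
      by (simp add: power2_eq_square field_simps)
    ultimately show ?thesis
      by (simp only: divide_divide_eq_left minus_divide_left[symmetric])
  qed
  also have "Re \<dots> = - (Re ((1 - w) / (1 + w)) * ((x + y)\<^sup>2 / 4) + Re ((1 + w) / (1 - w)) * ((x - y)\<^sup>2 / 4))"
    by (simp only: uminus_complex.sel plus_complex.sel times_complex.sel Re_complex_of_real Im_complex_of_real mult_zero_right diff_zero)
  also have "\<dots> \<le> 0"
    unfolding neg_le_0_iff_le by (intro add_nonneg_nonneg mult_nonneg_nonneg Re) auto
  finally have "cmod (exp (?E)) \<le> 1"
    by (simp only: norm_exp_eq_Re exp_le_one_iff)
  then have "cmod (cmehler x y w) \<le> 1 / (sqrt pi * cmod (csqrt (1 - w\<^sup>2)))"
    unfolding cmehler_def norm_divide norm_mult norm_of_real by (simp add: divide_right_mono)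
  also have "sqrt pi * cmod (csqrt (1 - w\<^sup>2)) = sqrt (pi * cmod (1 - w\<^sup>2))"
    by (simp add: real_sqrt_mult)
  finally show ?thesis .
qed

lemma norm_mehler_L2_le:
  assumes "0 < r" "r < 1"
  shows "norm (mehler_L2 r x) \<le> sqrt (1 / sqrt (pi * (1 - r ^ 4)))"
proof -
  have "0 < r\<^sup>2" "r\<^sup>2 < 1"
    using assms by (simp_all add: power_less_one_iff)
  have "complex_of_real ((norm (mehler_L2 r x))\<^sup>2) = of_real (mehler (r\<^sup>2) x x)"
    using cinner_mehler_L2[OF assms, of x x] by (simp only: cinner_self)
  then have "(norm (mehler_L2 r x))\<^sup>2 \<le> 1 / sqrt (pi * (1 - r ^ 4))"
    using mehler_le_const[OF \<open>0 < r\<^sup>2\<close> \<open>r\<^sup>2 < 1\<close>, of x x] by (simp only: of_real_eq_iff) simp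
  then show ?thesis
    by (rule real_le_rsqrt)
qed

text \<open>The squared distance expands into values of the kernel with parameter
  \<open>r^2\<close>, which are continuous.\<close>

lemma continuous_mehler_L2:
  assumes r: "0 < r" "r < 1"
  shows "isCont (mehler_L2 r) x"
proof -
  have "((\<lambda>y. (norm (mehler_L2 r y - mehler_L2 r x))\<^sup>2) \<longlongrightarrow> 0) (at x)"
  proof -
    have eq: "(norm (mehler_L2 r y - mehler_L2 r x))\<^sup>2 = mehler (r\<^sup>2) y y + mehler (r\<^sup>2) x x - 2 * mehler (r\<^sup>2) x y" for y
      unfolding power2_norm_eq_inner inner_diff_left inner_diff_right
      using r by (simp add: inner_L2_def cinner_mehler_L2 mehler_commute[of _ y x])
    have "isCont (\<lambda>y. mehler (r\<^sup>2) y y + mehler (r\<^sup>2) x x - 2 * mehler (r\<^sup>2) x y) x"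
    proof -
      have "(r\<^sup>2)\<^sup>2 < 1"
        using r by (simp add: power_less_one_iff)
      then show ?thesis
        unfolding mehler_def by (intro continuous_intros) auto
    qed
    then show ?thesis
      unfolding eq by (simp add: isCont_def)
  qed
  then have "((\<lambda>y. sqrt ((norm (mehler_L2 r y - mehler_L2 r x))\<^sup>2)) \<longlongrightarrow> sqrt 0) (at x)"
    by (rule tendsto_real_sqrt)
  then have "((\<lambda>y. norm (mehler_L2 r y - mehler_L2 r x)) \<longlongrightarrow> 0) (at x)"
    by simp
  then show ?thesis
    unfolding isCont_def by (simp add: LIM_zero_iff tendsto_norm_zero_iff)
qed

text \<open>The inner product is the integral kernel of \<open>e\<^sup>i\<^sup>(\<^sup>s\<^sup>-\<^sup>t\<^sup>)\<^sup>H\<close>, smoothed on both sides.\<close>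

lemma cinner_flow_mehler_L2_le:
  assumes r: "0 < r" "r < 1"
  shows "cmod (cinner (flow s (mehler_L2 r x)) (flow t (mehler_L2 r y))) \<le> 1 / sqrt (pi * cmod (1 - (of_real (r\<^sup>2) * cis (2 * (s - t)))\<^sup>2))"
proof -
  \<comment> \<open>Each of the two vectors contributes \<open>r ^ n\<close>. The phases contribute
    \<open>cis (2 * (s - t)) ^ n\<close> and, from the 1 in \<open>2 n + 1\<close>, a common factor
    of modulus one.\<close>
  define w where "w = of_real (r\<^sup>2) * cis (2 * (s - t))"
  have w: "cmod w < 1"
    using r by (simp add: w_def norm_mult norm_power power_less_one_iff)
  have "herm.coeff (flow s (mehler_L2 r x)) n * cnj (herm.coeff (flow t (mehler_L2 r y)) n)
      = cis (s - t) * (of_real (hermite_fun n x * hermite_fun n y) * w ^ n)" for n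
  proof -
    have "phase s n * cnj (phase t n) = cis (s - t) * cis (2 * (s - t)) ^ n"
      unfolding Complex.DeMoivre phase_def cis_cnj cis_mult
      by (rule arg_cong[of _ _ cis]) (simp add: algebra_simps)
    moreover have "herm.coeff (flow s (mehler_L2 r x)) n * cnj (herm.coeff (flow t (mehler_L2 r y)) n)
        = (phase s n * cnj (phase t n)) * (of_real (hermite_fun n x * hermite_fun n y) * of_real (r\<^sup>2) ^ n)"
      by (simp add: coeff_flow coeff_mehler_L2[OF r] power_even_eq power2_eq_square power_mult_distrib)
    ultimately show ?thesis
      by (simp add: w_def power_mult_distrib)
  qed
  then have "(\<lambda>n. cis (s - t) * (of_real (hermite_fun n x * hermite_fun n y) * w ^ n)) sums cinner (flow s (mehler_L2 r x)) (flow t (mehler_L2 r y))"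
    using herm.parseval[of "flow s (mehler_L2 r x)" "flow t (mehler_L2 r y)"] by simp
  moreover have "(\<lambda>n. cis (s - t) * (of_real (hermite_fun n x * hermite_fun n y) * w ^ n)) sums (cis (s - t) * cmehler x y w)"
    by (intro sums_mult cmehler_sums w)
  ultimately have "cinner (flow s (mehler_L2 r x)) (flow t (mehler_L2 r y)) = cis (s - t) * cmehler x y w"
    by (rule sums_unique2)
  then show ?thesis
    using norm_cmehler_le[OF w, of x y] by (simp add: norm_mult w_def)
qed

section \<open>The Strichartz estimate in \<open>L\<^sup>4\<^sub>t L\<^sup>\<infinity>\<^sub>x\<close>\<close>

lemma nn_integral_even:
  fixes \<phi> :: "real \<Rightarrow> real"
  assumes [measurable]: "\<phi> \<in> borel_measurable borel" and nonneg: "\<And>x. \<phi> x \<ge> 0"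
    and I: "(\<phi> has_integral I) {0..}"
  shows "(\<integral>\<^sup>+ s. ennreal (\<phi> \<bar>t - s\<bar>) \<partial>lborel) \<le> ennreal (2 * I)"
proof -
  have "I \<ge> 0"
    using I nonneg by (rule has_integral_nonneg)
  have half: "(\<integral>\<^sup>+ x. ennreal (indicator {0..} x * \<phi> x) \<partial>lborel) = ennreal I"
  proof (rule nn_integral_has_integral_lborel)
    have "(\<lambda>x. indicator {0..} x * \<phi> x) = (\<lambda>x. if x \<in> {0..} then \<phi> x else 0)"
      by (auto simp: fun_eq_iff)
    then show "((\<lambda>x. indicator {0..} x * \<phi> x) has_integral I) UNIV"
      using I by (simp only: has_integral_restrict_UNIV)
  qed (use nonneg in auto)
  have "(\<integral>\<^sup>+ s. ennreal (\<phi> \<bar>t - s\<bar>) \<partial>lborel) = (\<integral>\<^sup>+ x. ennreal (\<phi> \<bar>x\<bar>) \<partial>lborel)"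
    by (subst nn_integral_real_affine[of _ 1 t]) auto
  also have "\<dots> \<le> (\<integral>\<^sup>+ x. ennreal (indicator {0..} x * \<phi> x) + ennreal (indicator {0..} (- x) * \<phi> (- x)) \<partial>lborel)"
    using nonneg by (intro nn_integral_mono) (auto simp: indicator_def)
  also have "\<dots> = (\<integral>\<^sup>+ x. ennreal (indicator {0..} x * \<phi> x) \<partial>lborel)
      + (\<integral>\<^sup>+ x. ennreal (indicator {0..} (- x) * \<phi> (- x)) \<partial>lborel)"
    by (rule nn_integral_add) auto
  also have "(\<integral>\<^sup>+ x. ennreal (indicator {0..} (- x) * \<phi> (- x)) \<partial>lborel) = (\<integral>\<^sup>+ x. ennreal (indicator {0..} x * \<phi> x) \<partial>lborel)"
    by (subst (2) nn_integral_real_affine[of _ "-1" 0]) auto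
  finally show ?thesis
    unfolding half using \<open>I \<ge> 0\<close> by (simp flip: ennreal_plus)
qed

lemma nn_integral_near:
  assumes "\<delta> > 0"
  shows "(\<integral>\<^sup>+ s. ennreal (if \<bar>t - s\<bar> \<le> \<delta> then \<bar>t - s\<bar> powr (-1/2) else 0) \<partial>lborel) \<le> ennreal (4 * sqrt \<delta>)"
proof -
  have "((\<lambda>x. x powr (-1/2)) has_integral \<delta> powr (-1/2 + 1) / (-1/2 + 1)) {0..\<delta>}"
    using assms by (intro has_integral_powr_from_0) auto
  then have "((\<lambda>x. if x \<in> {0..\<delta>} then x powr (-1/2) else 0) has_integral 2 * sqrt \<delta>) {0..}"
    using assms by (subst has_integral_restrict) (auto simp: powr_half_sqrt mult.commute)
  then have "((\<lambda>x. if x \<le> \<delta> then x powr (-1/2) else 0) has_integral 2 * sqrt \<delta>) {0..}"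
    by (rule has_integral_eq[rotated]) auto
  from nn_integral_even[OF _ _ this, of t] show ?thesis
    by simp
qed

text \<open>The exponent -2 is that of the fourth power of the kernel, which arises from Young's
  inequality far from the diagonal.\<close>

lemma nn_integral_far:
  assumes "\<delta> > 0"
  shows "(\<integral>\<^sup>+ s. ennreal (if \<bar>t - s\<bar> > \<delta> then \<bar>t - s\<bar> powr (-2) else 0) \<partial>lborel) \<le> ennreal (2 / \<delta>)"
proof -
  have "((\<lambda>x. x powr (-2)) has_integral - (\<delta> powr (-2 + 1)) / (-2 + 1)) {\<delta>..}"
    using assms by (intro has_integral_powr_to_inf) auto
  then have "((\<lambda>x. x powr (-2)) has_integral 1 / \<delta>) {\<delta>..}"
    using assms by (simp add: powr_minus divide_inverse)
  then have "((\<lambda>x. if x \<in> {\<delta>..} then x powr (-2) else 0) has_integral 1 / \<delta>) {0..}"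
    using assms by (subst has_integral_restrict) auto
  moreover have "negligible {\<delta>}"
    by simp
  ultimately have "((\<lambda>x. if x > \<delta> then x powr (-2) else 0) has_integral 1 / \<delta>) {0..}"
    by (rule has_integral_spike[rotated 2]) auto
  from nn_integral_even[OF _ _ this, of t] show ?thesis
    by simp
qed

text \<open>Either \<open>b\<close> is at most \<open>l * a\<close>, and the first term dominates,
  or \<open>a\<close> is below \<open>b / l\<close>, and the second does. The weight
  \<open>l\<close> remains free for balancing.\<close>

lemma young_4_3:
  fixes a b l :: real
  assumes "a \<ge> 0" "b \<ge> 0" "l > 0"
  shows "a ^ 3 * b \<le> l * a ^ 4 + b ^ 4 / l ^ 3"
proof (cases "b \<le> l * a")
  case True
  then have "a ^ 3 * b \<le> a ^ 3 * (l * a)"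
    using assms by (intro mult_left_mono) auto
  also have "\<dots> = l * a ^ 4"
    by (simp add: eval_nat_numeral)
  finally show ?thesis
    using assms by (simp add: add_increasing2)
next
  case False
  then have "a \<le> b / l"
    using assms by (simp add: field_simps)
  then have "a ^ 3 * b \<le> (b / l) ^ 3 * b"
    using assms by (intro mult_right_mono power_mono) auto
  also have "\<dots> = b ^ 4 / l ^ 3"
    by (simp add: power_divide eval_nat_numeral)
  finally show ?thesis
    using assms by (simp add: add_increasing)
qed

text \<open>
  The case \<open>p = 4/3\<close> of the Hardy--Littlewood--Sobolev inequality, for the function \<open>F\<^sup>3\<close>. By symmetry
  one may assume \<open>F s \<le> F t\<close>; then the kernel is split at distance \<open>K / F(t)\<^sup>4\<close> from the diagonal.
\<close>

lemma hardy_littlewood_sobolev: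
  fixes F :: "real \<Rightarrow> real"
  assumes [measurable]: "F \<in> borel_measurable borel" and nonneg: "\<And>t. F t \<ge> 0"
    and int: "integrable lborel (\<lambda>t. F t ^ 4)" and K: "K = (LINT t|lborel. F t ^ 4)" "K > 0"
  shows "(\<integral>\<^sup>+ t. \<integral>\<^sup>+ s. ennreal (F t ^ 3 * F s ^ 3 * \<bar>t - s\<bar> powr (-1/2)) \<partial>lborel \<partial>lborel) \<le> ennreal (14 * (K * sqrt K))"
proof -
  define h where "h t s = F t ^ 3 * F s ^ 3 * \<bar>t - s\<bar> powr (-1/2)" for t s
  define g where "g t s = (if F s \<le> F t then h t s else 0)" for t s
  have h_nonneg: "h t s \<ge> 0" for t s
    using nonneg by (simp add: h_def)
  then have g_nonneg: "g t s \<ge> 0" for t s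
    by (simp add: g_def)
  have [measurable]: "(\<lambda>(t, s). h t s) \<in> borel_measurable (borel \<Otimes>\<^sub>M borel)"
    unfolding h_def by measurable
  have [measurable]: "(\<lambda>(t, s). g t s) \<in> borel_measurable (borel \<Otimes>\<^sub>M borel)"
    unfolding g_def by measurable
  have inner: "(\<integral>\<^sup>+ s. ennreal (g t s) \<partial>lborel) \<le> ennreal (7 * sqrt K * F t ^ 4)" for t
  proof (cases "F t = 0")
    case True
    then have "g t s = 0" for s
      by (simp add: g_def h_def)
    then show ?thesis
      by simp
  next
    case False
    define p where "p = F t"
    have "p > 0"
      using False nonneg[of t] by (simp add: p_def)
    define \<delta> where "\<delta> = K / p ^ 4"
    \<comment> \<open>With this weight and \<open>\<delta>\<close>, the near part, the term in
      \<open>F s ^ 4\<close> and the far part contribute 4, 1 and 2 times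
      \<open>sqrt K * p ^ 4\<close>. This gives the 7, which the symmetrization doubles to
      14.\<close>
    define l where "l = p / sqrt K"
    have pos: "\<delta> > 0" "l > 0"
      using \<open>p > 0\<close> K(2) by (simp_all add: \<delta>_def l_def)
    let ?near = "\<lambda>s. if \<bar>t - s\<bar> \<le> \<delta> then \<bar>t - s\<bar> powr (-1/2) else 0"
    let ?far = "\<lambda>s. if \<bar>t - s\<bar> > \<delta> then \<bar>t - s\<bar> powr (-2) else 0"
    have le: "g t s \<le> p ^ 6 * ?near s + (p ^ 3 * l * F s ^ 4 + p ^ 3 / l ^ 3 * ?far s)" for s
    proof (cases "F s \<le> p")
      case True
      show ?thesis
      proof (cases "\<bar>t - s\<bar> \<le> \<delta>")
        case near: True
        have "F s ^ 3 \<le> p ^ 3"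
          using True nonneg by (intro power_mono) auto
        then have "p ^ 3 * F s ^ 3 * \<bar>t - s\<bar> powr (-1/2) \<le> p ^ 3 * p ^ 3 * \<bar>t - s\<bar> powr (-1/2)"
          using \<open>p > 0\<close> by (intro mult_right_mono mult_left_mono) auto
        also have "\<dots> = p ^ 6 * \<bar>t - s\<bar> powr (-1/2)"
          by (simp flip: power_add)
        finally show ?thesis
          using near True \<open>p > 0\<close> pos by (simp add: g_def h_def p_def[symmetric] add_increasing2)
      next
        case far: False
        have "(\<bar>t - s\<bar> powr (-1/2)) ^ 4 = \<bar>t - s\<bar> powr (-2)"
          using powr_powr[of "\<bar>t - s\<bar>" "-1/2" 4] by (cases "t = s") (simp_all add: powr_numeral)
        then have "F s ^ 3 * \<bar>t - s\<bar> powr (-1/2) \<le> l * F s ^ 4 + \<bar>t - s\<bar> powr (-2) / l ^ 3"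
          using young_4_3[of "F s" "\<bar>t - s\<bar> powr (-1/2)" l] nonneg pos by simp
        then have "p ^ 3 * (F s ^ 3 * \<bar>t - s\<bar> powr (-1/2)) \<le> p ^ 3 * (l * F s ^ 4 + \<bar>t - s\<bar> powr (-2) / l ^ 3)"
          using \<open>p > 0\<close> by (intro mult_left_mono) auto
        then show ?thesis
          using far True by (simp add: g_def h_def p_def[symmetric] distrib_left mult_ac)
      qed
    next
      case False
      then show ?thesis
        using \<open>p > 0\<close> pos by (simp add: g_def p_def[symmetric])
    qed
    have F4: "(\<integral>\<^sup>+ s. ennreal (F s ^ 4) \<partial>lborel) = ennreal K"
      unfolding K(1) by (rule nn_integral_eq_integral[OF int]) auto
    have "(\<integral>\<^sup>+ s. ennreal (g t s) \<partial>lborel)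
        \<le> (\<integral>\<^sup>+ s. ennreal (p ^ 6) * ennreal (?near s) + (ennreal (p ^ 3 * l) * ennreal (F s ^ 4)
            + ennreal (p ^ 3 / l ^ 3) * ennreal (?far s)) \<partial>lborel)"
    proof (intro nn_integral_mono)
      fix s
      have "ennreal (g t s) \<le> ennreal (p ^ 6 * ?near s + (p ^ 3 * l * F s ^ 4 + p ^ 3 / l ^ 3 * ?far s))"
        by (rule ennreal_leI[OF le])
      also have "\<dots> = ennreal (p ^ 6) * ennreal (?near s) + (ennreal (p ^ 3 * l) * ennreal (F s ^ 4)
            + ennreal (p ^ 3 / l ^ 3) * ennreal (?far s))"
        using \<open>p > 0\<close> pos
        by (subst ennreal_plus, simp, simp, subst ennreal_plus, simp, simp, subst (1 2 3) ennreal_mult, simp_all)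
      finally show "ennreal (g t s) \<le> \<dots>" .
    qed
    also have "\<dots> = ennreal (p ^ 6) * (\<integral>\<^sup>+ s. ennreal (?near s) \<partial>lborel)
        + (ennreal (p ^ 3 * l) * (\<integral>\<^sup>+ s. ennreal (F s ^ 4) \<partial>lborel)
          + ennreal (p ^ 3 / l ^ 3) * (\<integral>\<^sup>+ s. ennreal (?far s) \<partial>lborel))"
      by (simp add: nn_integral_add nn_integral_cmult)
    also have "\<dots> \<le> ennreal (p ^ 6) * ennreal (4 * sqrt \<delta>) + (ennreal (p ^ 3 * l) * ennreal K + ennreal (p ^ 3 / l ^ 3) * ennreal (2 / \<delta>))"
      unfolding F4 by (intro add_mono mult_left_mono nn_integral_near nn_integral_far pos order_refl) auto
    also have "\<dots> = ennreal (p ^ 6 * (4 * sqrt \<delta>) + (p ^ 3 * l * K + p ^ 3 / l ^ 3 * (2 / \<delta>)))"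
    proof -
      have e: "ennreal (p ^ 6) * ennreal (4 * sqrt \<delta>) = ennreal (p ^ 6 * (4 * sqrt \<delta>))"
        "ennreal (p ^ 3 * l) * ennreal K = ennreal (p ^ 3 * l * K)"
        "ennreal (p ^ 3 / l ^ 3) * ennreal (2 / \<delta>) = ennreal (p ^ 3 / l ^ 3 * (2 / \<delta>))"
        by (rule ennreal_mult[symmetric]; use \<open>p > 0\<close> pos K(2) in simp)+
      have plus: "ennreal x + (ennreal y + ennreal z) = ennreal (x + (y + z))"
        if "x \<ge> 0" "y \<ge> 0" "z \<ge> 0" for x y z
        using that by simp
      show ?thesis
        unfolding e by (rule plus; use \<open>p > 0\<close> pos K(2) in simp)
    qed
    also have "p ^ 6 * (4 * sqrt \<delta>) + (p ^ 3 * l * K + p ^ 3 / l ^ 3 * (2 / \<delta>)) = 7 * sqrt K * p ^ 4"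
    proof -
      define k where "k = sqrt K"
      have k: "K = k\<^sup>2" "k > 0"
        using K(2) by (simp_all add: k_def)
      have "\<delta> = (k / p\<^sup>2)\<^sup>2"
        by (simp add: \<delta>_def k(1) power_divide flip: power_mult)
      then have "sqrt \<delta> = k / p\<^sup>2"
        using k(2) by (simp only: real_sqrt_abs) simp
      then show ?thesis
        unfolding k_def[symmetric] l_def \<delta>_def k(1) using k(2) \<open>p > 0\<close>
        by (simp add: field_simps) (simp add: eval_nat_numeral)
    qed
    finally show ?thesis
      by (simp add: p_def)
  qed
  have "(\<integral>\<^sup>+ t. \<integral>\<^sup>+ s. ennreal (g t s) \<partial>lborel \<partial>lborel) \<le> (\<integral>\<^sup>+ t. ennreal (7 * sqrt K * F t ^ 4) \<partial>lborel)"
    by (intro nn_integral_mono inner)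
  also have "\<dots> = ennreal (LINT t|lborel. 7 * sqrt K * F t ^ 4)"
    using int K(2) by (intro nn_integral_eq_integral) auto
  also have "(LINT t|lborel. 7 * sqrt K * F t ^ 4) = 7 * (K * sqrt K)"
    by (simp add: K(1))
  finally have 7: "(\<integral>\<^sup>+ t. \<integral>\<^sup>+ s. ennreal (g t s) \<partial>lborel \<partial>lborel) \<le> ennreal (7 * (K * sqrt K))" .
  have "(\<integral>\<^sup>+ t. \<integral>\<^sup>+ s. ennreal (h t s) \<partial>lborel \<partial>lborel)
      \<le> (\<integral>\<^sup>+ t. \<integral>\<^sup>+ s. ennreal (g t s) + ennreal (g s t) \<partial>lborel \<partial>lborel)"
  proof (intro nn_integral_mono)
    fix t s
    have "h t s \<le> g t s + g s t"
      using h_nonneg[of t s] by (auto simp: g_def h_def abs_minus_commute mult_ac)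
    then show "ennreal (h t s) \<le> ennreal (g t s) + ennreal (g s t)"
      using g_nonneg by (simp add: ennreal_leI flip: ennreal_plus)
  qed
  also have "\<dots> = (\<integral>\<^sup>+ t. \<integral>\<^sup>+ s. ennreal (g t s) \<partial>lborel \<partial>lborel) + (\<integral>\<^sup>+ t. \<integral>\<^sup>+ s. ennreal (g s t) \<partial>lborel \<partial>lborel)"
    by (simp add: nn_integral_add lborel.borel_measurable_nn_integral)
  also have "(\<integral>\<^sup>+ t. \<integral>\<^sup>+ s. ennreal (g s t) \<partial>lborel \<partial>lborel) = (\<integral>\<^sup>+ t. \<integral>\<^sup>+ s. ennreal (g t s) \<partial>lborel \<partial>lborel)"
    by (rule lborel_pair.Fubini') measurable
  also have "(\<integral>\<^sup>+ t. \<integral>\<^sup>+ s. ennreal (g t s) \<partial>lborel \<partial>lborel) + (\<integral>\<^sup>+ t. \<integral>\<^sup>+ s. ennreal (g t s) \<partial>lborel \<partial>lborel)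
      \<le> ennreal (7 * (K * sqrt K)) + ennreal (7 * (K * sqrt K))"
    by (intro add_mono 7)
  also have "\<dots> = ennreal (14 * (K * sqrt K))"
    using K(2) by (simp flip: ennreal_plus)
  finally show ?thesis
    by (simp add: h_def)
qed

section \<open>The dispersive estimate\<close>

lemma sin_ge_half:
  assumes "0 \<le> x" "x \<le> pi / 2"
  shows "x / 2 \<le> sin x"
proof -
  \<comment> \<open>Halving the angle gives \<open>sin x = 2 * sin y * cos y\<close>; up to pi/4
    both \<open>y * cos y \<le> sin y\<close> and \<open>1 \<le> 2 * (cos y)^2\<close> hold.\<close>
  define y where "y = x / 2"
  have y: "0 \<le> y" "y \<le> pi / 4"
    using assms by (simp_all add: y_def)
  have "sin 0 - 0 * cos 0 \<le> sin y - y * cos y"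
  proof (rule DERIV_nonneg_imp_nondecreasing[OF y(1)])
    fix z
    assume z: "0 \<le> z" "z \<le> y"
    have "((\<lambda>z. sin z - z * cos z) has_real_derivative z * sin z) (at z)"
      by (auto intro!: derivative_eq_intros)
    moreover have "0 \<le> z * sin z"
      using z y pi_gt_zero by (intro mult_nonneg_nonneg sin_ge_zero) auto
    ultimately show "\<exists>d. ((\<lambda>z. sin z - z * cos z) has_real_derivative d) (at z) \<and> 0 \<le> d"
      by blast
  qed
  then have 1: "y * cos y \<le> sin y"
    by simp
  have 2: "sqrt 2 / 2 \<le> cos y"
    using cos_monotone_0_pi_le[of y "pi / 4"] y pi_gt_zero by (simp add: cos_45)
  have "(sqrt 2 / 2)\<^sup>2 \<le> (cos y)\<^sup>2"
    using 2 by (intro power_mono) auto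
  then have "1 \<le> 2 * (cos y)\<^sup>2"
    by (simp add: power_divide)
  then have "y * 1 \<le> y * (2 * (cos y)\<^sup>2)"
    using y by (intro mult_left_mono) auto
  also have "\<dots> = 2 * (y * cos y) * cos y"
    by (simp add: power2_eq_square)
  also have "\<dots> \<le> 2 * sin y * cos y"
  proof -
    have "0 \<le> cos y"
      using 2 by (rule order_trans[rotated]) simp
    then show ?thesis
      using 1 by (intro mult_right_mono) auto
  qed
  also have "\<dots> = sin x"
    using sin_double[of y] by (simp add: y_def)
  finally show ?thesis
    by (simp add: y_def)
qed

text \<open>Geometrically this concerns the distance from 1 to the ray of angle
  \<open>\<theta>\<close>: at least the sine of the angle when it is acute, at least 1 when it is
  obtuse. Uniformity in \<open>\<rho>\<close> is what survives \<open>r\<close> tending to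
  1.\<close>

lemma norm_one_minus_cis_ge:
  assumes "0 \<le> \<rho>" "\<bar>\<theta>\<bar> \<le> pi"
  shows "\<bar>\<theta>\<bar> / pi \<le> cmod (1 - of_real \<rho> * cis \<theta>)"
proof -
  have sq: "(cmod (1 - of_real \<rho> * cis \<theta>))\<^sup>2 = (1 - \<rho> * cos \<theta>)\<^sup>2 + (\<rho> * sin \<theta>)\<^sup>2"
    by (simp add: cmod_power2)
  show ?thesis
  proof (cases "\<bar>\<theta>\<bar> \<le> pi / 2")
    case True
    have "\<rho>\<^sup>2 * (cos \<theta>)\<^sup>2 + \<rho>\<^sup>2 * (sin \<theta>)\<^sup>2 = \<rho>\<^sup>2"
      by (simp flip: distrib_left)
    then have "(1 - \<rho> * cos \<theta>)\<^sup>2 + (\<rho> * sin \<theta>)\<^sup>2 - (sin \<theta>)\<^sup>2 = (\<rho> - cos \<theta>)\<^sup>2"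
      by (simp add: sin_squared_eq power_mult_distrib power2_diff)
    then have "(sin \<theta>)\<^sup>2 \<le> (cmod (1 - of_real \<rho> * cis \<theta>))\<^sup>2"
      unfolding sq using zero_le_power2[of "\<rho> - cos \<theta>"] by linarith
    then have "\<bar>sin \<theta>\<bar>\<^sup>2 \<le> (cmod (1 - of_real \<rho> * cis \<theta>))\<^sup>2"
      by simp
    then have "\<bar>sin \<theta>\<bar> \<le> cmod (1 - of_real \<rho> * cis \<theta>)"
      by (rule power2_le_imp_le) simp
    moreover have "\<bar>\<theta>\<bar> / 2 \<le> sin \<bar>\<theta>\<bar>"
      using True by (intro sin_ge_half) auto
    moreover have "sin \<bar>\<theta>\<bar> \<le> \<bar>sin \<theta>\<bar>"
      by (cases "\<theta> \<ge> 0") auto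
    moreover have "\<bar>\<theta>\<bar> / pi \<le> \<bar>\<theta>\<bar> / 2"
      using pi_ge_two by (intro divide_left_mono) auto
    ultimately show ?thesis
      by linarith
  next
    case False
    have "cos \<theta> = cos \<bar>\<theta>\<bar>"
      by (cases "\<theta> \<ge> 0") auto
    also have "\<dots> \<le> cos (pi / 2)"
      using False assms(2) by (intro cos_monotone_0_pi_le) auto
    finally have "\<rho> * cos \<theta> \<le> 0"
      using assms(1) by (simp add: mult_nonneg_nonpos)
    then have "1\<^sup>2 \<le> (1 - \<rho> * cos \<theta>)\<^sup>2"
      by (intro power_mono) auto
    then have "1\<^sup>2 \<le> (cmod (1 - of_real \<rho> * cis \<theta>))\<^sup>2"
      unfolding sq by (simp add: add_increasing2)
    then have "1 \<le> cmod (1 - of_real \<rho> * cis \<theta>)"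
      by (rule power2_le_imp_le) simp
    moreover have "\<bar>\<theta>\<bar> / pi \<le> 1"
      using assms(2) by simp
    ultimately show ?thesis
      by linarith
  qed
qed

text \<open>The restriction on \<open>s - t\<close> keeps the angle \<open>4 * (s - t)\<close> of
  \<open>w^2\<close> within half a turn, where the distance from \<open>w^2\<close> to 1 is bounded
  below by a multiple of the angle. The constant is independent of \<open>r\<close>.\<close>

lemma dispersive:
  assumes r: "0 < r" "r < 1" and st: "\<bar>s - t\<bar> \<le> pi / 4" "s \<noteq> t"
  shows "cmod (cinner (flow s (mehler_L2 r x)) (flow t (mehler_L2 r y))) \<le> 1/2 * \<bar>s - t\<bar> powr (-1/2)"
proof -
  define w where "w = of_real (r\<^sup>2) * cis (2 * (s - t))"
  have "w\<^sup>2 = of_real (r ^ 4) * (cis (2 * (s - t)) * cis (2 * (s - t)))"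
    by (simp add: w_def power2_eq_square) (simp add: eval_nat_numeral)
  also have "cis (2 * (s - t)) * cis (2 * (s - t)) = cis (4 * (s - t))"
    unfolding cis_mult by (rule arg_cong[of _ _ cis]) simp
  finally have "w\<^sup>2 = of_real (r ^ 4) * cis (4 * (s - t))" .
  moreover have "\<bar>4 * (s - t)\<bar> \<le> pi"
    unfolding abs_mult using st(1) by simp
  ultimately have "\<bar>4 * (s - t)\<bar> / pi \<le> cmod (1 - w\<^sup>2)"
    using norm_one_minus_cis_ge[of "r ^ 4" "4 * (s - t)"] r by simp
  then have *: "4 * \<bar>s - t\<bar> \<le> pi * cmod (1 - w\<^sup>2)"
    by (simp only: abs_mult abs_numeral pos_divide_le_eq[OF pi_gt_zero] mult.commute[of pi])
  have "cmod (cinner (flow s (mehler_L2 r x)) (flow t (mehler_L2 r y))) \<le> 1 / sqrt (pi * cmod (1 - w\<^sup>2))"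
    unfolding w_def by (rule cinner_flow_mehler_L2_le[OF r])
  also have "\<dots> \<le> 1 / sqrt (4 * \<bar>s - t\<bar>)"
  proof -
    have "0 < 4 * \<bar>s - t\<bar>"
      using st by simp
    moreover from this * have "0 < pi * cmod (1 - w\<^sup>2)"
      by (rule less_le_trans)
    ultimately have "0 < sqrt (pi * cmod (1 - w\<^sup>2)) * sqrt (4 * \<bar>s - t\<bar>)"
      by (intro mult_pos_pos) (simp_all only: real_sqrt_gt_0_iff)
    then show ?thesis
      by (rule divide_left_mono[OF real_sqrt_le_mono[OF *] zero_le_one])
  qed
  also have "\<dots> = 1/2 * \<bar>s - t\<bar> powr (-1/2)"
  proof -
    have "\<bar>s - t\<bar> powr (-1/2) = 1 / sqrt \<bar>s - t\<bar>"
      using powr_minus_divide[of "\<bar>s - t\<bar>" "1/2"] by (simp add: powr_half_sqrt)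
    then show ?thesis
      by (simp add: real_sqrt_mult)
  qed
  finally show ?thesis .
qed

section \<open>Measurability, and the estimate along selected points\<close>

lemma measurable_cinner [measurable (raw)]:
  "f \<in> borel_measurable M \<Longrightarrow> g \<in> borel_measurable M \<Longrightarrow> (\<lambda>x. cinner (f x) (g x)) \<in> borel_measurable M"
  by (rule borel_measurable_continuous_Pair) (auto intro!: cinner.continuous_on continuous_intros)

lemma measurable_scaleC [measurable (raw)]:
  "f \<in> borel_measurable M \<Longrightarrow> g \<in> borel_measurable M \<Longrightarrow> (\<lambda>x. f x *\<^sub>C g x) \<in> borel_measurable M"
  by (rule borel_measurable_continuous_Pair) (auto intro!: scaleC.continuous_on continuous_intros)

lemma measurable_flow [measurable (raw)]:
  assumes "f \<in> borel_measurable M" "g \<in> borel_measurable M"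
  shows "(\<lambda>x. flow (f x) (g x)) \<in> borel_measurable M"
  using assms
proof (rule borel_measurable_continuous_Pair)
  show "continuous_on UNIV (\<lambda>x. flow (fst x) (snd x))"
    unfolding continuous_on_def by (intro ballI tendsto_flow tendsto_fst tendsto_snd tendsto_ident_at)
qed

text \<open>The \<open>T T\<^sup>*\<close> argument, along a measurable choice \<open>X\<close> of points.\<close>

lemma strichartz_selection:
  fixes X :: "real \<Rightarrow> nat" and q :: "nat \<Rightarrow> real"
  assumes r: "0 < r" "r < 1" and X [measurable]: "X \<in> borel \<rightarrow>\<^sub>M count_space UNIV" and ab: "b - a \<le> pi / 4"
  shows "(\<integral>\<^sup>+ t. ennreal (indicator {a..b} t * cmod (cinner (flow t f) (mehler_L2 r (q (X t)))) ^ 4) \<partial>lborel) \<le> ennreal (49 * norm f ^ 4)"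
proof -
  obtain B where B: "\<And>x. norm (mehler_L2 r x) \<le> B"
    using norm_mehler_L2_le[OF r] by blast
  then have "B \<ge> 0"
    using norm_ge_zero order_trans by blast
  define m where "m t = mehler_L2 r (q (X t))" for t
  have m_meas [measurable]: "m \<in> borel_measurable borel"
    unfolding m_def by (rule measurable_compose_countable[OF _ X]) measurable
  have m_le: "norm (m t) \<le> B" for t
    unfolding m_def by (rule B)
  define c where "c t = cinner (flow t f) (m t)" for t
  have [measurable]: "c \<in> borel_measurable borel"
    unfolding c_def by measurable
  \<comment> \<open>This crude bound depends on \<open>r\<close> and does not enter the final
    constant; it makes \<open>K\<close> finite, so that powers of it can be cancelled, and
    \<open>G\<close> integrable.\<close>
  have c_le: "cmod (c t) \<le> norm f * B" for t
  proof -
    have "cmod (c t) \<le> norm f * norm (m t)"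
      using norm_cinner_le[of "flow t f" "m t"] by (simp add: c_def)
    also have "\<dots> \<le> norm f * B"
      by (intro mult_left_mono m_le) auto
    finally show ?thesis .
  qed
  define J :: "real \<Rightarrow> real" where "J = indicator {a..b}"
  have [measurable]: "J \<in> borel_measurable borel"
    by (simp add: J_def)
  have J: "J t * J t = J t" "J t \<ge> 0" "J t \<le> 1" for t
    by (auto simp: J_def indicator_def)
  have int_J: "integrable lborel (\<lambda>t. C * J t)" for C :: real
    unfolding J_def by (intro integrable_mult_right integrable_real_indicator) (auto simp: emeasure_lborel_Icc_eq)
  define F where "F t = J t * cmod (c t)" for t
  have [measurable]: "F \<in> borel_measurable borel"
    unfolding F_def by measurable
  have F_nonneg: "F t \<ge> 0" for t
    using J by (simp add: F_def)
  have F_pow: "F t ^ Suc k = J t * cmod (c t) ^ Suc k" for t k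
    by (auto simp: F_def J_def indicator_def)
  have F4: "F t ^ 4 = J t * cmod (c t) ^ 4" for t
    using F_pow[of t 3] by simp
  have F4_int: "integrable lborel (\<lambda>t. F t ^ 4)"
  proof (rule Bochner_Integration.integrable_bound[OF int_J[of "(norm f * B) ^ 4"]])
    have le4: "F t ^ 4 \<le> (norm f * B) ^ 4 * J t" for t
      unfolding F4 mult.commute[of "J t"] by (intro mult_right_mono power_mono c_le J) auto
    have "\<bar>F t ^ 4\<bar> \<le> \<bar>(norm f * B) ^ 4 * J t\<bar>" for t
      using order_trans[OF le4[of t] abs_ge_self] by simp
    then show "AE t in lborel. norm (F t ^ 4) \<le> norm ((norm f * B) ^ 4 * J t)"
      by (simp only: real_norm_def) simp
  qed measurable
  define K where "K = (LINT t|lborel. F t ^ 4)"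
  have nn_K: "(\<integral>\<^sup>+ t. ennreal (F t ^ 4) \<partial>lborel) = ennreal K"
    unfolding K_def by (rule nn_integral_eq_integral[OF F4_int]) auto
  have "K \<le> 49 * norm f ^ 4"
  proof (cases "K > 0")
    case True
    define v where "v t = flow (- t) (m t)" for t
    have [measurable]: "v \<in> borel_measurable borel"
      unfolding v_def by measurable
    \<comment> \<open>The dual weight: pairing \<open>f\<close> with \<open>G t\<close> gives
      \<open>F t ^ 4\<close>, so the integral \<open>V\<close> of \<open>G\<close> satisfies
      \<open>cinner f V = K\<close>.\<close>
    define G where "G t = (of_real (J t * cmod (c t) ^ 2) * c t) *\<^sub>C v t" for t
    have [measurable]: "G \<in> borel_measurable borel"
      unfolding G_def by measurable
    have norm_G: "norm (G t) = F t ^ 3 * norm (m t)" for t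
      using J(2) F_pow[of t 2] by (simp add: G_def norm_scaleC norm_mult norm_power v_def eval_nat_numeral mult_ac)
    have int_G: "integrable lborel G"
    proof (rule Bochner_Integration.integrable_bound[OF int_J[of "(norm f * B) ^ 3 * B"]])
      have "norm (G t) \<le> (norm f * B) ^ 3 * B * J t" for t
      proof -
        have "F t ^ 3 \<le> (norm f * B) ^ 3 * J t"
        proof -
          have "F t ^ 3 = cmod (c t) ^ 3 * J t"
            using F_pow[of t 2] by (simp add: mult.commute)
          also have "\<dots> \<le> (norm f * B) ^ 3 * J t"
            by (intro mult_right_mono power_mono c_le J) auto
          finally show ?thesis .
        qed
        then have "F t ^ 3 * norm (m t) \<le> ((norm f * B) ^ 3 * J t) * B"
          using m_le[of t] J(2)[of t] \<open>B \<ge> 0\<close> by (intro mult_mono) auto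
        then show ?thesis
          by (simp add: norm_G mult_ac)
      qed
      then show "AE t in lborel. norm (G t) \<le> norm ((norm f * B) ^ 3 * B * J t)"
        by (intro AE_I2) (metis abs_ge_self order_trans real_norm_def)
    qed measurable
    define V where "V = (LINT t|lborel. G t)"
    have inner_G: "cinner f (G t) = of_real (F t ^ 4)" for t
    proof -
      have "cinner f (G t) = of_real (J t * cmod (c t) ^ 2) * (c t * cnj (c t))"
        using cinner_flow[of t f "m t"] by (simp add: G_def cinner_scaleC_right v_def c_def)
      also have "\<dots> = of_real (F t ^ 4)"
        unfolding complex_norm_square[symmetric] F4 by (simp add: eval_nat_numeral mult_ac)
      finally show ?thesis .
    qed
    have "cinner f V = (LINT t|lborel. cinner f (G t))"
      unfolding V_def by (rule integral_bounded_linear[OF cinner.bounded_linear_right int_G, symmetric])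
    then have "cinner f V = of_real K"
      by (simp only: inner_G integral_complex_of_real K_def)
    then have KV: "K \<le> norm f * norm V"
      using norm_cinner_le[of f V] True by simp
    have cVV: "cinner V V = (LINT t|lborel. cinner (G t) V)"
      by (subst (1) V_def) (rule integral_bounded_linear[OF cinner.bounded_linear_left int_G, symmetric])
    have cGV: "cinner (G t) V = (LINT s|lborel. cinner (G t) (G s))" for t
      unfolding V_def by (rule integral_bounded_linear[OF cinner.bounded_linear_right int_G, symmetric])
    \<comment> \<open>The squared norm of \<open>V\<close> is a double integral in which the flow
      occurs only through the kernel at the time difference; the dispersive bound leaves the
      fractional integral of \<open>F ^ 3\<close>.\<close>
    have "ennreal (cmod (cinner V V)) \<le> (\<integral>\<^sup>+ t. ennreal (cmod (cinner (G t) V)) \<partial>lborel)"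
      unfolding cVV
      by (intro integral_norm_bound_ennreal integrable_bounded_linear[OF cinner.bounded_linear_left int_G])
    also have "\<dots> \<le> (\<integral>\<^sup>+ t. \<integral>\<^sup>+ s. ennreal (cmod (cinner (G t) (G s))) \<partial>lborel \<partial>lborel)"
      unfolding cGV
      by (intro nn_integral_mono integral_norm_bound_ennreal integrable_bounded_linear[OF cinner.bounded_linear_right int_G])
    also have "\<dots> \<le> (\<integral>\<^sup>+ t. \<integral>\<^sup>+ s. ennreal (1/2) * ennreal (F t ^ 3 * F s ^ 3 * \<bar>t - s\<bar> powr (-1/2)) \<partial>lborel \<partial>lborel)"
    proof (rule nn_integral_mono, rule nn_integral_mono_AE)
      fix t :: real
      have "AE s in lborel. s \<noteq> t"
        by (rule AE_lborel_singleton)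
      then show "AE s in lborel. ennreal (cmod (cinner (G t) (G s)))
          \<le> ennreal (1/2) * ennreal (F t ^ 3 * F s ^ 3 * \<bar>t - s\<bar> powr (-1/2))"
      proof eventually_elim
        case (elim s)
        have eq: "cmod (cinner (G t) (G s)) = (F t ^ 3 * F s ^ 3) * cmod (cinner (v t) (v s))"
          using J(2) F_pow[of t 2] F_pow[of s 2]
          by (simp add: G_def cinner_scaleC_left cinner_scaleC_right norm_mult norm_power eval_nat_numeral mult_ac)
        have "cmod (cinner (G t) (G s)) \<le> (F t ^ 3 * F s ^ 3) * (1/2 * \<bar>t - s\<bar> powr (-1/2))"
        proof (cases "t \<in> {a..b} \<and> s \<in> {a..b}")
          case True
          then have "\<bar>- t - - s\<bar> \<le> b - a"
            by (simp add: abs_le_iff)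
          then have "\<bar>- t - - s\<bar> \<le> pi / 4" "- t \<noteq> - s"
            using ab elim by linarith+
          from dispersive[OF r this] have "cmod (cinner (v t) (v s)) \<le> 1/2 * \<bar>t - s\<bar> powr (-1/2)"
            by (simp add: v_def m_def abs_minus_commute)
          then show ?thesis
            unfolding eq using F_nonneg by (intro mult_left_mono) auto
        next
          case False
          then have "F t = 0 \<or> F s = 0"
            by (auto simp: F_def J_def)
          then show ?thesis
            unfolding eq by auto
        qed
        then have "ennreal (cmod (cinner (G t) (G s))) \<le> ennreal (1/2 * (F t ^ 3 * F s ^ 3 * \<bar>t - s\<bar> powr (-1/2)))"
          by (intro ennreal_leI) (simp add: mult_ac)
        then show ?case
          by (subst (asm) ennreal_mult) (use F_nonneg in auto)
      qed
    qed
    also have "\<dots> = ennreal (1/2) * (\<integral>\<^sup>+ t. \<integral>\<^sup>+ s. ennreal (F t ^ 3 * F s ^ 3 * \<bar>t - s\<bar> powr (-1/2)) \<partial>lborel \<partial>lborel)"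
      by (simp add: nn_integral_cmult lborel.borel_measurable_nn_integral)
    also have "\<dots> \<le> ennreal (1/2) * ennreal (14 * (K * sqrt K))"
      by (intro mult_left_mono hardy_littlewood_sobolev F_nonneg F4_int K_def True) auto
    also have "\<dots> = ennreal (7 * (K * sqrt K))"
      using True by (subst ennreal_mult[symmetric]) simp_all
    finally have "ennreal ((norm V)\<^sup>2) \<le> ennreal (7 * (K * sqrt K))"
      by (simp add: cinner_self norm_power)
    then have V2: "(norm V)\<^sup>2 \<le> 7 * (K * sqrt K)"
      using True by (subst (asm) ennreal_le_iff) auto
    have "K\<^sup>2 \<le> (norm f * norm V)\<^sup>2"
      using KV True by (intro power_mono) auto
    also have "\<dots> \<le> (norm f)\<^sup>2 * (7 * (K * sqrt K))"
      unfolding power_mult_distrib by (intro mult_left_mono V2) auto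
    \<comment> \<open>Cancelling \<open>K * sqrt K\<close> leaves a bound for \<open>sqrt K\<close>
      with the factor 7; squaring it gives the constant 49.\<close>
    finally have "(K * sqrt K) * sqrt K \<le> (K * sqrt K) * (7 * (norm f)\<^sup>2)"
      using True by (simp add: power2_eq_square mult_ac)
    then have "sqrt K \<le> 7 * (norm f)\<^sup>2"
      using True by (subst (asm) mult_le_cancel_left_pos) auto
    then have "(sqrt K)\<^sup>2 \<le> (7 * (norm f)\<^sup>2)\<^sup>2"
      using True by (intro power_mono) auto
    then show ?thesis
      using True by (simp add: power_mult_distrib)
  qed (auto intro: order_trans[of _ 0])
  then show ?thesis
    using nn_K by (simp add: F4 J_def c_def m_def ennreal_leI)
qed

lemma closure_Rats: "closure (\<rat> :: real set) = UNIV"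
proof -
  have "x \<in> closure \<rat>" for x :: real
    unfolding closure_approachable
  proof (intro allI impI)
    fix e :: real
    assume "e > 0"
    then obtain y where "y \<in> \<rat>" "x < y" "y < x + e"
      using Rats_dense_in_real[of x "x + e"] by auto
    then show "\<exists>y\<in>\<rat>. dist y x < e"
      by (intro bexI[of _ y]) (auto simp: dist_real_def)
  qed
  then show ?thesis by auto
qed

text \<open>The supremum over rational points need not be attained, but some rational point comes
  within a factor 2 of it. The least index of such a point is a measurable function of time, and
  continuity in \<open>y\<close> extends the bound from the rationals to the line. The constant is
  \<open>2 ^ 4\<close> times 49.\<close>

lemma strichartz:
  assumes r: "0 < r" "r < 1"
  obtains F :: "real \<Rightarrow> real" where "F \<in> borel_measurable borel"
    "\<And>t y. cmod (cinner (flow t f) (mehler_L2 r y)) \<le> F t"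
    "\<And>a b. b - a \<le> pi / 4 \<Longrightarrow> (\<integral>\<^sup>+ t. ennreal (indicator {a..b} t * F t ^ 4) \<partial>lborel) \<le> ennreal (784 * norm f ^ 4)"
proof -
  define q :: "nat \<Rightarrow> real" where "q n = of_rat (from_nat n)" for n
  have range_q: "range q = \<rat>"
    unfolding q_def Rats_def by (metis from_nat_to_nat image_image surj_def surj_from_nat)
  define d where "d t k = cmod (cinner (flow t f) (mehler_L2 r (q k)))" for t k
  have [measurable]: "(\<lambda>t. d t k) \<in> borel_measurable borel" for k
    unfolding d_def by measurable
  define X where "X t = (LEAST k. \<forall>j. d t j \<le> 2 * d t k)" for t
  have X [measurable]: "X \<in> borel \<rightarrow>\<^sub>M count_space UNIV"
    unfolding X_def by measurable
  have "\<exists>k. \<forall>j. d t j \<le> 2 * d t k" for t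
  proof (cases "\<exists>i. d t i > 0")
    case True
    then obtain i where i: "d t i > 0"
      by blast
    obtain B where B: "\<And>x. norm (mehler_L2 r x) \<le> B"
      using norm_mehler_L2_le[OF r] by blast
    have "d t k \<le> norm f * B" for k
      unfolding d_def using norm_cinner_le[of "flow t f" "mehler_L2 r (q k)"] mult_left_mono[OF B[of "q k"] norm_ge_zero[of f]]
      by simp
    then have bdd: "bdd_above (range (d t))"
      by (auto simp: bdd_above_def)
    define S where "S = (SUP k. d t k)"
    have le_S: "d t k \<le> S" for k
      unfolding S_def by (intro cSUP_upper bdd) auto
    have "S / 2 < (SUP k. d t k)"
      using i le_S[of i] unfolding S_def by linarith
    then obtain k where k: "S / 2 < d t k"
      using less_cSUP_iff[of UNIV "d t" "S / 2"] bdd by auto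
    have "d t j \<le> 2 * d t k" for j
      using le_S[of j] k by linarith
    then show ?thesis
      by blast
  next
    case False
    then have "d t i = 0" for i
      using norm_ge_zero[of "cinner (flow t f) (mehler_L2 r (q i))"] unfolding d_def by (meson antisym not_less)
    then show ?thesis by simp
  qed
  then have X_le: "d t j \<le> 2 * d t (X t)" for t j
    using LeastI_ex[of "\<lambda>k. \<forall>j. d t j \<le> 2 * d t k"] by (simp add: X_def)
  define F where "F t = 2 * cmod (cinner (flow t f) (mehler_L2 r (q (X t))))" for t
  show thesis
  proof (rule that[of F])
    have "(\<lambda>t. d t (X t)) \<in> borel_measurable borel"
      by (rule measurable_compose_countable[OF _ X]) measurable
    then show "F \<in> borel_measurable borel"
      unfolding F_def d_def by measurable
    fix t y
    have "closed {y. cmod (cinner (flow t f) (mehler_L2 r y)) \<le> F t}"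
      by (intro closed_Collect_le continuous_intros cinner.continuous_on continuous_at_imp_continuous_on ballI continuous_mehler_L2 r)
    moreover have "\<rat> \<subseteq> {y. cmod (cinner (flow t f) (mehler_L2 r y)) \<le> F t}"
      unfolding range_q[symmetric] using X_le by (auto simp: F_def d_def)
    ultimately have "closure \<rat> \<subseteq> {y. cmod (cinner (flow t f) (mehler_L2 r y)) \<le> F t}"
      by (rule closure_minimal[rotated])
    then show "cmod (cinner (flow t f) (mehler_L2 r y)) \<le> F t"
      by (auto simp: closure_Rats)
  next
    fix a b :: real
    assume ab: "b - a \<le> pi / 4"
    have "(\<integral>\<^sup>+ t. ennreal (indicator {a..b} t * F t ^ 4) \<partial>lborel)
        = (\<integral>\<^sup>+ t. ennreal 16 * ennreal (indicator {a..b} t * cmod (cinner (flow t f) (mehler_L2 r (q (X t)))) ^ 4) \<partial>lborel)"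
      by (intro nn_integral_cong, subst ennreal_mult[symmetric]) (auto simp: F_def power_mult_distrib)
    also have "\<dots> = ennreal 16 * (\<integral>\<^sup>+ t. ennreal (indicator {a..b} t * cmod (cinner (flow t f) (mehler_L2 r (q (X t)))) ^ 4) \<partial>lborel)"
    proof (rule nn_integral_cmult)
      have "(\<lambda>t. d t (X t)) \<in> borel_measurable borel"
        by (rule measurable_compose_countable[OF _ X]) measurable
      then show "(\<lambda>t. ennreal (indicator {a..b} t * cmod (cinner (flow t f) (mehler_L2 r (q (X t)))) ^ 4)) \<in> borel_measurable lborel"
        unfolding d_def by measurable
    qed
    also have "\<dots> \<le> ennreal 16 * ennreal (49 * norm f ^ 4)"
      by (intro mult_left_mono strichartz_selection r X ab) auto
    also have "\<dots> = ennreal (784 * norm f ^ 4)"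
      by (subst ennreal_mult[symmetric]) auto
    finally show "(\<integral>\<^sup>+ t. ennreal (indicator {a..b} t * F t ^ 4) \<partial>lborel) \<le> ennreal (784 * norm f ^ 4)" .
  qed
qed

section \<open>The quintic nonlinearity\<close>

text \<open>Only the modulus in the weight is capped. This makes the map globally Lipschitz, hence
  continuous on \<open>L2\<close>, and its modulus increases with \<open>k\<close> to that of the
  quintic power.\<close>

definition cut :: "real \<Rightarrow> complex \<Rightarrow> complex" where
  "cut k z = of_real (min (cmod z) k ^ 4) * z"

text \<open>The constant 5 is 1 for the change of \<open>z\<close> under the capped weight plus 4
  for the change of the weight.\<close>

lemma cut_Lipschitz:
  assumes "k \<ge> 0"
  shows "cmod (cut k z - cut k w) \<le> 5 * k ^ 4 * cmod (z - w)"
proof -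
  \<comment> \<open>With \<open>z\<close> the smaller of the two, the weights can differ only when
    \<open>cmod z \<le> k\<close>, so the remaining factor \<open>cmod z\<close> is bounded
    there.\<close>
  have *: "cmod (cut k z - cut k w) \<le> 5 * k ^ 4 * cmod (z - w)" if "cmod z \<le> cmod w" for z w
  proof -
    define a where "a = min (cmod z) k"
    define b where "b = min (cmod w) k"
    have ab: "0 \<le> a" "a \<le> b" "b \<le> k" "b - a \<le> cmod (z - w)" "a \<le> cmod z"
      using that assms norm_triangle_ineq2[of w z] by (auto simp: a_def b_def norm_minus_commute)
    have "cmod z * (b ^ 4 - a ^ 4) \<le> 4 * k ^ 4 * cmod (z - w)"
    proof (cases "cmod z \<le> k")
      case True
      have "b ^ 4 - a ^ 4 = (b - a) * (b ^ 3 + b ^ 2 * a + b * a ^ 2 + a ^ 3)"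
        by (simp add: eval_nat_numeral algebra_simps)
      also have "\<dots> \<le> cmod (z - w) * (k ^ 3 + k ^ 2 * k + k * k ^ 2 + k ^ 3)"
        using ab by (intro mult_mono add_mono power_mono add_nonneg_nonneg mult_nonneg_nonneg zero_le_power) auto
      also have "\<dots> = 4 * k ^ 3 * cmod (z - w)"
        by (simp add: eval_nat_numeral)
      finally have "cmod z * (b ^ 4 - a ^ 4) \<le> k * (4 * k ^ 3 * cmod (z - w))"
        using True ab assms by (intro mult_mono) (auto intro: power_mono)
      then show ?thesis
        by (simp add: eval_nat_numeral mult_ac)
    next
      case False
      then have "a = b"
        using that by (simp add: a_def b_def)
      then show ?thesis
        using assms by simp
    qed
    moreover have "b ^ 4 * cmod (z - w) \<le> k ^ 4 * cmod (z - w)"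
      using ab by (intro mult_right_mono power_mono) auto
    moreover have "cut k z - cut k w = of_real (b ^ 4) * (z - w) - of_real (b ^ 4 - a ^ 4) * z"
      by (simp add: cut_def a_def b_def algebra_simps)
    then have "cmod (cut k z - cut k w) \<le> b ^ 4 * cmod (z - w) + cmod z * (b ^ 4 - a ^ 4)"
      using norm_triangle_ineq4[of "of_real (b ^ 4) * (z - w)" "of_real (b ^ 4 - a ^ 4) * z"] ab
      by (simp add: norm_mult power_mono mult.commute del: of_real_diff of_real_power)
    ultimately show ?thesis
      by linarith
  qed
  show ?thesis
    using *[of z w] *[of w z] by (cases "cmod z \<le> cmod w") (auto simp: norm_minus_commute)
qed

lemma measurable_cut [measurable]: "cut k \<in> borel_measurable borel"
  unfolding cut_def by measurable

lemma norm_cut: "k \<ge> 0 \<Longrightarrow> cmod (cut k z) = min (cmod z) k ^ 4 * cmod z"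
  by (simp add: cut_def norm_mult norm_power)

lemma norm_cut_le: "k \<ge> 0 \<Longrightarrow> cmod (cut k z) \<le> k ^ 4 * cmod z"
  by (simp add: norm_cut mult_right_mono power_mono)

lemma norm_abs_L2_le:
  assumes "square_integrable f" "square_integrable g" "C \<ge> 0"
    and le: "AE x in lborel. cmod (f x) \<le> C * cmod (g x)"
  shows "norm (abs_L2 f) \<le> C * norm (abs_L2 g)"
proof -
  have "(LINT x|lborel. (cmod (f x))\<^sup>2) \<le> (LINT x|lborel. C\<^sup>2 * (cmod (g x))\<^sup>2)"
  proof (rule integral_mono_AE)
    show "AE x in lborel. (cmod (f x))\<^sup>2 \<le> C\<^sup>2 * (cmod (g x))\<^sup>2"
      using le by eventually_elim (metis norm_ge_zero power_mono power_mult_distrib)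
  qed (use assms in \<open>auto simp: square_integrable_def\<close>)
  then have "sqrt (LINT x|lborel. (cmod (f x))\<^sup>2) \<le> sqrt (C\<^sup>2 * (LINT x|lborel. (cmod (g x))\<^sup>2))"
    by simp
  then show ?thesis
    using assms by (simp add: norm_abs_L2 real_sqrt_mult)
qed

definition cut_L2 :: "real \<Rightarrow> L2 \<Rightarrow> L2" where
  "cut_L2 k f = abs_L2 (\<lambda>x. cut k (rep_L2 f x))"

lemma square_integrable_cut:
  assumes "k \<ge> 0"
  shows "square_integrable (\<lambda>x. cut k (rep_L2 f x))"
proof (rule square_integrable_bound)
  show "square_integrable (\<lambda>x. of_real (k ^ 4) * rep_L2 f x)"
    by (intro square_integrable_scale square_integrable_rep)
  show "AE x in lborel. cmod (cut k (rep_L2 f x)) \<le> cmod (of_real (k ^ 4) * rep_L2 f x)"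
    using norm_cut_le[OF assms] assms by (intro AE_I2) (simp add: norm_mult norm_power)
qed measurable

lemma cut_L2_Lipschitz:
  assumes "k \<ge> 0"
  shows "norm (cut_L2 k f - cut_L2 k g) \<le> 5 * k ^ 4 * norm (f - g)"
proof -
  have "f - g = abs_L2 (\<lambda>x. rep_L2 f x - rep_L2 g x)"
    using abs_L2_diff[of "rep_L2 f" "rep_L2 g"] by simp
  moreover have "cut_L2 k f - cut_L2 k g = abs_L2 (\<lambda>x. cut k (rep_L2 f x) - cut k (rep_L2 g x))"
    unfolding cut_L2_def by (intro abs_L2_diff square_integrable_cut assms)
  moreover have sq: "square_integrable (\<lambda>x. a x - b x)" if "square_integrable a" "square_integrable b" for a b
    using square_integrable_add[OF that(1) square_integrable_scale[OF that(2), of "-1"]] by simp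
  ultimately show ?thesis
    using assms
    by (auto intro!: norm_abs_L2_le sq square_integrable_cut cut_Lipschitz)
qed

lemma continuous_cut_L2:
  assumes "k \<ge> 0"
  shows "continuous_on A (cut_L2 k)"
  unfolding continuous_on_iff
proof (intro ballI allI impI)
  fix f and e :: real
  assume e: "e > 0"
  show "\<exists>d>0. \<forall>g\<in>A. dist g f < d \<longrightarrow> dist (cut_L2 k g) (cut_L2 k f) < e"
  \<comment> \<open>The summand 1 keeps the denominator positive for \<open>k = 0\<close>.\<close>
  proof (intro exI[of _ "e / (5 * k ^ 4 + 1)"] conjI ballI impI)
    show "e / (5 * k ^ 4 + 1) > 0"
      using e assms by (intro divide_pos_pos add_nonneg_pos) auto
    fix g
    assume "dist g f < e / (5 * k ^ 4 + 1)"
    then have "(5 * k ^ 4 + 1) * norm (g - f) < e"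
      using assms by (simp add: dist_norm pos_less_divide_eq add_nonneg_pos mult.commute)
    moreover have "5 * k ^ 4 * norm (g - f) \<le> (5 * k ^ 4 + 1) * norm (g - f)"
      by (intro mult_right_mono) auto
    ultimately show "dist (cut_L2 k g) (cut_L2 k f) < e"
      using cut_L2_Lipschitz[OF assms, of g f] by (simp add: dist_norm)
  qed
qed

lemma measurable_cut_L2 [measurable (raw)]:
  assumes "k \<ge> 0" "f \<in> borel_measurable M"
  shows "(\<lambda>x. cut_L2 k (f x)) \<in> borel_measurable M"
  using measurable_compose[OF assms(2) borel_measurable_continuous_onI[OF continuous_cut_L2[OF assms(1)]]] .

lemma norm_cut_L2_le:
  assumes "k \<ge> 0" "C \<ge> 0" "AE x in lborel. cmod (rep_L2 f x) \<le> C"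
  shows "norm (cut_L2 k f) \<le> C ^ 4 * norm f"
proof -
  have "norm (cut_L2 k f) \<le> C ^ 4 * norm (abs_L2 (rep_L2 f))"
    unfolding cut_L2_def
  proof (intro norm_abs_L2_le square_integrable_cut assms square_integrable_rep)
    show "AE x in lborel. cmod (cut k (rep_L2 f x)) \<le> C ^ 4 * cmod (rep_L2 f x)"
      using assms(3)
    proof eventually_elim
      case (elim x)
      then show ?case
        unfolding norm_cut[OF assms(1)] using assms(1) by (intro mult_right_mono power_mono) auto
    qed
  qed (use assms in auto)
  then show ?thesis by simp
qed

lemma rep_add: "AE x in lborel. rep_L2 (f + g) x = rep_L2 f x + rep_L2 g x"
proof -
  have "f + g = abs_L2 (\<lambda>x. rep_L2 f x + rep_L2 g x)"
    using plus_L2.abs_eq[OF L2_rel_rep[of f] L2_rel_rep[of g]] by simp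
  then show ?thesis
    using rep_abs_L2[OF square_integrable_add[OF square_integrable_rep square_integrable_rep]] by simp
qed

lemma rep_scaleC: "AE x in lborel. rep_L2 (c *\<^sub>C f) x = c * rep_L2 f x"
proof -
  have "c *\<^sub>C f = abs_L2 (\<lambda>x. c * rep_L2 f x)"
    using scaleC.abs_eq[OF L2_rel_rep[of f]] by simp
  then show ?thesis
    using rep_abs_L2[OF square_integrable_scale[OF square_integrable_rep]] by simp
qed

lemma rep_herm: "AE x in lborel. rep_L2 (herm n) x = of_real (hermite_fun n x)"
proof -
  have "AE x in lborel. rep_L2 (herm n) x = of_real (1 / hnorm n) * rep_L2 (pgauss_L2 (hermite n)) x"
    unfolding herm_def scaleR_eq_scaleC by (rule rep_scaleC)
  moreover have "AE x in lborel. rep_L2 (pgauss_L2 (hermite n)) x = of_real (pgauss (hermite n) x)"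
    unfolding pgauss_L2_def by (rule rep_abs_L2[OF square_integrable_pgauss])
  ultimately show ?thesis
    by eventually_elim (simp add: hermite_fun_def)
qed

lemma rep_sum_herm: "AE x in lborel. rep_L2 (\<Sum>n<N. a n *\<^sub>C herm n) x = (\<Sum>n<N. a n * of_real (hermite_fun n x))"
proof (induction N)
  case 0
  have "AE x in lborel. rep_L2 (0 *\<^sub>C 0) x = 0 * rep_L2 0 x"
    by (rule rep_scaleC)
  then show ?case by simp
next
  case (Suc N)
  show ?case
    using Suc rep_add[of "\<Sum>n<N. a n *\<^sub>C herm n" "a N *\<^sub>C herm N"] rep_scaleC[of "a N" "herm N"] rep_herm[of N]
    by eventually_elim simp
qed

section \<open>Abel means of Hermite expansions and the removal of the smoothing\<close>

definition smooth :: "real \<Rightarrow> L2 \<Rightarrow> L2" where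
  "smooth r = herm.diag (\<lambda>n. of_real (r ^ n))"

lemma power_le_1: "0 < r \<Longrightarrow> r < 1 \<Longrightarrow> cmod (of_real (r ^ n)) \<le> 1"
  by (simp add: norm_power power_le_one)

text \<open>
  \<open>smooth r g\<close> is the function \<open>y \<mapsto> \<langle>g, mehler_L2 r y\<rangle>\<close>; passing to the limit along Hermite expansions avoids
  identifying the representatives.
\<close>

lemma norm_cut_L2_smooth_le:
  assumes r: "0 < r" "r < 1" and k: "k \<ge> 0" and F: "\<And>y. cmod (cinner g (mehler_L2 r y)) \<le> F"
  shows "norm (cut_L2 k (smooth r g)) \<le> F ^ 4 * norm g"
proof -
  obtain B where B: "\<And>x. norm (mehler_L2 r x) \<le> B"
    using norm_mehler_L2_le[OF r] by blast
  have "B \<ge> 0" "F \<ge> 0"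
    using norm_ge_zero order_trans B F by blast+
  define S where "S N = (\<Sum>n<N. herm.coeff g n *\<^sub>C herm n)" for N
  have S: "S \<longlonglongrightarrow> g"
    using herm.expansion[of g] by (simp add: sums_def S_def[abs_def])
  note p = power_le_1[OF r]
  have "isCont (cut_L2 k) (smooth r g)"
    using continuous_cut_L2[OF k, of UNIV] by (simp add: continuous_on_eq_continuous_at)
  moreover have "(\<lambda>N. smooth r (S N)) \<longlonglongrightarrow> smooth r g"
  proof (rule LIM_zero_cancel, rule Lim_null_comparison)
    show "\<forall>\<^sub>F N in sequentially. norm (smooth r (S N) - smooth r g) \<le> norm (S N - g)"
      unfolding smooth_def herm.diag_diff[OF p, symmetric]
      using herm.norm_diag_le[where C = 1, OF p] by (intro always_eventually allI) simp
    show "(\<lambda>N. norm (S N - g)) \<longlonglongrightarrow> 0"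
      using S by (simp add: LIM_zero_iff tendsto_norm_zero_iff)
  qed
  ultimately have "(\<lambda>N. cut_L2 k (smooth r (S N))) \<longlonglongrightarrow> cut_L2 k (smooth r g)"
    by (rule isCont_tendsto_compose)
  then have "(\<lambda>N. norm (cut_L2 k (smooth r (S N)))) \<longlonglongrightarrow> norm (cut_L2 k (smooth r g))"
    by (rule tendsto_norm)
  moreover have "(\<lambda>N. (F + norm (S N - g) * B) ^ 4 * norm (S N)) \<longlonglongrightarrow> (F + norm (g - g) * B) ^ 4 * norm g"
    by (intro tendsto_intros S)
  then have "(\<lambda>N. (F + norm (S N - g) * B) ^ 4 * norm (S N)) \<longlonglongrightarrow> F ^ 4 * norm g"
    by simp
  moreover have "norm (cut_L2 k (smooth r (S N))) \<le> (F + norm (S N - g) * B) ^ 4 * norm (S N)" for N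
  proof -
    have eq: "smooth r (S N) = (\<Sum>n<N. (of_real (r ^ n) * herm.coeff g n) *\<^sub>C herm n)"
      by (rule herm.eqI) (simp add: smooth_def herm.coeff_diag[OF p] S_def herm.coeff_sum del: of_real_power)
    \<comment> \<open>Finite Hermite sums have explicit values almost everywhere, and these are
      pairings with \<open>mehler_L2 r y\<close>.\<close>
    have pt: "(\<Sum>n<N. (of_real (r ^ n) * herm.coeff g n) * of_real (hermite_fun n y)) = cinner (S N) (mehler_L2 r y)" for y
    proof -
      have "cinner (herm n) (mehler_L2 r y) = of_real (r ^ n * hermite_fun n y)" for n
        unfolding cinner_commute[of "herm n" "mehler_L2 r y"] using coeff_mehler_L2[OF r, of y n] by (simp add: herm.coeff_def)
      then show ?thesis
        by (simp add: S_def cinner.sum_left cinner_scaleC_left mult_ac)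
    qed
    \<comment> \<open>Replacing \<open>g\<close> by its partial sum costs an error bounded uniformly
      in \<open>y\<close> through \<open>B\<close>, which disappears as \<open>N\<close>
      grows.\<close>
    have bd: "cmod (cinner (S N) (mehler_L2 r y)) \<le> F + norm (S N - g) * B" for y
    proof -
      have "cinner (S N) (mehler_L2 r y) = cinner g (mehler_L2 r y) + cinner (S N - g) (mehler_L2 r y)"
        by (simp add: cinner.diff_left)
      then have "cmod (cinner (S N) (mehler_L2 r y)) \<le> cmod (cinner g (mehler_L2 r y)) + cmod (cinner (S N - g) (mehler_L2 r y))"
        by (simp only: norm_triangle_ineq)
      also have "\<dots> \<le> F + norm (S N - g) * B"
        by (intro add_mono F order_trans[OF norm_cinner_le] mult_left_mono B) auto
      finally show ?thesis .
    qed
    have "AE y in lborel. cmod (rep_L2 (smooth r (S N)) y) \<le> F + norm (S N - g) * B"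
      unfolding eq using rep_sum_herm[where N = N and a = "\<lambda>n. of_real (r ^ n) * herm.coeff g n"]
      by eventually_elim (simp only: pt bd)
    then have "norm (cut_L2 k (smooth r (S N))) \<le> (F + norm (S N - g) * B) ^ 4 * norm (smooth r (S N))"
      using \<open>B \<ge> 0\<close> \<open>F \<ge> 0\<close> by (intro norm_cut_L2_le k) auto
    also have "\<dots> \<le> (F + norm (S N - g) * B) ^ 4 * norm (S N)"
      using herm.norm_diag_le[where C = 1 and f = "S N", OF p] by (intro mult_left_mono) (auto simp: smooth_def)
    finally show ?thesis .
  qed
  ultimately show ?thesis
    by (intro LIMSEQ_le) auto
qed

text \<open>For fixed \<open>k\<close> the truncated nonlinearity is continuous, so Fatou's lemma
  along \<open>r\<close> tending to 1 carries over the Strichartz bound, whose constant is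
  independent of \<open>r\<close>. Four powers of the norm come from Strichartz, the fifth from the
  isometry of the flow.\<close>

lemma nn_integral_cut_L2_flow_le_short:
  assumes k: "k \<ge> 0" and ab: "b - a \<le> pi / 4"
  shows "(\<integral>\<^sup>+ t. ennreal (indicator {a..b} t * norm (cut_L2 k (flow t f))) \<partial>lborel) \<le> ennreal (784 * norm f ^ 5)"
proof -
  have [measurable]: "smooth r \<in> borel_measurable borel" if "0 < r" "r < 1" for r
  proof -
    have "((\<lambda>g. smooth r g) \<longlongrightarrow> smooth r f) (at f)" for f
    proof (rule LIM_zero_cancel, rule Lim_null_comparison)
      show "\<forall>\<^sub>F g in at f. norm (smooth r g - smooth r f) \<le> norm (g - f)"
        unfolding smooth_def herm.diag_diff[OF power_le_1[OF that], symmetric]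
        using herm.norm_diag_le[where C = 1, OF power_le_1[OF that]] by (intro always_eventually allI) simp
      show "((\<lambda>g. norm (g - f)) \<longlongrightarrow> 0) (at f)"
        by (intro tendsto_norm_zero LIM_zero tendsto_ident_at)
    qed
    then show ?thesis
      by (intro borel_measurable_continuous_onI) (simp add: continuous_on_def)
  qed
  define r :: "nat \<Rightarrow> real" where "r j = 1 - 1 / real (j + 2)" for j
  have r: "0 < r j" "r j < 1" for j
    by (simp_all add: r_def)
  have meas: "(\<lambda>t. ennreal (indicator {a..b} t * norm (cut_L2 k (smooth (r j) (flow t f))))) \<in> borel_measurable lborel" for j
    using r k by measurable
  have r_lim: "r \<longlonglongrightarrow> 1"
  proof -
    have "(\<lambda>j. 1 - 1 / real (j + 2)) \<longlonglongrightarrow> 1 - 0"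
      by (intro tendsto_diff tendsto_const LIMSEQ_ignore_initial_segment lim_1_over_n)
    then show ?thesis
      by (simp add: r_def[abs_def])
  qed
  have lim: "(\<lambda>j. cut_L2 k (smooth (r j) g)) \<longlonglongrightarrow> cut_L2 k g" for g
  proof -
    have one: "herm.diag (\<lambda>n. 1) g = g"
      by (rule herm.eqI) (simp add: herm.coeff_diag[where C = 1])
    have "(\<lambda>j. smooth (r j) g) \<longlonglongrightarrow> herm.diag (\<lambda>n. 1) g"
      unfolding smooth_def
    proof (rule herm.tendsto_diag)
      show "cmod (of_real (r j ^ n)) \<le> 1" for j n
        by (rule power_le_1[OF r])
      show "(\<lambda>j. complex_of_real (r j ^ n)) \<longlonglongrightarrow> 1" for n
        using tendsto_of_real[OF tendsto_power[OF r_lim, of n], where 'a = complex] by simp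
    qed simp
    then have "(\<lambda>j. smooth (r j) g) \<longlonglongrightarrow> g"
      by (simp only: one)
    moreover have "isCont (cut_L2 k) g"
      using continuous_cut_L2[OF k, of UNIV] by (simp add: continuous_on_eq_continuous_at)
    ultimately show ?thesis
      by (rule isCont_tendsto_compose[rotated])
  qed
  have bound: "(\<integral>\<^sup>+ t. ennreal (indicator {a..b} t * norm (cut_L2 k (smooth (r j) (flow t f)))) \<partial>lborel) \<le> ennreal (784 * norm f ^ 5)" for j
  proof -
    obtain F :: "real \<Rightarrow> real" where [measurable]: "F \<in> borel_measurable borel"
      and F: "\<And>t y. cmod (cinner (flow t f) (mehler_L2 (r j) y)) \<le> F t"
      and int_F: "\<And>a b. b - a \<le> pi / 4 \<Longrightarrow> (\<integral>\<^sup>+ t. ennreal (indicator {a..b} t * F t ^ 4) \<partial>lborel) \<le> ennreal (784 * norm f ^ 4)"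
      by (rule strichartz[OF r(1)[of j] r(2)[of j], where f = f]) (rule that; assumption)
    have "(\<integral>\<^sup>+ t. ennreal (indicator {a..b} t * norm (cut_L2 k (smooth (r j) (flow t f)))) \<partial>lborel)
        \<le> (\<integral>\<^sup>+ t. ennreal (norm f) * ennreal (indicator {a..b} t * F t ^ 4) \<partial>lborel)"
    proof (intro nn_integral_mono)
      fix t
      have "norm (cut_L2 k (smooth (r j) (flow t f))) \<le> F t ^ 4 * norm f"
        using norm_cut_L2_smooth_le[OF r k F] by simp
      then have "indicator {a..b} t * norm (cut_L2 k (smooth (r j) (flow t f))) \<le> norm f * (indicator {a..b} t * F t ^ 4)"
        by (auto simp: indicator_def mult.commute)
      then show "ennreal (indicator {a..b} t * norm (cut_L2 k (smooth (r j) (flow t f)))) \<le> ennreal (norm f) * ennreal (indicator {a..b} t * F t ^ 4)"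
        by (subst ennreal_mult[symmetric]) (auto intro: ennreal_leI)
    qed
    also have "\<dots> = ennreal (norm f) * (\<integral>\<^sup>+ t. ennreal (indicator {a..b} t * F t ^ 4) \<partial>lborel)"
      by (rule nn_integral_cmult) measurable
    also have "\<dots> \<le> ennreal (norm f) * ennreal (784 * norm f ^ 4)"
      by (intro mult_left_mono int_F ab) auto
    also have "\<dots> = ennreal (784 * norm f ^ 5)"
      by (subst ennreal_mult[symmetric]) (auto simp: eval_nat_numeral mult_ac)
    finally show ?thesis .
  qed
  have "(\<integral>\<^sup>+ t. ennreal (indicator {a..b} t * norm (cut_L2 k (flow t f))) \<partial>lborel)
      = (\<integral>\<^sup>+ t. liminf (\<lambda>j. ennreal (indicator {a..b} t * norm (cut_L2 k (smooth (r j) (flow t f))))) \<partial>lborel)"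
    by (intro nn_integral_cong lim_imp_Liminf[symmetric] tendsto_ennrealI tendsto_intros lim) simp
  also have "\<dots> \<le> liminf (\<lambda>j. \<integral>\<^sup>+ t. ennreal (indicator {a..b} t * norm (cut_L2 k (smooth (r j) (flow t f)))) \<partial>lborel)"
    by (rule nn_integral_liminf[OF meas])
  also have "\<dots> \<le> limsup (\<lambda>j. \<integral>\<^sup>+ t. ennreal (indicator {a..b} t * norm (cut_L2 k (smooth (r j) (flow t f)))) \<partial>lborel)"
    by (simp add: Liminf_le_Limsup)
  also have "\<dots> \<le> ennreal (784 * norm f ^ 5)"
    by (intro Limsup_bounded always_eventually allI bound)
  finally show ?thesis .
qed

abbreviation (input) period :: "real set" where
  "period \<equiv> {- pi / 4..pi / 4}"

text \<open>The interval is cut at 0 because the dispersive bound covers time differences up to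
  pi/4; the two halves double the constant.\<close>

lemma nn_integral_cut_L2_flow_le:
  assumes k: "k \<ge> 0"
  shows "(\<integral>\<^sup>+ t. ennreal (indicator period t * norm (cut_L2 k (flow t f))) \<partial>lborel) \<le> ennreal (1568 * norm f ^ 5)"
proof -
  let ?I = "\<lambda>a b. \<integral>\<^sup>+ t. ennreal (indicator {a..b} t * norm (cut_L2 k (flow t f))) \<partial>lborel"
  have "?I (- pi / 4) (pi / 4) \<le> (\<integral>\<^sup>+ t. ennreal (indicator {- pi / 4..0} t * norm (cut_L2 k (flow t f)))
      + ennreal (indicator {0..pi / 4} t * norm (cut_L2 k (flow t f))) \<partial>lborel)"
    by (intro nn_integral_mono) (auto simp: indicator_def)
  also have "\<dots> = ?I (- pi / 4) 0 + ?I 0 (pi / 4)"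
    by (rule nn_integral_add) (use k in measurable)
  also have "\<dots> \<le> ennreal (784 * norm f ^ 5) + ennreal (784 * norm f ^ 5)"
    by (intro add_mono nn_integral_cut_L2_flow_le_short k) auto
  also have "\<dots> = ennreal (1568 * norm f ^ 5)"
    by (simp flip: ennreal_plus)
  finally show ?thesis .
qed

section \<open>Removal of the truncation\<close>

definition quintic_L2 :: "L2 \<Rightarrow> L2" where
  "quintic_L2 f = L2_of (quintic (rep_L2 f))"

text \<open>Square integrability of the nonlinearity, encoded with natural numbers: countably many
  conditions on continuous maps make it a Borel predicate.\<close>

definition regular :: "L2 \<Rightarrow> bool" where
  "regular f \<longleftrightarrow> (\<exists>C::nat. \<forall>k::nat. norm (cut_L2 (real k) f) \<le> real C)"

lemma measurable_quintic [measurable]: "quintic (rep_L2 f) \<in> borel_measurable borel"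
  unfolding quintic_def using measurable_rep_L2[of f] by simp

lemma cut_eventually_eq: "\<forall>\<^sub>F k in sequentially. cut (real k) z = of_real (cmod z ^ 4) * z"
proof -
  obtain N :: nat where N: "cmod z \<le> real N"
    using real_arch_simple by blast
  show ?thesis
    using eventually_ge_at_top[of N]
    by eventually_elim (use N in \<open>simp add: cut_def min_def\<close>)
qed

lemma tendsto_cut: "(\<lambda>k. cut (real k) (rep_L2 f x)) \<longlonglongrightarrow> quintic (rep_L2 f) x"
  using cut_eventually_eq[of "rep_L2 f x"] unfolding quintic_def by (rule tendsto_eventually)

lemma norm_cut_le_quintic: "cmod (cut (real k) (f x)) \<le> cmod (quintic f x)"
  by (simp add: norm_cut quintic_def norm_mult norm_power mult_right_mono power_mono)

text \<open>Fatou turns a uniform bound on the truncations into a finite integral; conversely every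
  truncation is dominated by the quintic power.\<close>

lemma regular_iff: "regular f \<longleftrightarrow> square_integrable (quintic (rep_L2 f))"
proof
  assume "regular f"
  then obtain C :: nat where C: "\<And>k::nat. norm (cut_L2 (real k) f) \<le> real C"
    by (auto simp: regular_def)
  have "(\<integral>\<^sup>+ x. ennreal ((cmod (quintic (rep_L2 f) x))\<^sup>2) \<partial>lborel)
      = (\<integral>\<^sup>+ x. liminf (\<lambda>k. ennreal ((cmod (cut (real k) (rep_L2 f x)))\<^sup>2)) \<partial>lborel)"
    by (intro nn_integral_cong lim_imp_Liminf[symmetric] tendsto_ennrealI tendsto_intros tendsto_cut) simp
  also have "\<dots> \<le> liminf (\<lambda>k. \<integral>\<^sup>+ x. ennreal ((cmod (cut (real k) (rep_L2 f x)))\<^sup>2) \<partial>lborel)"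
    by (rule nn_integral_liminf) measurable
  also have "\<dots> \<le> limsup (\<lambda>k. \<integral>\<^sup>+ x. ennreal ((cmod (cut (real k) (rep_L2 f x)))\<^sup>2) \<partial>lborel)"
    by (simp add: Liminf_le_Limsup)
  also have "\<dots> \<le> ennreal ((real C)\<^sup>2)"
  proof (intro Limsup_bounded always_eventually allI)
    fix k :: nat
    have "(\<integral>\<^sup>+ x. ennreal ((cmod (cut (real k) (rep_L2 f x)))\<^sup>2) \<partial>lborel) = ennreal ((norm (cut_L2 (real k) f))\<^sup>2)"
      using square_integrable_cut[of "real k" f]
      by (simp add: cut_L2_def norm_abs_L2 nn_integral_eq_integral square_integrable_def integral_nonneg_AE)
    also have "\<dots> \<le> ennreal ((real C)\<^sup>2)"
      by (intro ennreal_leI power_mono C) auto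
    finally show "(\<integral>\<^sup>+ x. ennreal ((cmod (cut (real k) (rep_L2 f x)))\<^sup>2) \<partial>lborel) \<le> ennreal ((real C)\<^sup>2)" .
  qed
  also have "\<dots> < \<infinity>"
    by simp
  finally show "square_integrable (quintic (rep_L2 f))"
    unfolding square_integrable_def by (intro conjI integrableI_bounded) auto
next
  assume sq: "square_integrable (quintic (rep_L2 f))"
  obtain C :: nat where C: "norm (abs_L2 (quintic (rep_L2 f))) \<le> real C"
    using real_arch_simple by blast
  have "norm (cut_L2 (real k) f) \<le> 1 * norm (abs_L2 (quintic (rep_L2 f)))" for k :: nat
    unfolding cut_L2_def
    by (intro norm_abs_L2_le square_integrable_cut sq AE_I2) (simp_all add: norm_cut_le_quintic)
  then show "regular f"
    unfolding regular_def using C by (intro exI[of _ C]) (auto intro: order_trans)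
qed

lemma tendsto_cut_L2_quintic_L2:
  assumes "regular f"
  shows "(\<lambda>k. cut_L2 (real k) f) \<longlonglongrightarrow> quintic_L2 f"
proof -
  have sq: "square_integrable (quintic (rep_L2 f))"
    using assms by (simp add: regular_iff)
  then have "quintic_L2 f = abs_L2 (quintic (rep_L2 f))"
    by (simp add: quintic_L2_def L2_of_eq)
  then show ?thesis
    unfolding cut_L2_def
    by (simp, intro tendsto_abs_L2[OF _ _ sq] AE_I2 tendsto_cut norm_cut_le_quintic) measurable
qed

lemma measurable_regular [measurable]: "Measurable.pred borel regular"
  unfolding regular_def by measurable

text \<open>On regular elements the truncations converge; elsewhere the value 0 of the approximants
  agrees with the default 0 of \<open>L2_of\<close>.\<close>

lemma measurable_quintic_L2 [measurable]: "quintic_L2 \<in> borel_measurable borel"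
proof (rule borel_measurable_LIMSEQ_metric)
  show "(\<lambda>f. if regular f then cut_L2 (real k) f else 0) \<in> borel_measurable borel" for k
    by measurable
  fix f
  show "(\<lambda>k. if regular f then cut_L2 (real k) f else 0) \<longlonglongrightarrow> quintic_L2 f"
    using tendsto_cut_L2_quintic_L2[of f] by (auto simp: regular_iff quintic_L2_def L2_of_def)
qed

lemma norm_cut_L2_mono:
  assumes "j \<le> k"
  shows "norm (cut_L2 (real j) f) \<le> norm (cut_L2 (real k) f)"
proof -
  have "norm (cut_L2 (real j) f) \<le> 1 * norm (cut_L2 (real k) f)"
    unfolding cut_L2_def
    by (intro norm_abs_L2_le square_integrable_cut AE_I2)
       (use assms in \<open>auto simp: norm_cut intro!: mult_right_mono power_mono\<close>)
  then show ?thesis by simp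
qed

lemma regular_if_SUP:
  assumes "(SUP k::nat. ennreal (norm (cut_L2 (real k) f))) \<noteq> \<infinity>"
  shows "regular f"
proof -
  obtain C where C: "C \<ge> 0" "(SUP k::nat. ennreal (norm (cut_L2 (real k) f))) = ennreal C"
    using assms by (cases "SUP k::nat. ennreal (norm (cut_L2 (real k) f))") auto
  have "norm (cut_L2 (real k) f) \<le> C" for k :: nat
  proof -
    have "ennreal (norm (cut_L2 (real k) f)) \<le> ennreal C"
      unfolding C(2)[symmetric] by (rule SUP_upper) simp
    then show ?thesis
      using C(1) by (simp add: ennreal_le_iff)
  qed
  moreover obtain N :: nat where "C \<le> real N"
    using real_arch_simple by blast
  ultimately show ?thesis
    unfolding regular_def by (meson order_trans)
qed

text \<open>The truncated norms increase with \<open>k\<close> and their integrals have a bound free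
  of \<open>k\<close>, so monotone convergence puts the supremum inside the integral.\<close>

lemma nn_integral_SUP_cut_L2_le:
  "(\<integral>\<^sup>+ t. (SUP k::nat. ennreal (indicator period t * norm (cut_L2 (real k) (flow t f)))) \<partial>lborel) \<le> ennreal (1568 * norm f ^ 5)"
proof -
  have "(\<integral>\<^sup>+ t. (SUP k::nat. ennreal (indicator period t * norm (cut_L2 (real k) (flow t f)))) \<partial>lborel)
      = (SUP k::nat. \<integral>\<^sup>+ t. ennreal (indicator period t * norm (cut_L2 (real k) (flow t f))) \<partial>lborel)"
  proof (rule nn_integral_monotone_convergence_SUP)
    show "incseq (\<lambda>(k::nat) t. ennreal (indicator period t * norm (cut_L2 (real k) (flow t f))))"
      by (auto simp: incseq_def le_fun_def intro!: ennreal_leI mult_left_mono norm_cut_L2_mono)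
    show "(\<lambda>t. ennreal (indicator period t * norm (cut_L2 (real k) (flow t f)))) \<in> borel_measurable lborel" for k
      by measurable
  qed
  also have "\<dots> \<le> ennreal (1568 * norm f ^ 5)"
    by (intro SUP_least nn_integral_cut_L2_flow_le) simp
  finally show ?thesis .
qed

text \<open>A finite integral of the supremum forces a finite supremum almost everywhere, which is a
  uniform bound on the truncations.\<close>

lemma AE_regular: "AE t in lborel. t \<in> period \<longrightarrow> regular (flow t f)"
proof -
  have "AE t in lborel. (SUP k::nat. ennreal (indicator period t * norm (cut_L2 (real k) (flow t f)))) \<noteq> \<infinity>"
  proof (rule nn_integral_PInf_AE)
    have [measurable]: "(\<lambda>t. ennreal (indicator period t * norm (cut_L2 (real k) (flow t f)))) \<in> borel_measurable lborel" for k
      by measurable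
    show "(\<lambda>t. SUP k::nat. ennreal (indicator period t * norm (cut_L2 (real k) (flow t f)))) \<in> borel_measurable lborel"
      by measurable
    show "(\<integral>\<^sup>+ t. (SUP k::nat. ennreal (indicator period t * norm (cut_L2 (real k) (flow t f)))) \<partial>lborel) \<noteq> \<infinity>"
      using nn_integral_SUP_cut_L2_le[of f] by (metis ennreal_less_top infinity_ennreal_def leD)
  qed
  then show ?thesis
  proof eventually_elim
    case (elim t)
    show ?case
      by (intro impI regular_if_SUP) (use elim in simp)
  qed
qed

lemma nn_integral_quintic_L2_le:
  "(\<integral>\<^sup>+ t. ennreal (indicator period t * norm (quintic_L2 (flow t f))) \<partial>lborel) \<le> ennreal (1568 * norm f ^ 5)"
proof (rule order_trans[OF nn_integral_mono_AE nn_integral_SUP_cut_L2_le])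
  show "AE t in lborel. ennreal (indicator period t * norm (quintic_L2 (flow t f)))
      \<le> (SUP k::nat. ennreal (indicator period t * norm (cut_L2 (real k) (flow t f))))"
    using AE_regular[of f]
  proof eventually_elim
    case (elim t)
    show ?case
    proof (cases "t \<in> period")
      case True
      then have "(\<lambda>k. ennreal (indicator period t * norm (cut_L2 (real k) (flow t f)))) \<longlonglongrightarrow> ennreal (indicator period t * norm (quintic_L2 (flow t f)))"
        using elim by (intro tendsto_ennrealI tendsto_intros tendsto_cut_L2_quintic_L2) auto
      then show ?thesis
        by (rule LIMSEQ_le_const2) (auto intro!: SUP_upper)
    qed simp
  qed
qed

section \<open>The sextic integral and integrability in time\<close>

definition sextic_integral :: "L2 \<Rightarrow> real" where
  "sextic_integral f = (LINT x|lborel. cmod (rep_L2 f x) ^ 6)"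

lemma Re_cinner_cut_L2: "k \<ge> 0 \<Longrightarrow> Re (cinner (cut_L2 k f) f) = (LINT x|lborel. min (cmod (rep_L2 f x)) k ^ 4 * (cmod (rep_L2 f x))\<^sup>2)"
  and integrable_sextic_cut: "k \<ge> 0 \<Longrightarrow> integrable lborel (\<lambda>x. min (cmod (rep_L2 f x)) k ^ 4 * (cmod (rep_L2 f x))\<^sup>2)"
proof -
  assume k: "k \<ge> 0"
  have eq: "cut k z * cnj z = of_real (min (cmod z) k ^ 4 * (cmod z)\<^sup>2)" for z
    by (simp add: cut_def complex_norm_square mult.assoc del: of_real_power)
  have "integrable lborel (\<lambda>x. cut k (rep_L2 f x) * cnj (rep_L2 f x))"
    by (intro integrable_mult_cnj square_integrable_cut square_integrable_rep k)
  then show "integrable lborel (\<lambda>x. min (cmod (rep_L2 f x)) k ^ 4 * (cmod (rep_L2 f x))\<^sup>2)"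
    by (simp only: eq complex_of_real_integrable_eq)
  have "cinner (cut_L2 k f) (abs_L2 (rep_L2 f)) = (LINT x|lborel. cut k (rep_L2 f x) * cnj (rep_L2 f x))"
    unfolding cut_L2_def by (intro cinner_abs_L2 square_integrable_cut square_integrable_rep k)
  then show "Re (cinner (cut_L2 k f) f) = (LINT x|lborel. min (cmod (rep_L2 f x)) k ^ 4 * (cmod (rep_L2 f x))\<^sup>2)"
    by (simp only: eq integral_complex_of_real abs_rep_L2 Re_complex_of_real)
qed

text \<open>Pairing the truncations with \<open>f\<close> gives continuous functions of
  \<open>f\<close> that increase with \<open>k\<close> to the sextic integral. Where they are
  unbounded the integrand is not integrable, and both the approximants and the Bochner integral are
  0.\<close>

lemma measurable_sextic_integral [measurable]: "sextic_integral \<in> borel_measurable borel"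
proof (rule borel_measurable_LIMSEQ_real)
  define bd where "bd f \<longleftrightarrow> (\<exists>C::nat. \<forall>k::nat. Re (cinner (cut_L2 (real k) f) f) \<le> real C)" for f
  have [measurable]: "(\<lambda>f. cinner (cut_L2 (real k) f) f) \<in> borel_measurable borel" for k
    by measurable
  have [measurable]: "Measurable.pred borel bd"
    unfolding bd_def by measurable
  show "(\<lambda>f. if bd f then Re (cinner (cut_L2 (real k) f) f) else 0) \<in> borel_measurable borel" for k
    by measurable
  fix f
  let ?s = "\<lambda>(k::nat) x. min (cmod (rep_L2 f x)) (real k) ^ 4 * (cmod (rep_L2 f x))\<^sup>2"
  have s_eq: "Re (cinner (cut_L2 (real k) f) f) = (LINT x|lborel. ?s k x)" for k
    by (rule Re_cinner_cut_L2) simp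
  have s_int: "integrable lborel (?s k)" for k
    by (rule integrable_sextic_cut) simp
  have s_mono: "?s j x \<le> ?s k x" if "j \<le> k" for j k x
    using that by (intro mult_right_mono power_mono) auto
  have s_le: "?s k x \<le> cmod (rep_L2 f x) ^ 6" for k x
  proof -
    have "?s k x \<le> cmod (rep_L2 f x) ^ 4 * (cmod (rep_L2 f x))\<^sup>2"
      by (intro mult_right_mono power_mono) auto
    then show ?thesis
      by (simp flip: power_add)
  qed
  have s_lim: "(\<lambda>k. ?s k x) \<longlonglongrightarrow> cmod (rep_L2 f x) ^ 6" for x
  proof -
    obtain N :: nat where N: "cmod (rep_L2 f x) \<le> real N"
      using real_arch_simple by blast
    have "\<forall>\<^sub>F k in sequentially. ?s k x = cmod (rep_L2 f x) ^ 6"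
      using eventually_ge_at_top[of N]
      by eventually_elim (use N in \<open>simp add: min_def flip: power_add\<close>)
    then show ?thesis
      by (rule tendsto_eventually)
  qed
  show "(\<lambda>k. if bd f then Re (cinner (cut_L2 (real k) f) f) else 0) \<longlonglongrightarrow> sextic_integral f"
  proof (cases "bd f")
    case True
    have inc: "incseq (\<lambda>k. LINT x|lborel. ?s k x)"
      unfolding incseq_def by (auto intro!: integral_mono s_int s_mono simp del: of_nat_le_iff)
    obtain C where "\<And>k. (LINT x|lborel. ?s k x) \<le> C"
      using True unfolding bd_def s_eq by blast
    then obtain L where L: "(\<lambda>k. LINT x|lborel. ?s k x) \<longlonglongrightarrow> L"
      using incseq_convergent[OF inc] by blast
    have "(LINT x|lborel. cmod (rep_L2 f x) ^ 6) = L"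
      by (rule integral_monotone_convergence[OF s_int _ _ L])
         (auto intro!: AE_I2 monoI s_mono s_lim)
    with L True show ?thesis
      by (simp add: s_eq sextic_integral_def)
  next
    case False
    have "\<not> integrable lborel (\<lambda>x. cmod (rep_L2 f x) ^ 6)"
    proof
      assume int: "integrable lborel (\<lambda>x. cmod (rep_L2 f x) ^ 6)"
      obtain C :: nat where C: "(LINT x|lborel. cmod (rep_L2 f x) ^ 6) \<le> real C"
        using real_arch_simple by blast
      have "(LINT x|lborel. ?s k x) \<le> (LINT x|lborel. cmod (rep_L2 f x) ^ 6)" for k
        by (intro integral_mono s_int int s_le)
      with C have "bd f"
        unfolding bd_def s_eq by (meson order_trans)
      with False show False by simp
    qed
    with False show ?thesis
      by (simp add: sextic_integral_def not_integrable_integral_eq)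
  qed
qed

lemma regular_cinner_quintic_L2:
  assumes "regular f"
  shows "integrable lborel (\<lambda>x. quintic (rep_L2 f) x * cnj (rep_L2 g x))"
    and "cinner (quintic_L2 f) g = (LINT x|lborel. quintic (rep_L2 f) x * cnj (rep_L2 g x))"
proof -
  have sq: "square_integrable (quintic (rep_L2 f))"
    using assms by (simp add: regular_iff)
  then show "integrable lborel (\<lambda>x. quintic (rep_L2 f) x * cnj (rep_L2 g x))"
    by (intro integrable_mult_cnj square_integrable_rep)
  show "cinner (quintic_L2 f) g = (LINT x|lborel. quintic (rep_L2 f) x * cnj (rep_L2 g x))"
    using cinner_abs_L2[OF sq square_integrable_rep, of g] by (simp add: quintic_L2_def L2_of_eq sq)
qed

text \<open>The sixth power is the quintic nonlinearity paired with \<open>f\<close> itself, so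
  Cauchy-Schwarz applies.\<close>

lemma regular_sextic:
  assumes "regular f"
  shows "integrable lborel (\<lambda>x. cmod (rep_L2 f x) ^ 6)"
    and "sextic_integral f \<le> norm (quintic_L2 f) * norm f" and "sextic_integral f \<ge> 0"
proof -
  have eq: "quintic (rep_L2 f) x * cnj (rep_L2 f x) = of_real (cmod (rep_L2 f x) ^ 6)" for x
  proof -
    have "quintic (rep_L2 f) x * cnj (rep_L2 f x) = of_real (cmod (rep_L2 f x) ^ 4) * of_real ((cmod (rep_L2 f x))\<^sup>2)"
      unfolding complex_norm_square by (simp add: quintic_def mult.assoc)
    then show ?thesis
      by (simp flip: power_add of_real_mult of_real_power)
  qed
  show "integrable lborel (\<lambda>x. cmod (rep_L2 f x) ^ 6)"
    using regular_cinner_quintic_L2(1)[OF assms, of f] by (simp only: eq complex_of_real_integrable_eq)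
  have "cinner (quintic_L2 f) f = of_real (sextic_integral f)"
    using regular_cinner_quintic_L2(2)[OF assms, of f] by (simp only: eq integral_complex_of_real sextic_integral_def)
  then show "sextic_integral f \<le> norm (quintic_L2 f) * norm f"
    using norm_cinner_le[of "quintic_L2 f" f] by simp
  show "sextic_integral f \<ge> 0"
    by (simp add: sextic_integral_def)
qed

text \<open>The outer propagator is isometric, so the norm of the integrand is that of the
  nonlinearity.\<close>

lemma set_integrable_resonant: "set_integrable lborel period (resonant_integrand f)"
proof -
  have eq: "resonant_integrand f s = flow (- s) (quintic_L2 (flow s f))" for s
    by (simp add: resonant_integrand_def propagator_eq_flow quintic_L2_def)
  show ?thesis
    unfolding set_integrable_def eq
  proof (rule integrableI_bounded)
    show "(\<lambda>s. indicat_real period s *\<^sub>R flow (- s) (quintic_L2 (flow s f))) \<in> borel_measurable lborel"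
      by measurable
    have "(\<integral>\<^sup>+ s. ennreal (norm (indicat_real period s *\<^sub>R flow (- s) (quintic_L2 (flow s f)))) \<partial>lborel) \<le> ennreal (1568 * norm f ^ 5)"
      using nn_integral_quintic_L2_le[of f] by simp
    then show "(\<integral>\<^sup>+ s. ennreal (norm (indicat_real period s *\<^sub>R flow (- s) (quintic_L2 (flow s f)))) \<partial>lborel) < \<infinity>"
      by (rule order.strict_trans1) simp
  qed
qed

lemma set_integrable_sextic: "set_integrable lborel period (\<lambda>t. sextic_integral (flow t f))"
  unfolding set_integrable_def
proof (rule Bochner_Integration.integrable_bound)
  show "integrable lborel (\<lambda>s. norm (indicat_real period s *\<^sub>R resonant_integrand f s) * norm f)"
    using set_integrable_resonant[of f] by (intro integrable_mult_left integrable_norm) (simp add: set_integrable_def)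
  show "AE t in lborel. norm (indicat_real period t *\<^sub>R sextic_integral (flow t f))
      \<le> norm (norm (indicat_real period t *\<^sub>R resonant_integrand f t) * norm f)"
    using AE_regular[of f]
  proof eventually_elim
    case (elim t)
    then show ?case
      using regular_sextic(2,3)[of "flow t f"]
      by (auto simp: indicator_def resonant_integrand_def propagator_eq_flow quintic_L2_def)
  qed
qed measurable

section \<open>The symplectic gradient\<close>

lemma norm_add_sq: "(cmod (u + of_real \<epsilon> * w))\<^sup>2 = (cmod u)\<^sup>2 + \<epsilon> * (2 * Re (u * cnj w)) + \<epsilon>\<^sup>2 * (cmod w)\<^sup>2"
  unfolding cmod_power2 by (simp add: power2_eq_square algebra_simps)

text \<open>The sixth power is the cube of \<open>A + d\<close>, with \<open>A\<close> the squared
  modulus of \<open>u\<close> and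
  \<open>\<bar>d\<bar> \<le> 3 * (\<bar>\<epsilon>\<bar> * M)\<close>. The remainder consists of
  \<open>3 A^2 \<epsilon>^2 W\<close>, \<open>3 A d^2\<close> and \<open>d^3\<close>, bounded by 3,
  27 and 27 times \<open>\<epsilon>^2 * M ^ 3\<close>, in total 57.\<close>

lemma sextic_taylor:
  assumes "\<bar>\<epsilon>\<bar> \<le> 1"
  shows "\<bar>cmod (u + of_real \<epsilon> * w) ^ 6 - cmod u ^ 6 - \<epsilon> * (6 * (cmod u ^ 4 * Re (u * cnj w)))\<bar>
    \<le> 57 * \<epsilon>\<^sup>2 * (cmod u ^ 6 + cmod w ^ 6)"
proof -
  define A where "A = (cmod u)\<^sup>2"
  define W where "W = (cmod w)\<^sup>2"
  define b where "b = 2 * Re (u * cnj w)"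
  define M where "M = (max (cmod u) (cmod w))\<^sup>2"
  define d where "d = \<epsilon> * b + \<epsilon>\<^sup>2 * W"
  have six: "x ^ 6 = (x\<^sup>2) ^ 3" for x :: real
    by (simp flip: power_mult)
  have M: "0 \<le> A" "A \<le> M" "0 \<le> W" "W \<le> M"
    by (auto simp: A_def W_def M_def intro!: power_mono)
  have "\<bar>Re (u * cnj w)\<bar> \<le> cmod u * cmod w"
    using abs_Re_le_cmod[of "u * cnj w"] by (simp add: norm_mult)
  also have "\<dots> \<le> M"
    unfolding M_def power2_eq_square by (intro mult_mono) (auto simp: le_max_iff_disj)
  finally have b: "\<bar>b\<bar> \<le> 2 * M"
    by (simp add: b_def)
  have "\<epsilon>\<^sup>2 \<le> \<bar>\<epsilon>\<bar>"
    using mult_left_le[OF assms abs_ge_zero[of \<epsilon>]] by (simp add: power2_eq_square)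
  then have "\<bar>d\<bar> \<le> \<bar>\<epsilon>\<bar> * (2 * M) + \<bar>\<epsilon>\<bar> * M"
    unfolding d_def using b M
    by (intro order_trans[OF abs_triangle_ineq] add_mono) (auto simp: abs_mult intro!: mult_mono)
  then have d: "\<bar>d\<bar> \<le> 3 * (\<bar>\<epsilon>\<bar> * M)"
    by (simp add: mult.commute)
  have "M \<ge> 0"
    by (simp add: M_def)
  have d2: "\<bar>d\<bar>\<^sup>2 \<le> 9 * (\<epsilon>\<^sup>2 * M\<^sup>2)"
    using power_mono[OF d, of 2] by (simp add: power_mult_distrib)
  have "\<bar>d\<bar> \<le> 3 * M"
    using d mult_right_mono[OF assms \<open>M \<ge> 0\<close>] by simp
  then have d3: "\<bar>d\<bar>\<^sup>2 * \<bar>d\<bar> \<le> (9 * (\<epsilon>\<^sup>2 * M\<^sup>2)) * (3 * M)"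
    using d2 by (intro mult_mono) auto
  have "A\<^sup>2 * W \<le> M\<^sup>2 * M"
    using M by (intro mult_mono power_mono) auto
  from mult_left_mono[OF this, of "3 * \<epsilon>\<^sup>2"]
  have t1: "3 * A\<^sup>2 * \<epsilon>\<^sup>2 * W \<le> 3 * M\<^sup>2 * \<epsilon>\<^sup>2 * M"
    by (simp add: mult_ac)
  have t2: "3 * A * \<bar>d\<bar>\<^sup>2 \<le> 3 * M * (9 * (\<epsilon>\<^sup>2 * M\<^sup>2))"
    using M d2 by (intro mult_mono) auto
  have "\<bar>(A + d) ^ 3 - A ^ 3 - \<epsilon> * (3 * A\<^sup>2 * b)\<bar> = \<bar>3 * A\<^sup>2 * \<epsilon>\<^sup>2 * W + (3 * A * d\<^sup>2 + d\<^sup>2 * d)\<bar>"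
    by (rule arg_cong[of _ _ abs]) (simp add: d_def eval_nat_numeral algebra_simps)
  also have "\<dots> \<le> \<bar>3 * A\<^sup>2 * \<epsilon>\<^sup>2 * W\<bar> + (\<bar>3 * A * d\<^sup>2\<bar> + \<bar>d\<^sup>2 * d\<bar>)"
    by (intro order_trans[OF abs_triangle_ineq] add_mono order_refl abs_triangle_ineq)
  also have "\<dots> = 3 * A\<^sup>2 * \<epsilon>\<^sup>2 * W + (3 * A * \<bar>d\<bar>\<^sup>2 + \<bar>d\<bar>\<^sup>2 * \<bar>d\<bar>)"
    using M by (simp add: abs_mult)
  also have "\<dots> \<le> 3 * M\<^sup>2 * \<epsilon>\<^sup>2 * M + (3 * M * (9 * (\<epsilon>\<^sup>2 * M\<^sup>2)) + (9 * (\<epsilon>\<^sup>2 * M\<^sup>2)) * (3 * M))"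
    by (intro add_mono t1 t2 d3)
  also have "\<dots> = 57 * \<epsilon>\<^sup>2 * M ^ 3"
    by (simp add: eval_nat_numeral)
  also have "M ^ 3 \<le> cmod u ^ 6 + cmod w ^ 6"
    unfolding M_def six[symmetric] by (auto simp: max_def)
  finally have "\<bar>(A + d) ^ 3 - A ^ 3 - \<epsilon> * (3 * A\<^sup>2 * b)\<bar> \<le> 57 * \<epsilon>\<^sup>2 * (cmod u ^ 6 + cmod w ^ 6)"
    by (simp add: mult_left_mono)
  moreover have "(A + d) ^ 3 = cmod (u + of_real \<epsilon> * w) ^ 6"
    unfolding six norm_add_sq by (simp add: A_def d_def b_def W_def add.assoc)
  moreover have "A ^ 3 = cmod u ^ 6"
    unfolding A_def six ..
  moreover have "3 * A\<^sup>2 * b = 6 * (cmod u ^ 4 * Re (u * cnj w))"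
    by (simp add: A_def b_def flip: power_mult)
  ultimately show ?thesis
    by simp
qed

text \<open>Measuring the remainder by sextic integrals themselves lets the integration in time
  bound it by the Hamiltonian.\<close>

lemma sextic_integral_taylor:
  assumes reg: "regular u" "regular w" "regular (u + \<epsilon> *\<^sub>R w)" and \<epsilon>: "\<bar>\<epsilon>\<bar> \<le> 1"
  shows "\<bar>sextic_integral (u + \<epsilon> *\<^sub>R w) - sextic_integral u - \<epsilon> * (6 * Re (cinner (quintic_L2 u) w))\<bar>
    \<le> 57 * \<epsilon>\<^sup>2 * (sextic_integral u + sextic_integral w)"
proof -
  let ?v = "u + \<epsilon> *\<^sub>R w"
  let ?D = "\<lambda>x. cmod (rep_L2 u x) ^ 4 * Re (rep_L2 u x * cnj (rep_L2 w x))"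
  note int = regular_sextic(1)[OF reg(1)] regular_sextic(1)[OF reg(2)] regular_sextic(1)[OF reg(3)]
  have D_eq: "Re (quintic (rep_L2 u) x * cnj (rep_L2 w x)) = ?D x" for x
    unfolding quintic_def mult.assoc by (simp del: of_real_power)
  have D_int: "integrable lborel ?D"
    using integrable_Re[OF regular_cinner_quintic_L2(1)[OF reg(1), of w]] unfolding D_eq .
  have D: "Re (cinner (quintic_L2 u) w) = (LINT x|lborel. ?D x)"
    using integral_Re[OF regular_cinner_quintic_L2(1)[OF reg(1), of w]]
    unfolding regular_cinner_quintic_L2(2)[OF reg(1)] D_eq by (rule sym)
  have rep: "AE x in lborel. rep_L2 ?v x = rep_L2 u x + of_real \<epsilon> * rep_L2 w x"
    using rep_add[of u "\<epsilon> *\<^sub>R w"] rep_scaleC[of "of_real \<epsilon>" w]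
    by eventually_elim (simp add: scaleR_eq_scaleC)
  let ?E = "\<lambda>x. cmod (rep_L2 ?v x) ^ 6 - cmod (rep_L2 u x) ^ 6 - \<epsilon> * (6 * ?D x)"
  have E_int: "integrable lborel ?E"
    by (intro Bochner_Integration.integrable_diff int integrable_mult_right D_int)
  have eq: "sextic_integral ?v - sextic_integral u - \<epsilon> * (6 * Re (cinner (quintic_L2 u) w)) = (LINT x|lborel. ?E x)"
    using int D_int by (simp add: sextic_integral_def D)
  have "\<bar>LINT x|lborel. ?E x\<bar> \<le> (LINT x|lborel. \<bar>?E x\<bar>)"
    by (rule integral_abs_bound)
  also have "\<dots> \<le> (LINT x|lborel. 57 * \<epsilon>\<^sup>2 * (cmod (rep_L2 u x) ^ 6 + cmod (rep_L2 w x) ^ 6))"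
  proof (rule integral_mono_AE)
    show "AE x in lborel. \<bar>?E x\<bar> \<le> 57 * \<epsilon>\<^sup>2 * (cmod (rep_L2 u x) ^ 6 + cmod (rep_L2 w x) ^ 6)"
      using rep by eventually_elim (simp only: sextic_taylor[OF \<epsilon>])
  qed (use E_int int in auto)
  also have "\<dots> = 57 * \<epsilon>\<^sup>2 * (sextic_integral u + sextic_integral w)"
    using int by (simp add: sextic_integral_def)
  finally show ?thesis
    unfolding eq .
qed

section \<open>The derivative of the Hamiltonian\<close>

definition resonant :: "L2 \<Rightarrow> L2" where
  "resonant f = (LINT s:period|lborel. resonant_integrand f s)"

text \<open>Pairing with a fixed \<open>g\<close> is bounded and linear, so it commutes with the
  Bochner integral; the adjoint of \<open>flow (- s)\<close> is \<open>flow s\<close>.\<close>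

lemma cinner_resonant:
  shows "set_integrable lborel period (\<lambda>s. cinner (quintic_L2 (flow s f)) (flow s g))"
    and "cinner (resonant f) g = (LINT s:period|lborel. cinner (quintic_L2 (flow s f)) (flow s g))"
proof -
  have eq: "cinner (indicat_real period s *\<^sub>R resonant_integrand f s) g
      = indicat_real period s *\<^sub>R cinner (quintic_L2 (flow s f)) (flow s g)" for s
    using cinner_flow[of "- s" "quintic_L2 (flow s f)" g]
    by (simp add: resonant_integrand_def propagator_eq_flow quintic_L2_def cinner.scaleR_left)
  have int: "integrable lborel (\<lambda>s. indicat_real period s *\<^sub>R resonant_integrand f s)"
    using set_integrable_resonant[of f] by (simp add: set_integrable_def)
  show "set_integrable lborel period (\<lambda>s. cinner (quintic_L2 (flow s f)) (flow s g))"
    unfolding set_integrable_def eq[symmetric]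
    by (rule integrable_bounded_linear[OF cinner.bounded_linear_left int])
  show "cinner (resonant f) g = (LINT s:period|lborel. cinner (quintic_L2 (flow s f)) (flow s g))"
    unfolding resonant_def set_lebesgue_integral_def eq[symmetric]
    by (rule integral_bounded_linear[OF cinner.bounded_linear_left int, symmetric])
qed

lemma H6_eq: "H6 f = 2 / pi * (LINT t:period|lborel. sextic_integral (flow t f))"
  by (simp add: H6_def sextic_integral_def propagator_eq_flow)

text \<open>The linear coefficient is 2/pi from the Hamiltonian times 6 from the sixth power. For
  each \<open>\<epsilon>\<close> the times in the interval at which \<open>f\<close>,
  \<open>g\<close> or \<open>f + \<epsilon> *\<^sub>R g\<close> evolves into an element that is not
  regular form a null set, which is enough because the inequality is integrated in time.\<close>

lemma H6_taylor:
  assumes \<epsilon>: "\<bar>\<epsilon>\<bar> \<le> 1"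
  shows "\<bar>H6 (f + \<epsilon> *\<^sub>R g) - H6 f - \<epsilon> * (12 / pi * Re (cinner (resonant f) g))\<bar> \<le> 57 * (H6 f + H6 g) * \<epsilon>\<^sup>2"
proof -
  define S where "S h t = indicat_real period t * sextic_integral (flow t h)" for h t
  define D where "D t = indicat_real period t * Re (cinner (quintic_L2 (flow t f)) (flow t g))" for t
  have S_int: "integrable lborel (S h)" for h
    using set_integrable_sextic[of h] by (simp add: set_integrable_def S_def[abs_def])
  have H6: "H6 h = 2 / pi * (LINT t|lborel. S h t)" for h
    by (simp add: H6_eq set_lebesgue_integral_def S_def)
  have D_eq: "D t = Re (indicat_real period t *\<^sub>R cinner (quintic_L2 (flow t f)) (flow t g))" for t
    by (simp add: D_def)
  have D_int: "integrable lborel D"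
    unfolding D_eq using cinner_resonant(1)[of f g] by (intro integrable_Re) (simp add: set_integrable_def)
  have D: "Re (cinner (resonant f) g) = (LINT t|lborel. D t)"
    unfolding D_eq cinner_resonant(2) set_lebesgue_integral_def
    using cinner_resonant(1)[of f g] by (intro integral_Re[symmetric]) (simp add: set_integrable_def)
  let ?E = "\<lambda>t. S (f + \<epsilon> *\<^sub>R g) t - S f t - \<epsilon> * (6 * D t)"
  have E_int: "integrable lborel ?E"
    by (intro Bochner_Integration.integrable_diff S_int integrable_mult_right D_int)
  have eq: "H6 (f + \<epsilon> *\<^sub>R g) - H6 f - \<epsilon> * (12 / pi * Re (cinner (resonant f) g)) = 2 / pi * (LINT t|lborel. ?E t)"
    using S_int D_int by (simp add: H6 D algebra_simps diff_divide_distrib)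
  have "\<bar>2 / pi * (LINT t|lborel. ?E t)\<bar> = 2 / pi * \<bar>LINT t|lborel. ?E t\<bar>"
    by (simp add: abs_mult)
  also have "\<dots> \<le> 2 / pi * (LINT t|lborel. 57 * \<epsilon>\<^sup>2 * (S f t + S g t))"
  proof (intro mult_left_mono order_trans[OF integral_abs_bound] integral_mono_AE)
    show "AE t in lborel. \<bar>?E t\<bar> \<le> 57 * \<epsilon>\<^sup>2 * (S f t + S g t)"
      using AE_regular[of f] AE_regular[of g] AE_regular[of "f + \<epsilon> *\<^sub>R g"]
    proof eventually_elim
      case (elim t)
      show ?case
      proof (cases "t \<in> period")
        case True
        then show ?thesis
          using sextic_integral_taylor[of "flow t f" "flow t g" \<epsilon>] elim \<epsilon>
          by (simp add: S_def D_def flow_add flow_scaleR)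
      qed (simp add: S_def D_def)
    qed
  qed (use E_int S_int in auto)
  also have "\<dots> = 57 * (H6 f + H6 g) * \<epsilon>\<^sup>2"
    using S_int by (simp add: H6 algebra_simps)
  finally show ?thesis
    unfolding eq .
qed

lemma has_derivative_from_quadratic_bound:
  fixes h :: "real \<Rightarrow> real"
  assumes "\<And>\<epsilon>. \<bar>\<epsilon>\<bar> \<le> 1 \<Longrightarrow> \<bar>h \<epsilon> - h 0 - \<epsilon> * D\<bar> \<le> C * \<epsilon>\<^sup>2"
  shows "(h has_real_derivative D) (at 0)"
proof -
  have "((\<lambda>\<epsilon>. (h \<epsilon> - h 0) / \<epsilon> - D) \<longlongrightarrow> 0) (at 0)"
  proof (rule Lim_null_comparison)
    have "\<forall>\<^sub>F \<epsilon> in at (0::real). \<epsilon> \<in> {-1<..<1} - {0}"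
      by (rule eventually_at_in_open) auto
    then show "\<forall>\<^sub>F \<epsilon> in at 0. norm ((h \<epsilon> - h 0) / \<epsilon> - D) \<le> C * \<bar>\<epsilon>\<bar>"
    proof eventually_elim
      case (elim \<epsilon>)
      then have "(h \<epsilon> - h 0) / \<epsilon> - D = (h \<epsilon> - h 0 - \<epsilon> * D) / \<epsilon>"
        by (simp add: diff_divide_distrib)
      then have "norm ((h \<epsilon> - h 0) / \<epsilon> - D) = \<bar>h \<epsilon> - h 0 - \<epsilon> * D\<bar> / \<bar>\<epsilon>\<bar>"
        by (simp add: abs_divide)
      also have "\<dots> \<le> C * \<epsilon>\<^sup>2 / \<bar>\<epsilon>\<bar>"
        using elim by (intro divide_right_mono assms) auto
      also have "\<dots> = C * \<bar>\<epsilon>\<bar>"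
        using elim by (simp add: power2_eq_square abs_if)
      finally show ?case .
    qed
    have "((\<lambda>\<epsilon>. C * \<bar>\<epsilon>\<bar>) \<longlongrightarrow> C * \<bar>0\<bar>) (at (0::real))"
      by (intro tendsto_intros)
    then show "((\<lambda>\<epsilon>. C * \<bar>\<epsilon>\<bar>) \<longlongrightarrow> 0) (at (0::real))"
      by simp
  qed
  then show ?thesis
    unfolding DERIV_def by (simp add: LIM_zero_iff)
qed

text \<open>Multiplication by \<open>- \<i>\<close> turns minus the imaginary part of a pairing into
  its real part, the form in which the derivative appears.\<close>

definition H6_gradient :: "L2 \<Rightarrow> L2" where
  "H6_gradient f = (- \<i>) *\<^sub>C (12 / pi) *\<^sub>R resonant f"

lemma symplectic_H6_gradient: "symplectic_form (H6_gradient f) g = 12 / pi * Re (cinner (resonant f) g)"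
  by (simp add: symplectic_form_def H6_gradient_def cinner_scaleC_left cinner.scaleR_left)

lemma is_symplectic_gradient_H6: "is_symplectic_gradient H6 f (H6_gradient f)"
  unfolding is_symplectic_gradient_def symplectic_H6_gradient
proof
  fix g
  show "((\<lambda>\<epsilon>. H6 (f + \<epsilon> *\<^sub>R g)) has_real_derivative 12 / pi * Re (cinner (resonant f) g)) (at 0)"
    using H6_taylor[of _ f g] by (intro has_derivative_from_quadratic_bound[where C = "57 * (H6 f + H6 g)"]) simp
qed

text \<open>Nondegeneracy of the symplectic form: testing with \<open>\<i>\<close> times the
  difference produces, up to sign, its squared norm.\<close>

lemma symplectic_gradient_unique:
  assumes "is_symplectic_gradient \<H> f v" "is_symplectic_gradient \<H> f w"
  shows "v = w"
proof -
  have "symplectic_form v g = symplectic_form w g" for g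
    using assms unfolding is_symplectic_gradient_def by (blast intro: DERIV_unique)
  then have "Im (cinner (v - w) g) = 0" for g
    by (simp add: symplectic_form_def cinner.diff_left)
  from this[of "\<i> *\<^sub>C (v - w)"] have "norm (v - w) = 0"
    by (simp add: cinner_scaleC_right cinner_self)
  then show ?thesis by simp
qed

lemma hamilton_equation_H6: "hamilton_equation H6 f f' \<longleftrightarrow> resonant_equation (12 / pi) f f'"
proof -
  have "symplectic_gradient H6 f = H6_gradient f"
    unfolding symplectic_gradient_def
    by (intro the_equality is_symplectic_gradient_H6 symplectic_gradient_unique[OF _ is_symplectic_gradient_H6])
  moreover have "f' = (- \<i>) *\<^sub>C v \<longleftrightarrow> \<i> *\<^sub>C f' = v" for v
    by (auto simp: scaleC_scaleC)
  ultimately show ?thesis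
    by (simp only: hamilton_equation_def resonant_equation_def H6_gradient_def resonant_def)
qed

section \<open>Rescaling of time\<close>

lemma scaleC_scaleR: "c *\<^sub>C r *\<^sub>R f = r *\<^sub>R c *\<^sub>C f"
  by (rule scaleC.scaleR_right)

lemma resonant_equation_scaleR:
  assumes "r \<noteq> 0"
  shows "resonant_equation (r * c) f (r *\<^sub>R f') \<longleftrightarrow> resonant_equation c f f'"
  using assms by (simp add: resonant_equation_def scaleC_scaleR flip: scaleR_scaleR)

text \<open>The chain rule multiplies the time derivative by \<open>r\<close>, and the equation is
  linear in that derivative. Using the rule with a factor and with its inverse gives both directions
  of the final equivalence.\<close>

lemma solution_on_rescale:
  assumes u: "solution_on I (resonant_equation c) u" and r: "r \<noteq> 0"
  shows "solution_on ((\<lambda>t. t / r) ` I) (resonant_equation (r * c)) (\<lambda>t. u (r * t))"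
  unfolding solution_on_def
proof
  fix s
  assume "s \<in> (\<lambda>t. t / r) ` I"
  then obtain t where t: "t \<in> I" "s = t / r"
    by auto
  then obtain u' where u': "(u has_vector_derivative u') (at t within I)" "resonant_equation c (u t) u'"
    using u by (auto simp: solution_on_def)
  have img: "(\<lambda>s. r * s) ` (\<lambda>t. t / r) ` I = I"
    using r by (auto simp: image_image)
  have "((\<lambda>s. r * s) has_vector_derivative r) (at s within (\<lambda>t. t / r) ` I)"
    by (auto intro!: derivative_eq_intros)
  moreover have "(u has_vector_derivative u') (at (r * s) within (\<lambda>s. r * s) ` (\<lambda>t. t / r) ` I)"
    using u'(1) t(2) r by (simp add: img)
  ultimately have "(u \<circ> (\<lambda>s. r * s) has_vector_derivative r *\<^sub>R u') (at s within (\<lambda>t. t / r) ` I)"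
    by (rule vector_diff_chain_within)
  moreover have "resonant_equation (r * c) (u (r * s)) (r *\<^sub>R u')"
    using u'(2) t(2) r by (simp add: resonant_equation_scaleR)
  ultimately show "\<exists>u'. ((\<lambda>t. u (r * t)) has_vector_derivative u') (at s within (\<lambda>t. t / r) ` I) \<and> resonant_equation (r * c) (u (r * s)) u'"
    by (auto simp: o_def)
qed

theorem theorem3p1:
  shows
    "(\<forall>f.
        (AE t in lborel. t \<in> {-pi/4..pi/4} \<longrightarrow>
           integrable lborel (\<lambda>x. cmod (rep_L2 (propagator t f) x) ^ 6)) \<and>
        set_integrable lborel {-pi/4..pi/4}
          (\<lambda>t. LINT x|lborel. cmod (rep_L2 (propagator t f) x) ^ 6) \<and>
        (AE s in lborel. s \<in> {-pi/4..pi/4} \<longrightarrow>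
           square_integrable (quintic (rep_L2 (propagator s f)))) \<and>
        set_integrable lborel {-pi/4..pi/4} (resonant_integrand f)) \<and>
     (\<forall>f. (\<exists>!v. is_symplectic_gradient H6 f v) \<and>
        (\<forall>f'. hamilton_equation H6 f f' \<longleftrightarrow> resonant_equation (12 / pi) f f')) \<and>
     (\<forall>I u. is_interval I \<longrightarrow>
        (solution_on I (hamilton_equation H6) u \<longleftrightarrow>
         solution_on I (resonant_equation (12 / pi)) u)) \<and>
     (\<forall>I u. is_interval I \<longrightarrow>
        (solution_on I (resonant_equation (12 / pi)) u \<longleftrightarrow>
         solution_on ((\<lambda>t. 6 * t) ` I) (resonant_equation (2 / pi)) (\<lambda>t. u (t / 6))))"
proof (intro conjI allI impI)
  fix f
  show "AE t in lborel. t \<in> period \<longrightarrow> integrable lborel (\<lambda>x. cmod (rep_L2 (propagator t f) x) ^ 6)"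
    using AE_regular[of f] by eventually_elim (simp add: propagator_eq_flow regular_sextic(1))
  show "set_integrable lborel period (\<lambda>t. LINT x|lborel. cmod (rep_L2 (propagator t f) x) ^ 6)"
    using set_integrable_sextic[of f] by (simp add: propagator_eq_flow sextic_integral_def)
  show "AE s in lborel. s \<in> period \<longrightarrow> square_integrable (quintic (rep_L2 (propagator s f)))"
    using AE_regular[of f] by eventually_elim (simp add: propagator_eq_flow regular_iff)
  show "set_integrable lborel period (resonant_integrand f)"
    by (rule set_integrable_resonant)
  show "\<exists>!v. is_symplectic_gradient H6 f v"
    by (rule ex1I[of _ "H6_gradient f"])
      (auto intro: is_symplectic_gradient_H6 symplectic_gradient_unique)
  show "hamilton_equation H6 f f' \<longleftrightarrow> resonant_equation (12 / pi) f f'" for f'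
    by (rule hamilton_equation_H6)
next
  fix I u
  show "solution_on I (hamilton_equation H6) u \<longleftrightarrow> solution_on I (resonant_equation (12 / pi)) u"
    by (simp add: solution_on_def hamilton_equation_H6)
  show "solution_on I (resonant_equation (12 / pi)) u \<longleftrightarrow>
      solution_on ((\<lambda>t. 6 * t) ` I) (resonant_equation (2 / pi)) (\<lambda>t. u (t / 6))"
  proof
    assume "solution_on I (resonant_equation (12 / pi)) u"
    \<comment> \<open>Here one sixth of 12/pi is 2/pi, and dividing times by 1/6 dilates the
      interval by 6.\<close>
    from solution_on_rescale[OF this, of "1/6"]
    show "solution_on ((\<lambda>t. 6 * t) ` I) (resonant_equation (2 / pi)) (\<lambda>t. u (t / 6))"
      by (simp add: mult.commute)
  next
    assume "solution_on ((\<lambda>t. 6 * t) ` I) (resonant_equation (2 / pi)) (\<lambda>t. u (t / 6))"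
    from solution_on_rescale[OF this, of 6]
    show "solution_on I (resonant_equation (12 / pi)) u"
      by (simp add: image_image)
  qed
qed

end
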